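(* Every $k$-tunnel gadget that is reversible, deterministic, and has interacting tunnels simulates, in planar systems, each of the parallel, antiparallel, and crossing locking 2-toggles.
   Context: A gadget consists of finitely many locations and finitely many states; each state $s$ has a set of transitions $(a,b,s')$ meaning a robot may enter at $a$, exit at $b$, and the state becomes $s'$. The transition graph has an edge $(s,a)\to(s',b)$ for each transition. A $k$-tunnel gadget has $2k$ locations partitioned into $k$ pairs called tunnels, every transition going between the two locations of one tunnel. It has interacting tunnels if some transition across a tunnel from $s$ to $s'$ changes the set of allowed traversal directions of some other tunnel; it is deterministic if the transition graph has out-degree at most 1, and reversible if the reverse of every transition-graph edge is an edge. The locking 2-toggle has tunnels $\{a_1,b_1\},\{a_2,b_2\}$ and states $M,S_1,S_2$: in $M$ the only transitions are $a_1\to b_1$ (to $S_1$) and $a_2\to b_2$ (to $S_2$); in $S_i$ the only transition is $b_i\to a_i$ (to $M$). For planar systems, a gadget's locations carry a cyclic order; the parallel locking 2-toggle has cyclic order $(a_1,b_1,b_2,a_2)$, the antiparallel one $(a_1,b_1,a_2,b_2)$, and the crossing one $(a_1,a_2,b_1,b_2)$. A system of gadgets consists of copies of gadgets, initial states, and a connection graph on locations; the robot moves freely along connection-graph paths and traverses gadgets according to their states. A system is planar if replacing each gadget by a wheel graph (cycle on its locations in cyclic order plus a hub adjacent to each) and adding the connection edges gives a planar graph (gadgets may be rotated and reflected). A gadget $G$ simulates $H$ in planar systems if there is a planar system of copies of $G$ with designated locations, appearing on the outer boundary in the cyclic order of $H$'s locations, playing the roles of $H$'s locations, and with each state of $H$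 corresponding to a configuration of the system, such that from the configuration of any state $q$, a robot entering at designated location $a$ can exit at designated location $b$ leaving the configuration of state $q'$ exactly when $H$ has transition $(a,b,q')$ in state $q$, and no other behavior is possible. *)

theory Defs
  imports "HOL-Analysis.Analysis" "HOL-Library.Disjoint_Sets"
begin

text \<open>The list \<open>locs\<close> carries the cyclic order of the locations; it is read up to rotation
  and reversal. A triple \<open>(a, b, s')\<close> in \<open>transitions G s\<close> lets the robot enter at \<open>a\<close> and exit
  at \<open>b\<close>, changing the state from \<open>s\<close> to \<open>s'\<close>.\<close>

record ('l, 's) gadget =
  locs :: "'l list"
  states :: "'s set"
  transitions :: "'s \<Rightarrow> ('l \<times> 'l \<times> 's) set"

definition is_gadget :: "('l, 's) gadget \<Rightarrow> bool" where
  "is_gadget G \<longleftrightarrow>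
     distinct (locs G) \<and> finite (states G) \<and>
     (\<forall>s \<in> states G. transitions G s \<subseteq> set (locs G) \<times> set (locs G) \<times> states G)"

definition transition_graph :: "('l, 's) gadget \<Rightarrow> (('s \<times> 'l) \<times> ('s \<times> 'l)) set" where
  "transition_graph G =
     {((s, a), (s', b)) | s a s' b. s \<in> states G \<and> (a, b, s') \<in> transitions G s}"

definition deterministic :: "('l, 's) gadget \<Rightarrow> bool" where
  "deterministic G \<longleftrightarrow> single_valued (transition_graph G)"

definition reversible :: "('l, 's) gadget \<Rightarrow> bool" where
  "reversible G \<longleftrightarrow> sym (transition_graph G)"

definition k_tunnel_gadget :: "nat \<Rightarrow> ('l, 's) gadget \<Rightarrow> 'l set set \<Rightarrow> bool" where
  "k_tunnel_gadget k G P \<longleftrightarrow>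
     is_gadget G \<and> length (locs G) = 2 * k \<and>
     partition_on (set (locs G)) P \<and> card P = k \<and> (\<forall>T \<in> P. card T = 2) \<and>
     (\<forall>s \<in> states G. \<forall>(a, b, s') \<in> transitions G s. a \<noteq> b \<and> {a, b} \<in> P)"

definition allowed_directions :: "('l, 's) gadget \<Rightarrow> 's \<Rightarrow> 'l set \<Rightarrow> ('l \<times> 'l) set" where
  "allowed_directions G s T = {(a, b). {a, b} = T \<and> (\<exists>s'. (a, b, s') \<in> transitions G s)}"

definition interacting_tunnels :: "('l, 's) gadget \<Rightarrow> 'l set set \<Rightarrow> bool" where
  "interacting_tunnels G P \<longleftrightarrow>
     (\<exists>s \<in> states G. \<exists>(a, b, s') \<in> transitions G s. \<exists>T \<in> P.
        T \<noteq> {a, b} \<and> allowed_directions G s T \<noteq> allowed_directions G s' T)"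


datatype toggle_loc = A1 | B1 | A2 | B2
datatype toggle_state = M | S1 | S2

definition locking_2_toggle :: "toggle_loc list \<Rightarrow> (toggle_loc, toggle_state) gadget" where
  "locking_2_toggle cyc =
     \<lparr>locs = cyc,
      states = {M, S1, S2},
      transitions = (\<lambda>s. case s of
          M \<Rightarrow> {(A1, B1, S1), (A2, B2, S2)}
        | S1 \<Rightarrow> {(B1, A1, M)}
        | S2 \<Rightarrow> {(B2, A2, M)})\<rparr>"

definition parallel_locking_2_toggle :: "(toggle_loc, toggle_state) gadget" where
  "parallel_locking_2_toggle = locking_2_toggle [A1, B1, B2, A2]"

definition antiparallel_locking_2_toggle :: "(toggle_loc, toggle_state) gadget" where
  "antiparallel_locking_2_toggle = locking_2_toggle [A1, B1, A2, B2]"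

definition crossing_locking_2_toggle :: "(toggle_loc, toggle_state) gadget" where
  "crossing_locking_2_toggle = locking_2_toggle [A1, A2, B1, B2]"


text \<open>Location \<open>l\<close> of the \<open>i\<close>-th gadget of a system is \<open>(i, l)\<close>. Connection edges are two-element
  sets of such locations. The states of the gadgets are not stored in the system but in a separate
  configuration, the list of current states; a choice of initial states is a configuration.\<close>

record ('l, 's) system =
  gadgets :: "('l, 's) gadget list"
  connections :: "(nat \<times> 'l) set set"

definition system_locs :: "('l, 's) system \<Rightarrow> (nat \<times> 'l) set" where
  "system_locs S = {(i, l). i < length (gadgets S) \<and> l \<in> set (locs (gadgets S ! i))}"

definition is_system :: "('l, 's) system \<Rightarrow> bool" where
  "is_system S \<longleftrightarrow>
     (\<forall>G \<in> set (gadgets S). is_gadget G) \<and>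
     (\<forall>e \<in> connections S. e \<subseteq> system_locs S \<and> card e = 2)"

definition configurations :: "('l, 's) system \<Rightarrow> 's list set" where
  "configurations S =
     {c. length c = length (gadgets S) \<and>
         (\<forall>i < length (gadgets S). c ! i \<in> states (gadgets S ! i))}"

inductive robot_step ::
  "('l, 's) system \<Rightarrow> 's list \<times> (nat \<times> 'l) \<Rightarrow> 's list \<times> (nat \<times> 'l) \<Rightarrow> bool"
  for S where
  connect: "{x, y} \<in> connections S \<Longrightarrow> robot_step S (c, x) (c, y)"
| traverse: "i < length (gadgets S) \<Longrightarrow> (a, b, s') \<in> transitions (gadgets S ! i) (c ! i) \<Longrightarrow>
    robot_step S (c, (i, a)) (c[i := s'], (i, b))"

text \<open>A passage through a system with set \<open>D\<close> of designated locations: the robot enters at the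
  location of \<open>x\<close> and exits at that of \<open>y\<close>, meeting no designated location in between (walking on
  from a designated location amounts to exiting and entering again). Leaving at once, without
  having moved, is included.\<close>

definition passage ::
  "('l, 's) system \<Rightarrow> (nat \<times> 'l) set \<Rightarrow> 's list \<times> (nat \<times> 'l) \<Rightarrow> 's list \<times> (nat \<times> 'l) \<Rightarrow> bool"
  where
  "passage S D x y \<longleftrightarrow>
     x = y \<or>
     (\<exists>z. (\<lambda>u v. robot_step S u v \<and> snd v \<notin> D)\<^sup>*\<^sup>* x z \<and> robot_step S z y)"


definition plane_drawing ::
  "'v set \<Rightarrow> 'v set set \<Rightarrow> ('v \<Rightarrow> complex) \<Rightarrow> ('v set \<Rightarrow> real \<Rightarrow> complex) \<Rightarrow> bool" where
  "plane_drawing V E p \<gamma> \<longleftrightarrow>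
     inj_on p V \<and>
     (\<forall>e \<in> E. arc (\<gamma> e) \<and> {pathstart (\<gamma> e), pathfinish (\<gamma> e)} = p ` e \<and>
        path_image (\<gamma> e) \<inter> p ` V = p ` e) \<and>
     (\<forall>e \<in> E. \<forall>f \<in> E. e \<noteq> f \<longrightarrow> path_image (\<gamma> e) \<inter> path_image (\<gamma> f) \<subseteq> p ` (e \<inter> f))"

definition drawing_image ::
  "'v set \<Rightarrow> 'v set set \<Rightarrow> ('v \<Rightarrow> complex) \<Rightarrow> ('v set \<Rightarrow> real \<Rightarrow> complex) \<Rightarrow> complex set" where
  "drawing_image V E p \<gamma> = p ` V \<union> (\<Union>e \<in> E. path_image (\<gamma> e))"

text \<open>The vertices in \<open>ds\<close> lie on the outer boundary of the drawing in the given cyclic order: some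
  simple closed curve encloses the drawing and passes through them in this order.\<close>

definition on_outer_boundary ::
  "'v set \<Rightarrow> 'v set set \<Rightarrow> ('v \<Rightarrow> complex) \<Rightarrow> ('v set \<Rightarrow> real \<Rightarrow> complex) \<Rightarrow> 'v list \<Rightarrow> bool" where
  "on_outer_boundary V E p \<gamma> ds \<longleftrightarrow>
     (\<exists>\<beta> ts. simple_path \<beta> \<and> pathfinish \<beta> = pathstart \<beta> \<and>
        drawing_image V E p \<gamma> \<subseteq> path_image \<beta> \<union> inside (path_image \<beta>) \<and>
        sorted_wrt (<) ts \<and> set ts \<subseteq> {0..<1} \<and> map \<beta> ts = map p ds)"

datatype 'l vertex = Loc "nat \<times> 'l" | Hub nat

definition system_vertices :: "('l, 's) system \<Rightarrow> 'l vertex set" where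
  "system_vertices S = Loc ` system_locs S \<union> Hub ` {..<length (gadgets S)}"

definition wheel_edges :: "nat \<Rightarrow> 'l list \<Rightarrow> 'l vertex set set" where
  "wheel_edges i ls =
     {{Loc (i, ls ! j), Loc (i, ls ! (Suc j mod length ls))} | j. j < length ls \<and> length ls \<ge> 2} \<union>
     {{Hub i, Loc (i, l)} | l. l \<in> set ls}"

definition system_edges :: "('l, 's) system \<Rightarrow> 'l vertex set set" where
  "system_edges S =
     (\<Union>i < length (gadgets S). wheel_edges i (locs (gadgets S ! i))) \<union>
     (\<lambda>e. Loc ` e) ` connections S"

text \<open>Planarity of a system together with the position of its designated locations. As planarity of
  an abstract graph is asked for, each gadget may be rotated and reflected individually.\<close>

definition planar_system_with_boundary :: "('l, 's) system \<Rightarrow> (nat \<times> 'l) list \<Rightarrow> bool" where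
  "planar_system_with_boundary S ds \<longleftrightarrow>
     (\<exists>p \<gamma>. plane_drawing (system_vertices S) (system_edges S) p \<gamma> \<and>
            on_outer_boundary (system_vertices S) (system_edges S) p \<gamma> (map Loc ds))"


text \<open>\<open>ext\<close> designates the locations playing the roles of those of \<open>H\<close>, and \<open>conf\<close> gives the
  configuration of each state of \<open>H\<close>. The alternative \<open>a = b \<and> q = q'\<close> accounts for the robot
  leaving where it entered without any net change, which no system can prevent.\<close>

definition simulates_planar :: "('l, 's) gadget \<Rightarrow> ('m, 't) gadget \<Rightarrow> bool" where
  "simulates_planar G H \<longleftrightarrow>
     (\<exists>S ext conf.
        is_system S \<and> set (gadgets S) \<subseteq> {G} \<and>
        inj_on ext (set (locs H)) \<and> ext ` set (locs H) \<subseteq> system_locs S \<and>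
        planar_system_with_boundary S (map ext (locs H)) \<and>
        conf ` states H \<subseteq> configurations S \<and>
        (\<forall>q \<in> states H. \<forall>a \<in> set (locs H). \<forall>b \<in> set (locs H).
           (\<forall>q' \<in> states H.
              passage S (ext ` set (locs H)) (conf q, ext a) (conf q', ext b) \<longleftrightarrow>
              (a, b, q') \<in> transitions H q \<or> a = b \<and> q = q') \<and>
           (\<forall>c. passage S (ext ` set (locs H)) (conf q, ext a) (c, ext b) \<longrightarrow>
              c \<in> conf ` states H)))"

end

theory Submission
  imports Defs "HOL-Complex_Analysis.Contour_Integration"
begin

text \<open>Determinism and reversibility make every tunnel a partial injection on the states. By
  interaction there are tunnels \<open>{a, b}\<close>, \<open>{c, d}\<close> and a state \<open>s0\<close> such that \<open>a \<rightarrow> b\<close> leads from \<open>s0\<close>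
  to a state in which \<open>c \<rightarrow> d\<close>, possible in \<open>s0\<close>, is blocked. Take two copies in state \<open>s0\<close> and let one
  route pass \<open>a \<rightarrow> b\<close> in the first and \<open>c \<rightarrow> d\<close> in the second copy, the other route conversely: either
  route blocks the other one. Four more copies make both routes one-way, which yields a locking
  2-toggle whose type depends on the cyclic order of \<open>a, b, c, d\<close>: parallel if the tunnels are
  parallel, antiparallel if they are antiparallel, and either of the two, at will, if they cross.

  It remains to convert the types. Two antiparallel toggles around a common junction give a crossing
  one, and so do seven parallel ones. In the latter case a single crossing of the routes does not
  suffice, as parallel toggles cannot keep the robot from changing routes there; five crossings do.
  A crossing toggle, in turn, gives the other two types by the first construction.

  Planarity is handled combinatorially: a system is assembled in a disc by taking disjoint unions and
  connecting neighbours on the boundary. Each such operation is realised by a homeomorphism of the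
  closed half plane, with the boundary locations on the real axis.\<close>

section \<open>Drawings in the half plane\<close>

text \<open>Two obstacles shape the construction. A tunnel that blocks another one may itself be
  open in both directions and remain so, hence the two central copies alone could be run backwards
  or repeatedly. This is why a word is sought, a sequence of tunnel crossings in one copy, that can
  be run once but not twice. A single crossing need not be such a word; if none is, finiteness of
  the state set yields one that crosses both tunnels. Of the two extra copies on a route, one bars a
  second run, and the other, which starts in the state after the word and carries its reverse, bars
  the way back. The second obstacle is composition: in the middle of a simulated traversal the
  configuration need not stand for any state of the simulated gadget, so systems are compared only
  between visits to designated locations. Planarity composes because it is given as a derivation, in
  which each basic disc can be replaced by a whole system with the same boundary order.\<close>

definition half_plane_drawing ::
  "'v set \<Rightarrow> 'v set set \<Rightarrow> ('v \<Rightarrow> complex) \<Rightarrow> ('v set \<Rightarrow> real \<Rightarrow> complex) \<Rightarrow> 'v list \<Rightarrow> bool" where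
  "half_plane_drawing V E p \<gamma> ds \<longleftrightarrow>
     plane_drawing V E p \<gamma> \<and> finite V \<and> finite E \<and> (\<forall>e \<in> E. e \<subseteq> V \<and> e \<noteq> {}) \<and>
     set ds \<subseteq> V \<and> sorted_wrt (<) (map (\<lambda>v. Re (p v)) ds) \<and> (\<forall>v \<in> set ds. Im (p v) = 0) \<and>
     (\<forall>z \<in> drawing_image V E p \<gamma>. Im z \<le> 0 \<and> (Im z = 0 \<longrightarrow> z \<in> p ` set ds))"

text \<open>In the half plane the boundary order is the order of real parts, juxtaposition is a
  translation, and a connection of neighbours is a segment of the axis. Since the axis meets the
  drawing only in terminals, such a segment, or a pole placed between two terminals, misses the
  rest.\<close>

definition half_plane_drawable :: "'v set \<Rightarrow> 'v set set \<Rightarrow> 'v list \<Rightarrow> bool" where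
  "half_plane_drawable V E ds \<longleftrightarrow> (\<exists>p \<gamma>. half_plane_drawing V E p \<gamma> ds)"

lemma plane_drawingD:
  assumes "plane_drawing V E p \<gamma>"
  shows "inj_on p V"
    and "e \<in> E \<Longrightarrow> arc (\<gamma> e)"
    and "e \<in> E \<Longrightarrow> {pathstart (\<gamma> e), pathfinish (\<gamma> e)} = p ` e"
    and "e \<in> E \<Longrightarrow> path_image (\<gamma> e) \<inter> p ` V = p ` e"
    and "e \<in> E \<Longrightarrow> f \<in> E \<Longrightarrow> e \<noteq> f \<Longrightarrow> path_image (\<gamma> e) \<inter> path_image (\<gamma> f) \<subseteq> p ` (e \<inter> f)"
  using assms unfolding plane_drawing_def by blast+

lemma arc_compose:
  assumes "arc g" "continuous_on (path_image g) h" "inj_on h (path_image g)"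
  shows "arc (h \<circ> g)"
  using assms unfolding arc_def path_def path_image_def
  by (metis comp_inj_on continuous_on_compose)

lemma drawing_image_compose:
  "drawing_image V E (h \<circ> p) (\<lambda>e. h \<circ> \<gamma> e) = h ` drawing_image V E p \<gamma>"
  by (auto simp: drawing_image_def path_image_compose)

lemma drawing_image_vertex: "v \<in> V \<Longrightarrow> p v \<in> drawing_image V E p \<gamma>"
  by (simp add: drawing_image_def)

lemma drawing_image_edge: "e \<in> E \<Longrightarrow> z \<in> path_image (\<gamma> e) \<Longrightarrow> z \<in> drawing_image V E p \<gamma>"
  by (auto simp: drawing_image_def)

lemma plane_drawing_compose:
  assumes d: "plane_drawing V E p \<gamma>" and sub: "\<forall>e \<in> E. e \<subseteq> V"
    and c: "continuous_on (drawing_image V E p \<gamma>) h" and i: "inj_on h (drawing_image V E p \<gamma>)"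
  shows "plane_drawing V E (h \<circ> p) (\<lambda>e. h \<circ> \<gamma> e)"
  unfolding plane_drawing_def
proof (intro conjI ballI impI)
  let ?D = "drawing_image V E p \<gamma>"
  have pV: "p ` V \<subseteq> ?D" and pi: "\<And>e. e \<in> E \<Longrightarrow> path_image (\<gamma> e) \<subseteq> ?D"
    by (auto simp: drawing_image_def)
  show "inj_on (h \<circ> p) V"
    using d i pV by (auto simp: plane_drawing_def intro!: comp_inj_on intro: inj_on_subset)
  fix e assume e: "e \<in> E"
  show "arc (h \<circ> \<gamma> e)"
    using d e pi[OF e] c i
    by (auto simp: plane_drawing_def intro!: arc_compose intro: continuous_on_subset inj_on_subset)
  have "{pathstart (\<gamma> e), pathfinish (\<gamma> e)} = p ` e"
    using d e by (auto simp: plane_drawing_def)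
  then have "h ` {pathstart (\<gamma> e), pathfinish (\<gamma> e)} = h ` p ` e" by simp
  then show "{pathstart (h \<circ> \<gamma> e), pathfinish (h \<circ> \<gamma> e)} = (h \<circ> p) ` e"
    by (simp add: pathstart_compose pathfinish_compose image_comp)
  have "path_image (\<gamma> e) \<inter> p ` V = p ` e"
    using d e by (auto simp: plane_drawing_def)
  then have "h ` (path_image (\<gamma> e) \<inter> p ` V) = h ` p ` e" by simp
  then show "path_image (h \<circ> \<gamma> e) \<inter> (h \<circ> p) ` V = (h \<circ> p) ` e"
    using inj_on_image_Int[OF i pi[OF e] pV]
    by (simp add: path_image_compose image_comp)
  fix f assume f: "f \<in> E" "e \<noteq> f"
  have "path_image (\<gamma> e) \<inter> path_image (\<gamma> f) \<subseteq> p ` (e \<inter> f)"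
    using d e f by (auto simp: plane_drawing_def)
  then have "h ` (path_image (\<gamma> e) \<inter> path_image (\<gamma> f)) \<subseteq> h ` p ` (e \<inter> f)" by blast
  then show "path_image (h \<circ> \<gamma> e) \<inter> path_image (h \<circ> \<gamma> f) \<subseteq> (h \<circ> p) ` (e \<inter> f)"
    using inj_on_image_Int[OF i pi[OF e] pi[OF f(1)]]
    by (simp add: path_image_compose image_comp)
qed

text \<open>Shearing downwards by an amount that vanishes exactly below the terminals pushes everything
  else off the real axis.\<close>

lemma half_plane_drawable_shear:
  assumes d: "plane_drawing V E p \<gamma>" and fin: "finite V" "finite E" "\<forall>e \<in> E. e \<subseteq> V \<and> e \<noteq> {}"
    and ds: "set ds \<subseteq> V" "sorted_wrt (<) (map (\<lambda>v. Re (p v)) ds)" "\<forall>v \<in> set ds. Im (p v) = 0"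
    and le: "\<forall>z \<in> drawing_image V E p \<gamma>. Im z \<le> 0"
  shows "half_plane_drawable V E ds"
proof -
  \<comment> \<open>\<open>m\<close> vanishes exactly at the abscissae of the terminals. Without
    terminals the empty product is 1, and the whole drawing moves below the axis.\<close>
  define m where "m x = (\<Prod>v\<in>set ds. \<bar>x - Re (p v)\<bar>)" for x :: real
  define h where "h z = z - \<i> * of_real (m (Re z))" for z
  have Re_h [simp]: "Re (h z) = Re z" and Im_h [simp]: "Im (h z) = Im z - m (Re z)" for z
    by (auto simp: h_def)
  have m0: "m x \<ge> 0" for x by (auto simp: m_def prod_nonneg)
  have m_eq: "m x = 0 \<longleftrightarrow> (\<exists>v\<in>set ds. x = Re (p v))" for x
    by (auto simp: m_def)
  have fix_h: "h (p v) = p v" if "v \<in> set ds" for v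
    using that m_eq[of "Re (p v)"] by (auto simp: complex_eq_iff)
  have cont: "continuous_on A h" for A
    unfolding h_def m_def by (intro continuous_intros)
  have "z = w" if "h z = h w" for z w
  proof -
    have r: "Re z = Re w" using arg_cong[OF that, of Re] by simp
    then show ?thesis using arg_cong[OF that, of Im] by (simp add: complex_eq_iff)
  qed
  then have inj: "inj_on h A" for A by (auto intro: inj_onI)
  have "half_plane_drawing V E (h \<circ> p) (\<lambda>e. h \<circ> \<gamma> e) ds"
    unfolding half_plane_drawing_def drawing_image_compose
  proof (intro conjI ballI impI)
    show "plane_drawing V E (h \<circ> p) (\<lambda>e. h \<circ> \<gamma> e)"
      using d fin cont inj by (intro plane_drawing_compose) auto
    fix z assume "z \<in> h ` drawing_image V E p \<gamma>"
    then obtain w where w: "w \<in> drawing_image V E p \<gamma>" "z = h w" by auto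
    show "Im z \<le> 0" using w le m0[of "Re w"] by force
    show "z \<in> (h \<circ> p) ` set ds" if "Im z = 0"
    proof -
      have *: "Im w = 0" "m (Re w) = 0" using that w le m0[of "Re w"] by force+
      then obtain v where v: "v \<in> set ds" "Re w = Re (p v)" using m_eq by auto
      then have "w = p v" using * ds by (auto simp: complex_eq_iff)
      then show ?thesis using v w by auto
    qed
  next
    show "Im ((h \<circ> p) v) = 0" if "v \<in> set ds" for v using fix_h[OF that] ds that by simp
  qed (use fin ds in auto)
  then show ?thesis by (auto simp: half_plane_drawable_def)
qed

text \<open>The former terminal only has to leave the axis, which the shear for the remaining
  terminals achieves.\<close>

lemma half_plane_drawable_drop:
  assumes "half_plane_drawable V E (x # ds)"
  shows "half_plane_drawable V E ds"
proof -
  obtain p \<gamma> where "half_plane_drawing V E p \<gamma> (x # ds)"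
    using assms by (auto simp: half_plane_drawable_def)
  then show ?thesis
    by (intro half_plane_drawable_shear[of V E p \<gamma>]) (auto simp: half_plane_drawing_def)
qed

text \<open>The new edge is the segment of the axis between the two neighbours. It meets the drawing
  only at its ends, and a shear then pushes its interior below the axis, which again contains
  terminals only.\<close>

lemma half_plane_drawable_connect:
  assumes "half_plane_drawable V E (x # y # ds)"
  shows "half_plane_drawable V (insert {x, y} E) (x # y # ds)"
proof (cases "{x, y} \<in> E")
  case True
  then show ?thesis using assms by (simp add: insert_absorb)
next
  case False
  obtain p \<gamma> where h: "half_plane_drawing V E p \<gamma> (x # y # ds)"
    using assms by (auto simp: half_plane_drawable_def)
  have pd: "plane_drawing V E p \<gamma>" and inV: "x \<in> V" "y \<in> V"
    and lt: "Re (p x) < Re (p y)" "\<And>v. v \<in> set ds \<Longrightarrow> Re (p y) < Re (p v)"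
    and im: "Im (p x) = 0" "Im (p y) = 0" "\<And>v. v \<in> set ds \<Longrightarrow> Im (p v) = 0"
    and img: "\<And>z. z \<in> drawing_image V E p \<gamma> \<Longrightarrow> Im z \<le> 0 \<and> (Im z = 0 \<longrightarrow> z \<in> p ` set (x # y # ds))"
    and E: "\<And>e. e \<in> E \<Longrightarrow> e \<subseteq> V \<and> e \<noteq> {}" "finite V" "finite E"
    and ds: "set ds \<subseteq> V" "sorted_wrt (<) (map (\<lambda>v. Re (p v)) (x # y # ds))"
    using h by (auto simp: half_plane_drawing_def)
  let ?l = "linepath (p x) (p y)"
  have neq: "p x \<noteq> p y" using lt by auto
  have seg: "Im z = 0 \<and> Re z \<le> Re (p y)" if z: "z \<in> path_image ?l" for z
  proof -
    obtain u where u: "0 \<le> u" "u \<le> 1" "z = (1 - u) *\<^sub>R p x + u *\<^sub>R p y"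
      using z by (auto simp: closed_segment_def)
    have "Re z = (1 - u) * Re (p x) + u * Re (p y)" using u by simp
    then have "Re z = Re (p y) - (1 - u) * (Re (p y) - Re (p x))" by (simp add: algebra_simps)
    moreover have "(1 - u) * (Re (p y) - Re (p x)) \<ge> 0" using u lt by simp
    ultimately show ?thesis using u im by simp
  qed
  have meet: "path_image ?l \<inter> drawing_image V E p \<gamma> \<subseteq> {p x, p y}"
  proof
    fix z assume z: "z \<in> path_image ?l \<inter> drawing_image V E p \<gamma>"
    then have "z \<in> p ` set (x # y # ds)" "Re z \<le> Re (p y)" using img seg by auto
    then show "z \<in> {p x, p y}" using lt by force
  qed
  define \<gamma>' where "\<gamma>' = \<gamma>({x, y} := ?l)"
  have g [simp]: "\<gamma>' e = \<gamma> e" if "e \<in> E" for e using that False by (auto simp: \<gamma>'_def)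
  have g2 [simp]: "\<gamma>' {x, y} = ?l" by (simp add: \<gamma>'_def)
  have cross: "path_image ?l \<inter> path_image (\<gamma> e) \<subseteq> p ` ({x, y} \<inter> e)" if e: "e \<in> E" for e
  proof
    fix z assume z: "z \<in> path_image ?l \<inter> path_image (\<gamma> e)"
    then have "z \<in> {p x, p y}" using meet drawing_image_edge[OF e] by blast
    then obtain v where v: "v \<in> {x, y}" "z = p v" by auto
    then have "z \<in> path_image (\<gamma> e) \<inter> p ` V" using z inV by auto
    moreover have "path_image (\<gamma> e) \<inter> p ` V = p ` e" using pd e by (auto simp: plane_drawing_def)
    ultimately have "z \<in> p ` e" by blast
    then have "v \<in> e" using v pd inV E(1)[OF e] by (auto simp: plane_drawing_def dest!: inj_onD)
    then show "z \<in> p ` ({x, y} \<inter> e)" using v by auto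
  qed
  have "plane_drawing V (insert {x, y} E) p \<gamma>'"
    unfolding plane_drawing_def
  proof (intro conjI ballI impI)
    show "inj_on p V" using pd by (simp add: plane_drawing_def)
    fix e assume e: "e \<in> insert {x, y} E"
    have new: "arc ?l" "{pathstart ?l, pathfinish ?l} = p ` {x, y}"
      "path_image ?l \<inter> p ` V = p ` {x, y}"
      using neq meet inV drawing_image_vertex[of _ V p E \<gamma>]
      by (auto simp: pathstart_in_path_image)
    show "arc (\<gamma>' e)" "{pathstart (\<gamma>' e), pathfinish (\<gamma>' e)} = p ` e"
      "path_image (\<gamma>' e) \<inter> p ` V = p ` e"
      using new plane_drawingD(2-4)[OF pd, of e] e
      by (cases "e \<in> E"; simp del: path_image_linepath)+
    fix f assume f: "f \<in> insert {x, y} E" "e \<noteq> f"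
    show "path_image (\<gamma>' e) \<inter> path_image (\<gamma>' f) \<subseteq> p ` (e \<inter> f)"
    proof (cases "e \<in> E \<and> f \<in> E")
      case True
      then show ?thesis using plane_drawingD(5)[OF pd, of e f] f by simp
    next
      case no: False
      show ?thesis
      proof (cases "e \<in> E")
        case True
        then have "f = {x, y}" using no f by auto
        then show ?thesis using cross[OF True] True by (auto simp del: path_image_linepath)
      next
        case no2: False
        then have "e = {x, y}" "f \<in> E" using e f by auto
        then show ?thesis using cross[of f] by (auto simp del: path_image_linepath)
      qed
    qed
  qed
  moreover have "\<forall>z \<in> drawing_image V (insert {x, y} E) p \<gamma>'. Im z \<le> 0"
  proof
    fix z assume "z \<in> drawing_image V (insert {x, y} E) p \<gamma>'"
    then have "z \<in> drawing_image V E p \<gamma> \<or> z \<in> path_image ?l"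
      by (auto simp: drawing_image_def simp del: path_image_linepath)
    then show "Im z \<le> 0" using img seg by fastforce
  qed
  ultimately show ?thesis
    using E ds inV im by (intro half_plane_drawable_shear[of V _ p \<gamma>']) auto
qed

text \<open>\<open>ds'\<close> may list the terminals in another order: a reflection or a Moebius
  transformation keeps the half plane and its axis, but not the order of the real parts.\<close>

lemma half_plane_drawing_compose:
  assumes h: "half_plane_drawing V E p \<gamma> ds"
    and c: "continuous_on (drawing_image V E p \<gamma>) h" and i: "inj_on h (drawing_image V E p \<gamma>)"
    and im: "\<And>z. z \<in> drawing_image V E p \<gamma> \<Longrightarrow> Im z < 0 \<Longrightarrow> Im (h z) < 0"
      "\<And>z. z \<in> drawing_image V E p \<gamma> \<Longrightarrow> Im z = 0 \<Longrightarrow> Im (h z) = 0"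
    and ds': "set ds' = set ds" "sorted_wrt (<) (map (\<lambda>v. Re (h (p v))) ds')"
  shows "half_plane_drawing V E (h \<circ> p) (\<lambda>e. h \<circ> \<gamma> e) ds'"
proof -
  have le: "Im z \<le> 0" and z0: "Im z = 0 \<Longrightarrow> z \<in> p ` set ds" if "z \<in> drawing_image V E p \<gamma>" for z
    using h that by (auto simp: half_plane_drawing_def)
  show ?thesis
    unfolding half_plane_drawing_def drawing_image_compose
  proof (intro conjI ballI impI)
    show "plane_drawing V E (h \<circ> p) (\<lambda>e. h \<circ> \<gamma> e)"
      using h c i by (intro plane_drawing_compose) (auto simp: half_plane_drawing_def)
    show "Im ((h \<circ> p) v) = 0" if v: "v \<in> set ds'" for v
      using v h ds' by (auto simp: half_plane_drawing_def intro!: im drawing_image_vertex)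
    fix z assume "z \<in> h ` drawing_image V E p \<gamma>"
    then obtain w where w: "w \<in> drawing_image V E p \<gamma>" "z = h w" by auto
    show "Im z \<le> 0" using w im le[OF w(1)] by (cases "Im w = 0") force+
    show "z \<in> (h \<circ> p) ` set ds'" if "Im z = 0"
    proof -
      have "Im w = 0" using im(1)[OF w(1)] le[OF w(1)] that w(2) by force
      then show ?thesis using z0[OF w(1)] w(2) ds'(1) by auto
    qed
  qed (use h ds' in \<open>auto simp: half_plane_drawing_def comp_def\<close>)
qed

lemmas half_plane_drawable_compose =
  half_plane_drawable_def[THEN iffD2, OF exI, OF exI, OF half_plane_drawing_compose]

lemma half_plane_drawable_rev:
  assumes "half_plane_drawable V E ds"
  shows "half_plane_drawable V E (rev ds)"
proof -
  obtain p \<gamma> where h: "half_plane_drawing V E p \<gamma> ds"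
    using assms by (auto simp: half_plane_drawable_def)
  have "sorted_wrt (<) (map (\<lambda>v. Re (- cnj (p v))) (rev ds))"
    using h by (simp add: half_plane_drawing_def sorted_wrt_map sorted_wrt_rev)
  then show ?thesis
    by (intro half_plane_drawable_compose[OF h, of "\<lambda>z. - cnj z"])
      (auto intro!: continuous_intros inj_onI)
qed

text \<open>A Moebius transformation whose pole lies between the first two terminals.\<close>

lemma half_plane_drawable_rotate:
  assumes "half_plane_drawable V E (x # ds)"
  shows "half_plane_drawable V E (ds @ [x])"
proof (cases ds)
  case Nil
  then show ?thesis using assms by simp
next
  case (Cons y ds')
  obtain p \<gamma> where h: "half_plane_drawing V E p \<gamma> (x # ds)"
    using assms by (auto simp: half_plane_drawable_def)
  have lt: "Re (p x) < Re (p y)" "\<And>v. v \<in> set ds \<Longrightarrow> Re (p y) \<le> Re (p v)"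
    using h Cons by (force simp: half_plane_drawing_def)+
  obtain r where r: "Re (p x) < r" "r < Re (p y)" using lt(1) dense by blast
  \<comment> \<open>The pole \<open>r\<close> is on the axis but no terminal, hence off the drawing.
    Terminals to its right get negative images in unchanged order, while \<open>x\<close>, to its
    left, gets a positive one and so becomes the last.\<close>
  define g where "g z = - inverse (z - of_real r)" for z :: complex
  have off: "z \<noteq> of_real r" if z: "z \<in> drawing_image V E p \<gamma>" for z
  proof
    assume "z = of_real r"
    then have "of_real r \<in> p ` set (x # ds)" using h z by (auto simp: half_plane_drawing_def)
    then obtain v where "v \<in> set (x # ds)" "Re (p v) = r" by (metis Re_complex_of_real image_iff)
    then show False using lt(2)[of v] r by auto
  qed
  have Im_g: "Im (g z) = Im z / ((Re z - r)\<^sup>2 + (Im z)\<^sup>2)" for z by (simp add: g_def)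
  have Re_g: "Re (g z) = - ((Re z - r) / ((Re z - r)\<^sup>2 + (Im z)\<^sup>2))" for z by (simp add: g_def)
  have im0: "Im (p v) = 0" if "v \<in> set (x # ds)" for v
    using h that by (auto simp: half_plane_drawing_def)
  have Re_g0: "Re (g (p v)) = - inverse (Re (p v) - r)" if "v \<in> set (x # ds)" for v
    using im0[OF that] by (simp add: Re_g power2_eq_square divide_simps)
  have gt: "r < Re (p v)" if "v \<in> set ds" for v using lt(2)[OF that] r by linarith
  have s: "sorted_wrt (\<lambda>u v. Re (p u) < Re (p v)) ds"
    using h by (simp add: half_plane_drawing_def sorted_wrt_map)
  have "sorted_wrt (\<lambda>u v. Re (g (p u)) < Re (g (p v))) ds"
    using s by (rule sorted_wrt_mono_rel[rotated]) (use gt Re_g0 in \<open>force simp: less_imp_inverse_less\<close>)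
  moreover have "Re (g (p v)) < Re (g (p x))" if "v \<in> set ds" for v
  proof -
    have "inverse (Re (p v) - r) > 0" "inverse (Re (p x) - r) < 0"
      using gt[OF that] r by auto
    then have "- inverse (Re (p v) - r) < - inverse (Re (p x) - r)" by linarith
    then show ?thesis using that Re_g0[of v] Re_g0[of x] by simp
  qed
  ultimately have sd: "sorted_wrt (<) (map (\<lambda>v. Re (g (p v))) (ds @ [x]))"
    by (simp add: sorted_wrt_map sorted_wrt_append)
  show ?thesis
  proof (rule half_plane_drawable_compose[OF h _ _ _ _ _ sd])
    show "continuous_on (drawing_image V E p \<gamma>) g"
      unfolding g_def using off by (intro continuous_intros) auto
    show "inj_on g (drawing_image V E p \<gamma>)" by (auto simp: g_def intro!: inj_onI)
    show "Im (g z) < 0" if "Im z < 0" for z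
      using that by (auto simp: Im_g divide_neg_pos add_nonneg_pos)
    show "Im (g z) = 0" if "Im z = 0" for z using that by (simp add: Im_g)
  qed auto
qed

lemma compact_drawing_image:
  assumes "plane_drawing V E p \<gamma>" "finite V" "finite E"
  shows "compact (drawing_image V E p \<gamma>)"
proof -
  have "compact (path_image (\<gamma> e))" if "e \<in> E" for e
    using plane_drawingD(2)[OF assms(1) that] by (rule compact_arc_image)
  then show ?thesis
    using assms unfolding drawing_image_def
    by (intro compact_Un compact_UN finite_imp_compact[OF finite_imageI]) auto
qed

lemma half_plane_drawable_union:
  assumes "half_plane_drawable V E ds" "half_plane_drawable V' E' ds'" and disj: "V \<inter> V' = {}"
  shows "half_plane_drawable (V \<union> V') (E \<union> E') (ds @ ds')"
proof -
  obtain p \<gamma> where h: "half_plane_drawing V E p \<gamma> ds"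
    using assms(1) by (auto simp: half_plane_drawable_def)
  obtain p0 \<gamma>0 where h0: "half_plane_drawing V' E' p0 \<gamma>0 ds'"
    using assms(2) by (auto simp: half_plane_drawable_def)
  have "bounded (drawing_image V E p \<gamma> \<union> drawing_image V' E' p0 \<gamma>0)"
    using h h0 by (auto simp: half_plane_drawing_def intro!: compact_imp_bounded compact_drawing_image)
  then obtain B where B: "\<And>z. z \<in> drawing_image V E p \<gamma> \<union> drawing_image V' E' p0 \<gamma>0 \<Longrightarrow> norm z \<le> B"
    by (auto simp: bounded_iff)
  \<comment> \<open>Both drawings lie in the disc of radius \<open>B\<close> about 0, so after this
    shift the second one has real parts of at least \<open>B + 1\<close> and lies to the right of
    the first.\<close>
  define t where "t z = z + of_real (2 * B + 1)" for z :: complex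
  define p' where "p' = t \<circ> p0"
  define \<gamma>' where "\<gamma>' = (\<lambda>e. t \<circ> \<gamma>0 e)"
  let ?D = "drawing_image V E p \<gamma>" and ?D' = "drawing_image V' E' p' \<gamma>'"
  have h': "half_plane_drawing V' E' p' \<gamma>' ds'"
    unfolding p'_def \<gamma>'_def using h0
    by (intro half_plane_drawing_compose[OF h0])
      (auto simp: t_def half_plane_drawing_def sorted_wrt_map intro!: continuous_intros inj_onI)
  have Re_le: "Re z \<le> B" if "z \<in> ?D" for z
    using B[of z] abs_Re_le_cmod[of z] that by auto
  have Re_gt: "Re z > B" if z: "z \<in> ?D'" for z
  proof -
    obtain w where "w \<in> drawing_image V' E' p0 \<gamma>0" "z = t w"
      using z by (auto simp: p'_def \<gamma>'_def drawing_image_compose)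
    then show ?thesis using B[of w] abs_Re_le_cmod[of w] by (simp add: t_def)
  qed
  have sep: "?D \<inter> ?D' = {}" using Re_le Re_gt by (meson disjoint_iff not_le)
  define q where "q v = (if v \<in> V then p v else p' v)" for v
  define \<delta> where "\<delta> e = (if e \<in> E then \<gamma> e else \<gamma>' e)" for e
  have sub: "\<And>e. e \<in> E \<Longrightarrow> e \<subseteq> V \<and> e \<noteq> {}" "\<And>e. e \<in> E' \<Longrightarrow> e \<subseteq> V' \<and> e \<noteq> {}"
    using h h' by (auto simp: half_plane_drawing_def)
  have qV: "q v = p v" if "v \<in> V" for v using that by (simp add: q_def)
  have qV': "q v = p' v" if "v \<in> V'" for v using that disj by (auto simp: q_def)
  have dE: "\<delta> e = \<gamma> e" if "e \<in> E" for e using that by (simp add: \<delta>_def)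
  have dE': "\<delta> e = \<gamma>' e" if "e \<in> E'" for e
  proof -
    have "e \<notin> E" using that disj sub(1)[of e] sub(2)[of e] by blast
    then show ?thesis by (simp add: \<delta>_def)
  qed
  have im: "q ` A = p ` A" if "A \<subseteq> V" for A using that qV by (intro image_cong) auto
  have im': "q ` A = p' ` A" if "A \<subseteq> V'" for A using that qV' by (intro image_cong) auto
  have img: "drawing_image (V \<union> V') (E \<union> E') q \<delta> = ?D \<union> ?D'"
    using im[of V] im'[of V'] dE dE' by (auto simp: drawing_image_def image_Un)
  have pd: "plane_drawing V E p \<gamma>" and pd': "plane_drawing V' E' p' \<gamma>'"
    using h h' by (auto simp: half_plane_drawing_def)
  have inD: "p ` V \<subseteq> ?D" "p' ` V' \<subseteq> ?D'" "\<And>e. e \<in> E \<Longrightarrow> path_image (\<gamma> e) \<subseteq> ?D"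
    "\<And>e. e \<in> E' \<Longrightarrow> path_image (\<gamma>' e) \<subseteq> ?D'"
    by (auto simp: drawing_image_def)
  have qVV: "q ` (V \<union> V') = p ` V \<union> p' ` V'" using im[of V] im'[of V'] by (simp add: image_Un)
  have disjoint_images: "e \<in> E \<Longrightarrow> path_image (\<gamma> e) \<inter> p' ` V' = {}"
    "e \<in> E' \<Longrightarrow> path_image (\<gamma>' e) \<inter> p ` V = {}" "p ` V \<inter> p' ` V' = {}" for e
    using inD(1,2) inD(3)[of e] inD(4)[of e] sep by blast+
  have "plane_drawing (V \<union> V') (E \<union> E') q \<delta>"
    unfolding plane_drawing_def
  proof (intro conjI ballI impI)
    have "inj_on q V" "inj_on q V'"
      using pd pd' qV qV' by (auto simp: plane_drawing_def inj_on_def)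
    moreover have "q ` V \<inter> q ` V' = {}" using im[of V] im'[of V'] disjoint_images(3) by simp
    ultimately show "inj_on q (V \<union> V')" by (auto simp: inj_on_Un)
    fix e assume e: "e \<in> E \<union> E'"
    have "arc (\<delta> e) \<and> {pathstart (\<delta> e), pathfinish (\<delta> e)} = q ` e"
    proof (cases "e \<in> E")
      case True
      then show ?thesis using plane_drawingD(2,3)[OF pd True] dE im[of e] sub by simp
    next
      case False
      then have "e \<in> E'" using e by simp
      then show ?thesis using plane_drawingD(2,3)[OF pd'] dE' im'[of e] sub by simp
    qed
    then show "arc (\<delta> e)" "{pathstart (\<delta> e), pathfinish (\<delta> e)} = q ` e" by auto
    show "path_image (\<delta> e) \<inter> q ` (V \<union> V') = q ` e"
    proof (cases "e \<in> E")
      case True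
      then have "path_image (\<delta> e) \<inter> q ` (V \<union> V') = path_image (\<gamma> e) \<inter> p ` V"
        using disjoint_images(1)[of e] unfolding qVV dE[OF True] by blast
      then show ?thesis using True plane_drawingD(4)[OF pd, of e] im[of e] sub by simp
    next
      case False
      then have e': "e \<in> E'" using e by auto
      then have "path_image (\<delta> e) \<inter> q ` (V \<union> V') = path_image (\<gamma>' e) \<inter> p' ` V'"
        using disjoint_images(2)[of e] unfolding qVV dE'[OF e'] by blast
      then show ?thesis using e' plane_drawingD(4)[OF pd', of e] im'[of e] sub by simp
    qed
    fix f assume f: "f \<in> E \<union> E'" "e \<noteq> f"
    consider "e \<in> E" "f \<in> E" | "e \<in> E'" "f \<in> E'" | "e \<in> E" "f \<in> E'" | "e \<in> E'" "f \<in> E"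
      using e f by blast
    then show "path_image (\<delta> e) \<inter> path_image (\<delta> f) \<subseteq> q ` (e \<inter> f)"
    proof cases
      case 1
      have "e \<inter> f \<subseteq> V" using sub 1 by blast
      then show ?thesis using 1 plane_drawingD(5)[OF pd, of e f] f im[of "e \<inter> f"] dE by simp
    next
      case 2
      have "e \<inter> f \<subseteq> V'" using sub 2 by blast
      then show ?thesis using 2 plane_drawingD(5)[OF pd', of e f] f im'[of "e \<inter> f"] dE' by simp
    next
      case 3
      then show ?thesis using inD(3)[of e] inD(4)[of f] sep dE dE' by auto
    next
      case 4
      then show ?thesis using inD(3)[of f] inD(4)[of e] sep dE dE' by auto
    qed
  qed
  moreover have "sorted_wrt (<) (map (\<lambda>v. Re (q v)) (ds @ ds'))"
  proof -
    have "set ds \<subseteq> V" "set ds' \<subseteq> V'" using h h' by (auto simp: half_plane_drawing_def)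
    then have "map (\<lambda>v. Re (q v)) ds = map (\<lambda>v. Re (p v)) ds"
      "map (\<lambda>v. Re (q v)) ds' = map (\<lambda>v. Re (p' v)) ds'"
      by (auto intro!: arg_cong[of _ _ Re] qV qV')
    moreover have "Re (p u) < Re (p' v)" if "u \<in> set ds" "v \<in> set ds'" for u v
    proof -
      have "p u \<in> ?D" "p' v \<in> ?D'"
        using that \<open>set ds \<subseteq> V\<close> \<open>set ds' \<subseteq> V'\<close> inD(1,2) by blast+
      then show ?thesis using Re_le[of "p u"] Re_gt[of "p' v"] by linarith
    qed
    moreover have "sorted_wrt (<) (map (\<lambda>v. Re (p v)) ds)" "sorted_wrt (<) (map (\<lambda>v. Re (p' v)) ds')"
      using h h' unfolding half_plane_drawing_def by blast+
    ultimately show ?thesis unfolding map_append sorted_wrt_append by (simp only:) auto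
  qed
  moreover have "q ` set (ds @ ds') = p ` set ds \<union> p' ` set ds'"
    using im[of "set ds"] im'[of "set ds'"] h h' by (simp add: half_plane_drawing_def image_Un)
  moreover have "Im (q v) = 0" if "v \<in> set (ds @ ds')" for v
    using that h h' qV[of v] qV'[of v] by (auto simp: half_plane_drawing_def)
  moreover have "Im z \<le> 0 \<and> (Im z = 0 \<longrightarrow> z \<in> p ` set ds \<union> p' ` set ds')" if "z \<in> ?D \<union> ?D'" for z
    using that h h' unfolding half_plane_drawing_def by blast
  moreover have "set (ds @ ds') \<subseteq> V \<union> V'" "finite (V \<union> V')" "finite (E \<union> E')"
    using h h' by (auto simp: half_plane_drawing_def)
  moreover have "\<forall>e \<in> E \<union> E'. e \<subseteq> V \<union> V' \<and> e \<noteq> {}" using sub by blast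
  ultimately have "half_plane_drawing (V \<union> V') (E \<union> E') q \<delta> (ds @ ds')"
    unfolding half_plane_drawing_def img by (intro conjI ballI) simp_all
  then show ?thesis by (auto simp: half_plane_drawable_def)
qed

text \<open>The centre is put at -i and the leaves at the points 0, 1, 2, ... of the axis, in the
  order of \<open>ls\<close>. Segments from -i to different points of the axis meet only in
  -i.\<close>

lemma half_plane_drawable_star:
  assumes "distinct ls" "c \<notin> set ls"
  shows "half_plane_drawable (insert c (set ls)) ((\<lambda>l. {c, l}) ` set ls) ls"
proof -
  define x where "x l = real (THE j. j < length ls \<and> ls ! j = l)" for l
  have x: "x (ls ! j) = real j" if "j < length ls" for j
    using that assms(1) by (auto simp: x_def nth_eq_iff_index_eq intro!: the_equality)
  have inj: "l = l'" if "x l = x l'" "l \<in> set ls" "l' \<in> set ls" for l l'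
    using that x by (auto simp: in_set_conv_nth)
  define p where "p v = (if v = c then - \<i> else of_real (x v))" for v
  define \<gamma> where "\<gamma> e = linepath (- \<i>) (of_real (x (the_elem (e - {c}))))" for e
  have p [simp]: "p c = - \<i>" "l \<in> set ls \<Longrightarrow> p l = of_real (x l)" for l
    using assms(2) by (auto simp: p_def)
  have spoke: "z \<in> path_image (linepath (- \<i>) (of_real a)) \<longleftrightarrow>
      (\<exists>u. 0 \<le> u \<and> u \<le> 1 \<and> Re z = u * a \<and> Im z = u - 1)" for z and a :: real
    by (auto simp: closed_segment_def complex_eq_iff algebra_simps)
  have \<gamma> [simp]: "\<gamma> {c, l} = linepath (- \<i>) (of_real (x l))" if "l \<in> set ls" for l
  proof -
    have "{c, l} - {c} = {l}" using that assms(2) by auto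
    then show ?thesis by (simp add: \<gamma>_def)
  qed
  have ne: "- \<i> \<noteq> of_real a" for a by (auto simp: complex_eq_iff)
  have "plane_drawing (insert c (set ls)) ((\<lambda>l. {c, l}) ` set ls) p \<gamma>"
    unfolding plane_drawing_def
  proof (intro conjI ballI impI)
    show "inj_on p (insert c (set ls))"
      using inj ne by (auto simp: inj_on_def) (metis ne)
    fix e assume "e \<in> (\<lambda>l. {c, l}) ` set ls"
    then obtain l where l: "l \<in> set ls" "e = {c, l}" by auto
    show "arc (\<gamma> e)" "{pathstart (\<gamma> e), pathfinish (\<gamma> e)} = p ` e"
      using l ne by auto
    show "path_image (\<gamma> e) \<inter> p ` insert c (set ls) = p ` e"
    proof
      show "p ` e \<subseteq> path_image (\<gamma> e) \<inter> p ` insert c (set ls)"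
        using l by auto
      show "path_image (\<gamma> e) \<inter> p ` insert c (set ls) \<subseteq> p ` e"
        using l inj by (auto simp: spoke simp del: path_image_linepath)
    qed
    fix f assume "f \<in> (\<lambda>l. {c, l}) ` set ls" "e \<noteq> f"
    then obtain l' where l': "l' \<in> set ls" "f = {c, l'}" "l \<noteq> l'" using l by auto
    show "path_image (\<gamma> e) \<inter> path_image (\<gamma> f) \<subseteq> p ` (e \<inter> f)"
    proof
      fix z assume "z \<in> path_image (\<gamma> e) \<inter> path_image (\<gamma> f)"
      then obtain u where "Re z = u * x l" "Re z = u * x l'" "Im z = u - 1"
        using l l' by (auto simp: spoke simp del: path_image_linepath)
      moreover have "x l \<noteq> x l'" using inj l l' by auto
      ultimately have "z = - \<i>" by (auto simp: complex_eq_iff)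
      then show "z \<in> p ` (e \<inter> f)" using l l' by auto
    qed
  qed
  moreover have "sorted_wrt (<) (map (\<lambda>v. Re (p v)) ls)"
    using x by (simp add: sorted_wrt_iff_nth_less)
  moreover have "Im z \<le> 0"
    if "z \<in> drawing_image (insert c (set ls)) ((\<lambda>l. {c, l}) ` set ls) p \<gamma>" for z
    using that by (auto simp: drawing_image_def spoke simp del: path_image_linepath)
  ultimately show ?thesis
    by (intro half_plane_drawable_shear[of _ _ p \<gamma>]) auto
qed

text \<open>The Cayley transform maps the (reflected) half plane into the unit disc, whose boundary
  circle then passes through the terminals in order.\<close>

lemma half_plane_drawable_outer_boundary:
  assumes "half_plane_drawable V E ds"
  shows "\<exists>p \<gamma>. plane_drawing V E p \<gamma> \<and> on_outer_boundary V E p \<gamma> ds"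
proof -
  obtain p \<gamma> where h: "half_plane_drawing V E p \<gamma> ds"
    using assms by (auto simp: half_plane_drawable_def)
  let ?D = "drawing_image V E p \<gamma>"
  have le: "Im z \<le> 0" if "z \<in> ?D" for z using h that by (auto simp: half_plane_drawing_def)
  define g where "g z = (cnj z - \<i>) / (cnj z + \<i>)" for z
  have off: "cnj z + \<i> \<noteq> 0" if "z \<in> ?D" for z
    using le[OF that] by (auto simp: complex_eq_iff)
  have cont: "continuous_on ?D g"
    unfolding g_def using off by (intro continuous_intros) auto
  have inj: "inj_on g ?D"
  proof (rule inj_onI)
    fix z w assume zw: "z \<in> ?D" "w \<in> ?D" "g z = g w"
    then have "(cnj z - \<i>) * (cnj w + \<i>) = (cnj w - \<i>) * (cnj z + \<i>)"
      using off by (simp add: g_def frac_eq_eq)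
    then have "2 * \<i> * cnj z = 2 * \<i> * cnj w" by (simp add: algebra_simps)
    then show "z = w" by simp
  qed
  have "plane_drawing V E (g \<circ> p) (\<lambda>e. g \<circ> \<gamma> e)"
    using h cont inj by (intro plane_drawing_compose) (auto simp: half_plane_drawing_def)
  moreover have "on_outer_boundary V E (g \<circ> p) (\<lambda>e. g \<circ> \<gamma> e) ds"
    unfolding on_outer_boundary_def drawing_image_compose
  proof (intro exI conjI)
    let ?\<beta> = "circlepath 0 1"
    \<comment> \<open>The parameter at which the unit circle passes through the image of the real
      number \<open>x\<close>: (x - i)/(x + i) equals -(1 + ix)/(1 - ix), and 1 + ix has argument
      \<open>arctan x\<close>, so the angle is pi + 2 \<open>arctan x\<close>. It increases with
      \<open>x\<close>.\<close>
    define \<tau> where "\<tau> x = 1 / 2 + arctan x / pi" for x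
    show "simple_path ?\<beta>" by (simp add: simple_path_circlepath)
    show "pathfinish ?\<beta> = pathstart ?\<beta>" by simp
    have "norm (g z) \<le> 1" if "z \<in> ?D" for z
    proof -
      have "(norm (cnj z - \<i>))\<^sup>2 \<le> (norm (cnj z + \<i>))\<^sup>2"
        using le[OF that] unfolding cmod_power2 by (simp add: power2_eq_square algebra_simps)
      then have "norm (cnj z - \<i>) \<le> norm (cnj z + \<i>)" by (simp add: power2_le_iff_abs_le)
      then show ?thesis using off[OF that] by (simp add: g_def norm_divide divide_le_eq_1)
    qed
    then have "g ` ?D \<subseteq> sphere 0 1 \<union> ball 0 1" by force
    moreover have "inside (path_image ?\<beta>) = ball 0 1"
      using inside_frontier_eq_interior[of "cball (0 :: complex) 1"] by simp
    ultimately show "g ` ?D \<subseteq> path_image ?\<beta> \<union> inside (path_image ?\<beta>)" by simp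
    show "sorted_wrt (<) (map (\<lambda>v. \<tau> (Re (p v))) ds)"
      using h by (auto simp: half_plane_drawing_def sorted_wrt_map \<tau>_def arctan_less_iff divide_strict_right_mono
          elim!: sorted_wrt_mono_rel[rotated])
    have "0 \<le> \<tau> x \<and> \<tau> x < 1" for x
    proof -
      have "- (pi / 2) / pi < arctan x / pi" "arctan x / pi < (pi / 2) / pi"
        by (intro divide_strict_right_mono arctan_lbound arctan_ubound pi_gt_zero)+
      then have "- (1 / 2) < arctan x / pi" "arctan x / pi < 1 / 2"
        by (simp_all del: divide_less_eq_1_pos less_divide_eq_1_pos mult_less_cancel_right)
      then show ?thesis unfolding \<tau>_def by linarith
    qed
    then show "set (map (\<lambda>v. \<tau> (Re (p v))) ds) \<subseteq> {0..<1}" by auto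
    have "?\<beta> (\<tau> x) = g (of_real x)" for x
    proof -
      let ?e = "exp (\<i> * of_real (arctan x))"
      have e: "?e = of_real (cos (arctan x)) * (1 + \<i> * of_real x)"
      proof -
        have "sin (arctan x) = cos (arctan x) * x" by (simp add: sin_arctan cos_arctan)
        then show ?thesis by (simp add: exp_Euler cos_of_real sin_of_real algebra_simps)
      qed
      have n: "1 - \<i> * of_real x \<noteq> 0" "1 + \<i> * of_real x \<noteq> 0" "of_real x + \<i> \<noteq> 0"
        by (auto simp: complex_eq_iff)
      have c2: "of_real (cos (arctan x)) ^ 2 * ((1 + \<i> * of_real x) * (1 - \<i> * of_real x)) =
          (1 :: complex)"
      proof -
        have "(cos (arctan x))\<^sup>2 * (1 + x\<^sup>2) = 1"
          by (simp add: cos_arctan power_divide add_pos_nonneg add_nonneg_eq_0_iff)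
        then have "of_real ((cos (arctan x))\<^sup>2 * (1 + x\<^sup>2)) = (1 :: complex)" by simp
        then show ?thesis by (simp add: algebra_simps power2_eq_square)
      qed
      have "?\<beta> (\<tau> x) = exp (\<i> * of_real pi + (\<i> * of_real (arctan x) + \<i> * of_real (arctan x)))"
        by (simp add: circlepath \<tau>_def algebra_simps add_divide_distrib)
      also have "\<dots> = - (?e * ?e)" unfolding exp_add by simp
      finally have "?\<beta> (\<tau> x) * (1 - \<i> * of_real x) = - (?e * ?e * (1 - \<i> * of_real x))" by simp
      also have "?e * ?e * (1 - \<i> * of_real x) =
          of_real (cos (arctan x)) ^ 2 * ((1 + \<i> * of_real x) * (1 - \<i> * of_real x)) * (1 + \<i> * of_real x)"
        unfolding e by (simp only: power2_eq_square ac_simps)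
      finally have "?\<beta> (\<tau> x) * (1 - \<i> * of_real x) = - (1 + \<i> * of_real x)"
        unfolding c2 by simp
      then have "?\<beta> (\<tau> x) = - (1 + \<i> * of_real x) / (1 - \<i> * of_real x)"
        using n by (simp add: eq_divide_eq)
      also have "\<dots> = g (of_real x)"
        using n by (simp add: g_def frac_eq_eq algebra_simps)
      finally show ?thesis .
    qed
    moreover have "of_real (Re (p v)) = p v" if "v \<in> set ds" for v
      using h that by (auto simp: half_plane_drawing_def complex_eq_iff)
    ultimately show "map ?\<beta> (map (\<lambda>v. \<tau> (Re (p v))) ds) = map (g \<circ> p) ds" by simp
  qed
  ultimately show ?thesis by blast
qed

section \<open>Assembling planar systems in a disc\<close>

text \<open>\<open>planar_disc ls I C ds\<close>: the gadgets with indices in \<open>I\<close>, each with cyclic location order \<open>ls\<close>,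
  and the connections \<open>C\<close> can be drawn in a disc with the locations \<open>ds\<close> on its boundary, in this
  cyclic order.\<close>

inductive planar_disc ::
  "'l list \<Rightarrow> nat set \<Rightarrow> (nat \<times> 'l) set set \<Rightarrow> (nat \<times> 'l) list \<Rightarrow> bool" for ls where
  gadget: "planar_disc ls {i} {} (map (Pair i) ls)"
| union: "planar_disc ls I C ds \<Longrightarrow> planar_disc ls I' C' ds' \<Longrightarrow> I \<inter> I' = {} \<Longrightarrow>
    planar_disc ls (I \<union> I') (C \<union> C') (ds @ ds')"
| connect: "planar_disc ls I C (x # y # ds) \<Longrightarrow> planar_disc ls I (insert {x, y} C) (x # y # ds)"
| drop: "planar_disc ls I C (x # ds) \<Longrightarrow> planar_disc ls I C ds"
| rotate: "planar_disc ls I C (x # ds) \<Longrightarrow> planar_disc ls I C (ds @ [x])"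
| reverse: "planar_disc ls I C ds \<Longrightarrow> planar_disc ls I C (rev ds)"

lemma planar_disc_wf:
  assumes "planar_disc ls I C ds" "distinct ls"
  shows "distinct ds \<and> set ds \<subseteq> I \<times> set ls \<and> (\<forall>e \<in> C. e \<subseteq> I \<times> set ls \<and> card e = 2)"
  using assms by induction (auto simp: distinct_map inj_on_def)

lemma planar_disc_append_swap:
  "planar_disc ls I C (us @ vs) \<Longrightarrow> planar_disc ls I C (vs @ us)"
proof (induction us arbitrary: vs)
  case (Cons u us)
  then show ?case using planar_disc.rotate[of ls I C u "us @ vs"] by fastforce
qed simp

lemma planar_disc_rotate_nth:
  "planar_disc ls I C ds \<Longrightarrow> planar_disc ls I C (drop k ds @ take k ds)"
  by (metis append_take_drop_id planar_disc_append_swap)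

lemma planar_disc_connect_nth:
  assumes "planar_disc ls I C ds" "Suc k < length ds"
  shows "planar_disc ls I (insert {ds ! k, ds ! Suc k} C) ds"
proof -
  have "drop k ds = ds ! k # ds ! Suc k # drop (Suc (Suc k)) ds"
    using assms(2) by (metis Cons_nth_drop_Suc Suc_lessD)
  then have "planar_disc ls I (insert {ds ! k, ds ! Suc k} C) (drop k ds @ take k ds)"
    using planar_disc.connect[of ls I C "ds ! k" "ds ! Suc k" "drop (Suc (Suc k)) ds @ take k ds"]
      planar_disc_rotate_nth[OF assms(1), of k] by simp
  then show ?thesis by (metis append_take_drop_id planar_disc_append_swap)
qed

lemma planar_disc_connect_ends:
  assumes "planar_disc ls I C (x # ds)" "ds \<noteq> []"
  shows "planar_disc ls I (insert {last ds, x} C) (x # ds)"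
proof -
  have "planar_disc ls I C (last ds # x # butlast ds)"
    using planar_disc_append_swap[of ls I C "x # butlast ds" "[last ds]"] assms by simp
  then have "planar_disc ls I (insert {last ds, x} C) ([last ds] @ (x # butlast ds))"
    by (simp add: planar_disc.connect)
  then show ?thesis using planar_disc_append_swap assms(2) by fastforce
qed

lemma planar_disc_drop_nth:
  assumes "planar_disc ls I C ds" "k < length ds"
  shows "planar_disc ls I C (take k ds @ drop (Suc k) ds)"
proof -
  have "planar_disc ls I C (ds ! k # (drop (Suc k) ds @ take k ds))"
    using planar_disc_rotate_nth[OF assms(1), of k] assms(2) by (metis Cons_nth_drop_Suc append_Cons)
  then show ?thesis using planar_disc.drop planar_disc_append_swap by fast
qed

lemma planar_disc_filter:
  assumes "planar_disc ls I C ds"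
  shows "planar_disc ls I C (filter Q ds)"
proof -
  \<comment> \<open>One turn around the boundary: each location of \<open>us\<close> is either moved
    to the back or dropped, and \<open>vs\<close> collects what has been moved.\<close>
  have "planar_disc ls I C (us @ vs) \<Longrightarrow> planar_disc ls I C (vs @ filter Q us)" for us vs
  proof (induction us arbitrary: vs)
    case (Cons u us)
    show ?case
    proof (cases "Q u")
      case True
      have "planar_disc ls I C (us @ (vs @ [u]))"
        using planar_disc.rotate[of ls I C u "us @ vs"] Cons.prems by simp
      from Cons.IH[OF this] show ?thesis using True by simp
    next
      case False
      have "planar_disc ls I C (us @ vs)"
        using planar_disc.drop[of ls I C u "us @ vs"] Cons.prems by simp
      from Cons.IH[OF this] show ?thesis using False by simp
    qed
  qed simp
  from this[of ds "[]"] show ?thesis using assms by simp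
qed

lemma planar_disc_move_front:
  assumes "planar_disc ls I C ds" "a \<in> set ds" "distinct ds"
  obtains ds' where "planar_disc ls I C (a # ds')" "set ds' = set ds - {a}" "distinct ds'"
proof -
  obtain us vs where ds: "ds = us @ a # vs" using assms(2) by (meson split_list)
  have "planar_disc ls I C (a # vs @ us)"
    using planar_disc_append_swap[of ls I C us "a # vs"] assms(1) ds by simp
  then show ?thesis using that[of "vs @ us"] assms(3) ds by auto
qed

text \<open>Two locations have only one cyclic order, so rotation reaches either list. This serves
  the blocking words that consist of a single crossing.\<close>

lemma planar_disc_pair:
  assumes "distinct ls" "p \<in> set ls" "q \<in> set ls" "p \<noteq> q"
  shows "planar_disc ls {i} {} [(i, p), (i, q)]"
proof -
  let ?L = "filter (\<lambda>x. snd x \<in> {p, q}) (map (Pair i) ls)"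
  have "planar_disc ls {i} {} ?L" by (intro planar_disc_filter planar_disc.gadget)
  moreover have "distinct ?L" "set ?L = {(i, p), (i, q)}"
    using assms by (auto simp: distinct_map inj_on_def)
  ultimately obtain ds where ds: "planar_disc ls {i} {} ((i, p) # ds)" "set ds = {(i, q)}" "distinct ds"
    using planar_disc_move_front[of ls "{i}" "{}" ?L "(i, p)"] assms(4) by auto
  then have "ds = [(i, q)]"
    by (metis distinct_length_2_or_more empty_iff insertE list.exhaust list.set(1) list.set_intros(1) list.set_intros(2) insertI1)
  then show ?thesis using ds by simp
qed

lemma distinct_three_cases:
  assumes "distinct xs" "set xs = {b, c, d}" "distinct [b, c, d]"
  shows "xs \<in> {[b, c, d], [b, d, c], [c, b, d], [c, d, b], [d, b, c], [d, c, b]}"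
proof -
  have "length xs = 3" using distinct_card[OF assms(1)] assms(2,3) by simp
  then obtain x y z where xs: "xs = [x, y, z]" by (auto simp: numeral_3_eq_3 length_Suc_conv)
  have "x \<in> set xs" "y \<in> set xs" "z \<in> set xs" by (simp_all add: xs)
  then have "x \<in> {b, c, d}" "y \<in> {b, c, d}" "z \<in> {b, c, d}" unfolding assms(2) .
  moreover have "x \<noteq> y" "x \<noteq> z" "y \<noteq> z" using assms(1) by (auto simp: xs)
  ultimately show ?thesis unfolding xs by (elim insertE emptyE) simp_all
qed

text \<open>Four points on a circle have three cyclic orders up to reversal: here the parallel, the
  antiparallel and the crossing one. The index \<open>i\<close> is quantified inside each
  alternative because all copies must have the same order.\<close>

lemma planar_disc_two_tunnels:
  assumes ls: "distinct ls" and abcd: "{a, b, c, d} \<subseteq> set ls" "distinct [a, b, c, d]"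
  shows "(\<forall>i. planar_disc ls {i} {} (map (Pair i) [a, b, d, c])) \<or>
    (\<forall>i. planar_disc ls {i} {} (map (Pair i) [a, b, c, d])) \<or>
    (\<forall>i. planar_disc ls {i} {} (map (Pair i) [a, c, b, d]))"
proof -
  let ?L = "filter (\<lambda>x. x \<in> {a, b, c, d}) ls"
  have L: "distinct ?L" "set ?L = {a, b, c, d}" using ls abcd by auto
  then obtain us vs where split: "?L = us @ a # vs" by (metis insertI1 split_list)
  define xs where "xs = vs @ us"
  have d: "distinct (us @ a # vs)" "set (us @ a # vs) = {a, b, c, d}" using L unfolding split .
  have "distinct xs" using d(1) by (auto simp: xs_def)
  moreover have "set xs = {b, c, d}"
  proof -
    have "set xs = set (us @ a # vs) - {a}" using d(1) by (auto simp: xs_def)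
    also have "\<dots> = {a, b, c, d} - {a}" unfolding d(2) ..
    finally show ?thesis using abcd(2) by auto
  qed
  ultimately have xs: "xs \<in> {[b, c, d], [b, d, c], [c, b, d], [c, d, b], [d, b, c], [d, c, b]}"
    using abcd(2) by (intro distinct_three_cases) simp_all
  have 1: "planar_disc ls {i} {} (map (Pair i) (a # xs))" for i
  proof -
    have "planar_disc ls {i} {} (map (Pair i) ?L)"
      using planar_disc_filter[OF planar_disc.gadget[of ls i], of "\<lambda>x. snd x \<in> {a, b, c, d}"]
      by (simp add: filter_map comp_def)
    then show ?thesis
      using planar_disc_append_swap[of ls "{i}" "{}" "map (Pair i) us" "map (Pair i) (a # vs)"]
      unfolding split xs_def by simp
  qed
  have 2: "planar_disc ls {i} {} (map (Pair i) (a # rev xs))" for i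
    using planar_disc_append_swap[of ls "{i}" "{}" "rev (map (Pair i) xs)" "[(i, a)]"]
      planar_disc.reverse[OF 1[of i]] by (simp add: rev_map)
  from xs have "a # xs \<in> {[a, b, d, c], [a, b, c, d], [a, c, b, d]} \<or>
      a # rev xs \<in> {[a, b, d, c], [a, b, c, d], [a, c, b, d]}" by auto
  then show ?thesis using 1 2 by (elim disjE insertE) (metis emptyE)+
qed

text \<open>Puts a piece with two ends in series with the terminal \<open>l\<close>, whose role
  passes to the outer end \<open>u\<close>, without disturbing the cyclic order. In this way the
  one-way pieces are hung on the entrances of the routes.\<close>

lemma planar_disc_attach:
  assumes "planar_disc ls I C (map ex cyc)" "planar_disc ls J C' [u, v]" "I \<inter> J = {}"
    "l \<in> set cyc" "distinct cyc"
  shows "planar_disc ls (J \<union> I) (insert {v, ex l} (C' \<union> C)) (map (ex(l := u)) cyc)"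
proof -
  obtain us vs where cyc: "cyc = us @ l # vs" using assms(4) by (meson split_list)
  have "planar_disc ls I C (ex l # map ex vs @ map ex us)"
    using planar_disc_append_swap[of ls I C "map ex us" "map ex (l # vs)"] assms(1) cyc by simp
  from planar_disc.union[OF assms(2) this]
  have "planar_disc ls (J \<union> I) (C' \<union> C) (u # v # ex l # map ex vs @ map ex us)"
    using assms(3) by (simp add: Int_commute)
  from planar_disc_connect_nth[OF this, of 1]
  have "planar_disc ls (J \<union> I) (insert {v, ex l} (C' \<union> C)) (u # v # ex l # map ex vs @ map ex us)"
      by simp
  from planar_disc_drop_nth[OF planar_disc_drop_nth[OF this, of 1], of 1]
  have "planar_disc ls (J \<union> I) (insert {v, ex l} (C' \<union> C)) ((u # map ex vs) @ map ex us)" by simp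
  then have "planar_disc ls (J \<union> I) (insert {v, ex l} (C' \<union> C)) (map ex us @ u # map ex vs)"
    by (rule planar_disc_append_swap)
  moreover have "map (ex(l := u)) cyc = map ex us @ u # map ex vs"
    using assms(5) cyc by auto
  ultimately show ?thesis by simp
qed

text \<open>The star gives hub and spokes. The rim is added while the boundary is rotated through a
  full turn: at every stage the two front locations are the ends of the next rim edge, including the
  one that closes the cycle.\<close>

lemma half_plane_drawable_wheel:
  fixes i :: nat and ls :: "'l list"
  assumes "distinct ls"
  shows "half_plane_drawable (insert (Hub i) (Loc ` ({i} \<times> set ls))) (wheel_edges i ls)
    (map (\<lambda>l. Loc (i, l)) ls)"
proof -
  define n where "n = length ls"
  define L where "L = map (\<lambda>l. Loc (i, l)) ls"
  define V where "V = insert (Hub i :: 'l vertex) (Loc ` ({i} \<times> set ls))"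
  define rim where "rim j = {Loc (i, ls ! j), Loc (i, ls ! (Suc j mod n))}" for j
  define spokes where "spokes = {{Hub i, Loc (i, l)} | l. l \<in> set ls}"
  have L: "length L = n" "\<And>j. j < n \<Longrightarrow> L ! j = Loc (i, ls ! j)" "set L = Loc ` ({i} \<times> set ls)"
    by (auto simp: L_def n_def)
  have "half_plane_drawable (insert (Hub i) (set L)) ((\<lambda>l. {Hub i, l}) ` set L) L"
    using assms by (intro half_plane_drawable_star) (auto simp: L_def distinct_map inj_on_def)
  moreover have "(\<lambda>l. {Hub i, l}) ` set L = spokes" by (auto simp: L_def spokes_def)
  ultimately have star: "half_plane_drawable V spokes L" by (simp add: V_def L)
  show ?thesis
  proof (cases "2 \<le> n")
    case False
    then have "wheel_edges i ls = spokes" by (auto simp: wheel_edges_def spokes_def n_def)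
    then show ?thesis using star by (simp add: V_def L_def)
  next
    case True
    have "half_plane_drawable V (rim ` {..<j} \<union> spokes) (List.rotate j L)" if "j \<le> n" for j
      using that
    proof (induction j)
      case 0
      then show ?case using star by simp
    next
      case (Suc j)
      obtain x y ds where r: "List.rotate j L = x # y # ds"
        using True L(1) by (metis length_rotate Suc_le_length_iff numeral_2_eq_2)
      have "x = List.rotate j L ! 0" "y = List.rotate j L ! 1" by (simp_all add: r)
      then have "x = L ! (j mod n)" "y = L ! (Suc j mod n)"
        using True L(1) nth_rotate[of 0 L j] nth_rotate[of 1 L j] by auto
      then have "{x, y} = rim j" using Suc.prems True L(2) by (simp add: rim_def)
      then have "half_plane_drawable V (insert (rim j) (rim ` {..<j} \<union> spokes)) (x # y # ds)"
        using half_plane_drawable_connect[of V "rim ` {..<j} \<union> spokes" x y ds] Suc r by simp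
      then have "half_plane_drawable V (insert (rim j) (rim ` {..<j} \<union> spokes)) ((y # ds) @ [x])"
        by (rule half_plane_drawable_rotate)
      moreover have "List.rotate (Suc j) L = (y # ds) @ [x]" using r by (simp add: rotate_Suc)
      ultimately show ?case by (simp add: lessThan_Suc)
    qed
    from this[of n] have "half_plane_drawable V (rim ` {..<n} \<union> spokes) L" using L(1) by simp
    moreover have "rim ` {..<n} \<union> spokes = wheel_edges i ls"
      using True by (auto simp: wheel_edges_def rim_def spokes_def n_def)
    ultimately show ?thesis by (simp add: V_def L_def)
  qed
qed

text \<open>Each rule of \<open>planar_disc\<close> has its counterpart for drawings in the half
  plane; the wheel is the base case.\<close>

lemma planar_disc_drawable:
  assumes "planar_disc ls I C ds" "distinct ls"
  shows "half_plane_drawable (Loc ` (I \<times> set ls) \<union> Hub ` I)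
    ((\<Union>i \<in> I. wheel_edges i ls) \<union> (\<lambda>e. Loc ` e) ` C) (map Loc ds)"
  using assms
proof induction
  case (gadget i)
  show ?case
    using half_plane_drawable_wheel[OF gadget, of i] by (simp add: comp_def)
next
  case (union I C ds I' C' ds')
  have "half_plane_drawable
      ((Loc ` (I \<times> set ls) \<union> Hub ` I) \<union> (Loc ` (I' \<times> set ls) \<union> Hub ` I'))
      (((\<Union>i \<in> I. wheel_edges i ls) \<union> (\<lambda>e. Loc ` e) ` C) \<union>
       ((\<Union>i \<in> I'. wheel_edges i ls) \<union> (\<lambda>e. Loc ` e) ` C')) (map Loc ds @ map Loc ds')"
    using union by (intro half_plane_drawable_union) auto
  moreover have "(Loc ` (I \<times> set ls) \<union> Hub ` I) \<union> (Loc ` (I' \<times> set ls) \<union> Hub ` I') =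
      Loc ` ((I \<union> I') \<times> set ls) \<union> Hub ` (I \<union> I')" by auto
  moreover have "((\<Union>i \<in> I. wheel_edges i ls) \<union> (\<lambda>e. Loc ` e) ` C) \<union>
      ((\<Union>i \<in> I'. wheel_edges i ls) \<union> (\<lambda>e. Loc ` e) ` C') =
      (\<Union>i \<in> I \<union> I'. wheel_edges i ls) \<union> (\<lambda>e. Loc ` e) ` (C \<union> C')" by auto
  ultimately show ?case by simp
next
  case (connect I C x y ds)
  then show ?case using half_plane_drawable_connect by force
next
  case (drop I C x ds)
  then show ?case using half_plane_drawable_drop by force
next
  case (rotate I C x ds)
  then show ?case using half_plane_drawable_rotate by force
next
  case (reverse I C ds)
  then show ?case using half_plane_drawable_rev by (force simp: rev_map)
qed

section \<open>From disc derivations to planar systems of copies\<close>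

definition copies :: "('l, 's) gadget \<Rightarrow> nat \<Rightarrow> (nat \<times> 'l) set set \<Rightarrow> ('l, 's) system" where
  "copies G n C = \<lparr>gadgets = replicate n G, connections = C\<rparr>"

lemma copies_simps [simp]:
  "gadgets (copies G n C) = replicate n G" "connections (copies G n C) = C"
  by (simp_all add: copies_def)

lemma planar_system_copies:
  assumes "planar_disc (locs G) {..<n} C ds" "distinct (locs G)"
  shows "planar_system_with_boundary (copies G n C) ds"
proof -
  have "system_vertices (copies G n C) = Loc ` ({..<n} \<times> set (locs G)) \<union> Hub ` {..<n}"
    by (auto simp: system_vertices_def system_locs_def)
  moreover have "system_edges (copies G n C) =
      (\<Union>i \<in> {..<n}. wheel_edges i (locs G)) \<union> (\<lambda>e. Loc ` e) ` C"
    by (auto simp: system_edges_def)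
  ultimately show ?thesis
    using half_plane_drawable_outer_boundary[OF planar_disc_drawable[OF assms]]
    by (simp add: planar_system_with_boundary_def)
qed

text \<open>A form of \<open>simulates_planar\<close> strong enough to compose: planarity is a
  \<open>planar_disc\<close> derivation, which can be substituted for the basic discs of another
  one, and \<open>conf\<close> is injective, so that a configuration determines the simulated
  state.\<close>

definition disc_simulation ::
  "('l, 's) gadget \<Rightarrow> ('m, 't) gadget \<Rightarrow> nat \<Rightarrow> (nat \<times> 'l) set set \<Rightarrow> ('m \<Rightarrow> nat \<times> 'l) \<Rightarrow>
    ('t \<Rightarrow> 's list) \<Rightarrow> bool" where
  "disc_simulation G H n C ext conf \<longleftrightarrow>
     planar_disc (locs G) {..<n} C (map ext (locs H)) \<and>
     inj_on conf (states H) \<and>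
     (\<forall>q \<in> states H. length (conf q) = n \<and> set (conf q) \<subseteq> states G) \<and>
     (\<forall>q \<in> states H. \<forall>a \<in> set (locs H). \<forall>b \<in> set (locs H). \<forall>c.
        passage (copies G n C) (ext ` set (locs H)) (conf q, ext a) (c, ext b) \<longleftrightarrow>
        (\<exists>q' \<in> states H. c = conf q' \<and> ((a, b, q') \<in> transitions H q \<or> a = b \<and> q = q')))"

definition disc_simulates :: "('l, 's) gadget \<Rightarrow> ('m, 't) gadget \<Rightarrow> bool" where
  "disc_simulates G H \<longleftrightarrow> (\<exists>n C ext conf. disc_simulation G H n C ext conf)"

lemma simulates_planar_if_disc_simulates:
  assumes "disc_simulates G H" "is_gadget G" "is_gadget H"
  shows "simulates_planar G H"
proof -
  obtain n C ext conf where s: "disc_simulation G H n C ext conf"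
    using assms(1) by (auto simp: disc_simulates_def)
  have d: "planar_disc (locs G) {..<n} C (map ext (locs H))" and inj: "inj_on conf (states H)"
    and conf: "\<And>q. q \<in> states H \<Longrightarrow> length (conf q) = n \<and> set (conf q) \<subseteq> states G"
    and pas: "\<And>q a b c. q \<in> states H \<Longrightarrow> a \<in> set (locs H) \<Longrightarrow> b \<in> set (locs H) \<Longrightarrow>
        passage (copies G n C) (ext ` set (locs H)) (conf q, ext a) (c, ext b) \<longleftrightarrow>
        (\<exists>q' \<in> states H. c = conf q' \<and> ((a, b, q') \<in> transitions H q \<or> a = b \<and> q = q'))"
    using s by (auto simp: disc_simulation_def)
  have dl: "distinct (locs G)" using assms by (simp add: is_gadget_def)
  note wf = planar_disc_wf[OF d dl]
  have sl: "system_locs (copies G n C) = {..<n} \<times> set (locs G)"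
    by (auto simp: system_locs_def)
  show ?thesis
    unfolding simulates_planar_def
  proof (intro exI conjI ballI allI impI)
    show "is_system (copies G n C)"
      using wf assms(2) by (auto simp: is_system_def sl)
    show "set (gadgets (copies G n C)) \<subseteq> {G}" by auto
    show "inj_on ext (set (locs H))" using wf by (simp add: distinct_map)
    show "ext ` set (locs H) \<subseteq> system_locs (copies G n C)" using wf by (simp add: sl)
    show "planar_system_with_boundary (copies G n C) (map ext (locs H))"
      using planar_system_copies[OF d dl] .
    show "conf ` states H \<subseteq> configurations (copies G n C)"
      using conf by (fastforce simp: configurations_def)
    fix q a b assume *: "q \<in> states H" "a \<in> set (locs H)" "b \<in> set (locs H)"
    show "passage (copies G n C) (ext ` set (locs H)) (conf q, ext a) (conf q', ext b) \<longleftrightarrow>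
        (a, b, q') \<in> transitions H q \<or> a = b \<and> q = q'" if "q' \<in> states H" for q'
      using pas[OF *] that inj by (auto dest: inj_onD)
    show "c \<in> conf ` states H"
      if "passage (copies G n C) (ext ` set (locs H)) (conf q, ext a) (c, ext b)" for c
      using pas[OF *] that by auto
  qed
qed

section \<open>Composing simulations\<close>

lemma planar_disc_reindex:
  assumes "planar_disc ls I C ds" "inj_on f I"
  shows "planar_disc ls (f ` I) ((`) (apfst f) ` C) (map (apfst f) ds)"
  using assms
proof induction
  case (gadget i)
  then show ?case using planar_disc.gadget[of ls "f i"] by (simp add: comp_def)
next
  case (union I C ds I' C' ds')
  then have "f ` I \<inter> f ` I' = {}" by (auto simp: inj_on_def)
  with union show ?case
    by (simp add: image_Un planar_disc.union inj_on_Un)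
next
  case (connect I C x y ds)
  then show ?case by (simp add: planar_disc.connect)
next
  case (drop I C x ds)
  then have "planar_disc ls (f ` I) ((`) (apfst f) ` C) ((apfst f) x # map (apfst f) ds)" by simp
  then show ?case by (rule planar_disc.drop)
next
  case (rotate I C x ds)
  then have "planar_disc ls (f ` I) ((`) (apfst f) ` C) ((apfst f) x # map (apfst f) ds)" by simp
  then show ?case using planar_disc.rotate by simp
next
  case (reverse I C ds)
  then have "planar_disc ls (f ` I) ((`) (apfst f) ` C) (rev (map (apfst f) ds))"
      by (intro planar_disc.reverse) simp
  then show ?case by (simp add: rev_map)
qed

abbreviation avoiding_step ::
  "('l, 's) system \<Rightarrow> (nat \<times> 'l) set \<Rightarrow> 's list \<times> (nat \<times> 'l) \<Rightarrow> 's list \<times> (nat \<times> 'l) \<Rightarrow> bool"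
  where "avoiding_step S D \<equiv> \<lambda>u v. robot_step S u v \<and> snd v \<notin> D"

lemma avoiding_steps_target:
  assumes "(avoiding_step S D)\<^sup>*\<^sup>* u v" "snd v \<in> D"
  shows "u = v"
  using assms by (auto elim: rtranclp.cases)

lemma avoiding_steps_passage:
  assumes "(avoiding_step S D)\<^sup>*\<^sup>* u v" "passage S D v w" "snd w \<in> D"
  shows "passage S D u w"
  using assms avoiding_steps_target[OF assms(1)] unfolding passage_def
  by (metis (no_types, lifting) rtranclp_trans)

text \<open>The copy of \<open>H\<close> with index \<open>i\<close> in the outer system becomes a
  block of \<open>n1\<close> copies of \<open>G\<close>, with indices \<open>i * n1 + j\<close>.
  Below, system 1 is a single block, system 2 the outer system and system 3 the flattened
  one.\<close>

locale disc_substitution =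
  fixes G :: "('l, 's) gadget" and H :: "('m, 't) gadget" and K :: "('n, 'u) gadget"
    and n1 n2 :: nat and C1 C2 e1 e2 k1 k2
  assumes G: "is_gadget G" and H: "is_gadget H"
    and sim1: "disc_simulation G H n1 C1 e1 k1" and sim2: "disc_simulation H K n2 C2 e2 k2"
begin

definition block :: "nat \<Rightarrow> nat \<times> 'l \<Rightarrow> nat \<times> 'l" where
  "block i = apfst ((+) (i * n1))"

definition place :: "nat \<times> 'm \<Rightarrow> nat \<times> 'l" where
  "place p = block (fst p) (e1 (snd p))"

definition C3 :: "(nat \<times> 'l) set set" where
  "C3 = (\<Union>i<n2. (`) (block i) ` C1) \<union> (`) place ` C2"

abbreviation "D1 \<equiv> e1 ` set (locs H)"
abbreviation "D2 \<equiv> e2 ` set (locs K)"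
abbreviation "D3 \<equiv> place ` D2"
abbreviation "sys1 \<equiv> copies G n1 C1"
abbreviation "sys2 \<equiv> copies H n2 C2"
abbreviation "sys3 \<equiv> copies G (n2 * n1) C3"

lemma disc1: "planar_disc (locs G) {..<n1} C1 (map e1 (locs H))"
  and inj_k1: "inj_on k1 (states H)"
  and k1: "q \<in> states H \<Longrightarrow> length (k1 q) = n1 \<and> set (k1 q) \<subseteq> states G"
  and passage1: "q \<in> states H \<Longrightarrow> a \<in> set (locs H) \<Longrightarrow> b \<in> set (locs H) \<Longrightarrow>
    passage sys1 D1 (k1 q, e1 a) (c, e1 b) \<longleftrightarrow>
    (\<exists>q' \<in> states H. c = k1 q' \<and> ((a, b, q') \<in> transitions H q \<or> a = b \<and> q = q'))"
  using sim1 by (auto simp: disc_simulation_def)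

lemma disc2: "planar_disc (locs H) {..<n2} C2 (map e2 (locs K))"
  and inj_k2: "inj_on k2 (states K)"
  and k2: "q \<in> states K \<Longrightarrow> length (k2 q) = n2 \<and> set (k2 q) \<subseteq> states H"
  and passage2: "q \<in> states K \<Longrightarrow> a \<in> set (locs K) \<Longrightarrow> b \<in> set (locs K) \<Longrightarrow>
    passage sys2 D2 (k2 q, e2 a) (c, e2 b) \<longleftrightarrow>
    (\<exists>q' \<in> states K. c = k2 q' \<and> ((a, b, q') \<in> transitions K q \<or> a = b \<and> q = q'))"
  using sim2 by (auto simp: disc_simulation_def)

lemma distinct_locs: "distinct (locs G)" "distinct (locs H)"
  using G H by (auto simp: is_gadget_def)

lemmas wf1 = planar_disc_wf[OF disc1 distinct_locs(1)]
lemmas wf2 = planar_disc_wf[OF disc2 distinct_locs(2)]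

lemma inj_e1: "inj_on e1 (set (locs H))" using wf1 by (simp add: distinct_map)

lemma e1_less: "a \<in> set (locs H) \<Longrightarrow> fst (e1 a) < n1" using wf1 by force

lemma D2_sub: "D2 \<subseteq> {..<n2} \<times> set (locs H)" using wf2 by simp

lemma index_inj:
  assumes "i * n1 + j = i' * n1 + j'" "j < n1" "j' < n1"
  shows "i = i'"
proof -
  have "i = (i * n1 + j) div n1" using assms(2) by simp
  also have "\<dots> = (i' * n1 + j') div n1" by (simp only: assms(1))
  also have "\<dots> = i'" using assms(3) by simp
  finally show ?thesis .
qed

lemma block_eq_iff:
  assumes "fst x < n1" "fst y < n1"
  shows "block i x = block i' y \<longleftrightarrow> i = i' \<and> x = y"
proof
  assume *: "block i x = block i' y"
  then have e: "i * n1 + fst x = i' * n1 + fst y" "snd x = snd y" by (auto simp: block_def prod_eq_iff)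
  then have "i = i'" using assms index_inj by blast
  then show "i = i' \<and> x = y" using e by (simp add: prod_eq_iff)
qed auto

lemma place_eq_iff:
  assumes "snd p \<in> set (locs H)" "snd p' \<in> set (locs H)"
  shows "place p = place p' \<longleftrightarrow> p = p'"
  using assms inj_e1
  by (cases p; cases p') (auto simp: place_def block_eq_iff e1_less dest: inj_onD)

text \<open>In the derivation for the outer system each basic disc is replaced by a copy of
  \<open>disc1\<close>, whose boundary carries the roles of \<open>locs H\<close> in the same order.
  The other rules act on the boundary only and carry over.\<close>

lemma planar_disc_substitution:
  assumes "planar_disc (locs H) I C ds"
  shows "planar_disc (locs G) (\<Union>i\<in>I. (+) (i * n1) ` {..<n1})
    ((\<Union>i\<in>I. (`) (block i) ` C1) \<union> (`) place ` C) (map place ds)"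
  using assms
proof induction
  case (gadget i)
  have "planar_disc (locs G) ((+) (i * n1) ` {..<n1}) ((`) (block i) ` C1)
      (map (block i) (map e1 (locs H)))"
    unfolding block_def by (intro planar_disc_reindex[OF disc1]) auto
  then show ?case by (simp add: place_def comp_def)
next
  case (union I C ds I' C' ds')
  have "(\<Union>i\<in>I. (+) (i * n1) ` {..<n1}) \<inter> (\<Union>i\<in>I'. (+) (i * n1) ` {..<n1}) = {}"
    using union.hyps index_inj by blast
  from planar_disc.union[OF union.IH this] show ?case
    by (simp add: image_Un Un_ac)
next
  case (connect I C x y ds)
  then show ?case by (simp add: planar_disc.connect)
next
  case (drop I C x ds)
  then have "planar_disc (locs G) (\<Union>i\<in>I. (+) (i * n1) ` {..<n1})
      ((\<Union>i\<in>I. (`) (block i) ` C1) \<union> (`) place ` C) ((place) x # map (place) ds)" by simp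
  then show ?case by (rule planar_disc.drop)
next
  case (rotate I C x ds)
  then have "planar_disc (locs G) (\<Union>i\<in>I. (+) (i * n1) ` {..<n1})
      ((\<Union>i\<in>I. (`) (block i) ` C1) \<union> (`) place ` C) ((place) x # map (place) ds)" by simp
  then show ?case using planar_disc.rotate by simp
next
  case (reverse I C ds)
  then have "planar_disc (locs G) (\<Union>i\<in>I. (+) (i * n1) ` {..<n1})
      ((\<Union>i\<in>I. (`) (block i) ` C1) \<union> (`) place ` C) (rev (map (place) ds))"
          by (intro planar_disc.reverse) simp
  then show ?case by (simp add: rev_map)
qed

lemma disc3: "planar_disc (locs G) {..<n2 * n1} C3 (map (place \<circ> e2) (locs K))"
proof -
  have "(\<Union>i<n2. (+) (i * n1) ` {..<n1}) = {..<n2 * n1}"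
  proof
    show "(\<Union>i<n2. (+) (i * n1) ` {..<n1}) \<subseteq> {..<n2 * n1}"
    proof clarsimp
      fix i j assume *: "i < n2" "j < n1"
      then have "Suc i * n1 \<le> n2 * n1" by (intro mult_le_mono1) auto
      then show "i * n1 + j < n2 * n1" using * by simp
    qed
    show "{..<n2 * n1} \<subseteq> (\<Union>i<n2. (+) (i * n1) ` {..<n1})"
    proof
      fix k assume k: "k \<in> {..<n2 * n1}"
      then have "n1 > 0" by (auto intro: gr0I)
      then have "k = (k div n1) * n1 + k mod n1" "k mod n1 < n1" "k div n1 < n2"
        using k by (auto simp: div_less_iff_less_mult)
      then show "k \<in> (\<Union>i<n2. (+) (i * n1) ` {..<n1})" by blast
    qed
  qed
  with planar_disc_substitution[OF disc2] show ?thesis by (simp add: C3_def)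
qed

section \<open>Configurations and steps of the flattened system\<close>

definition join :: "(nat \<Rightarrow> 's list) \<Rightarrow> 's list" where
  "join g = map (\<lambda>k. g (k div n1) ! (k mod n1)) [0..<n2 * n1]"

lemma index_less: "i < n2 \<Longrightarrow> j < n1 \<Longrightarrow> i * n1 + j < n2 * n1"
proof -
  assume *: "i < n2" "j < n1"
  then have "Suc i * n1 \<le> n2 * n1" by (intro mult_le_mono1) auto
  then show ?thesis using * by simp
qed

lemma length_join [simp]: "length (join g) = n2 * n1" by (simp add: join_def)

lemma join_nth: "i < n2 \<Longrightarrow> j < n1 \<Longrightarrow> join g ! (i * n1 + j) = g i ! j"
  using index_less by (simp add: join_def)

lemma join_update:
  assumes "i < n2" "j < n1" "length (g i) = n1"
  shows "(join g)[i * n1 + j := s] = join (g(i := (g i)[j := s]))"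
proof (rule nth_equalityI)
  fix k assume "k < length ((join g)[i * n1 + j := s])"
  then have k: "k < n2 * n1" by simp
  have m: "k mod n1 < n1" using assms(2) by simp
  have "k = i * n1 + j \<longleftrightarrow> k div n1 = i \<and> k mod n1 = j"
    using assms(2) by (metis div_mult_mod_eq div_mult_self3 div_less add_0_right add.commute gr_implies_not0 mod_mult_self3 mod_less)
  moreover have "(join g)[i * n1 + j := s] ! k =
      (if k = i * n1 + j then s else g (k div n1) ! (k mod n1))"
    using k index_less[OF assms(1,2)] by (simp add: join_def nth_list_update)
  ultimately show "(join g)[i * n1 + j := s] ! k = join (g(i := (g i)[j := s])) ! k"
    using k m assms by (auto simp: join_def nth_list_update)
qed simp

lemma join_cong: "(\<And>i. i < n2 \<Longrightarrow> g i = g' i) \<Longrightarrow> join g = join g'"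
  unfolding join_def by (intro map_cong) (auto simp: less_mult_imp_div_less)

definition lift :: "'t list \<Rightarrow> 's list" where
  "lift c = join (\<lambda>i. k1 (c ! i))"

definition valid :: "'t list \<times> (nat \<times> 'm) \<Rightarrow> bool" where
  "valid u \<longleftrightarrow> length (fst u) = n2 \<and> set (fst u) \<subseteq> states H \<and>
     fst (snd u) < n2 \<and> snd (snd u) \<in> set (locs H)"

lemma valid_nth: "valid (c, p) \<Longrightarrow> i < n2 \<Longrightarrow> c ! i \<in> states H"
  by (auto simp: valid_def)

lemma H_transition:
  "q \<in> states H \<Longrightarrow> (a, b, q') \<in> transitions H q \<Longrightarrow>
    q' \<in> states H \<and> a \<in> set (locs H) \<and> b \<in> set (locs H)"
  using H by (auto simp: is_gadget_def)

lemma valid_step: "robot_step sys2 u v \<Longrightarrow> valid u \<Longrightarrow> valid v"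
proof (induction rule: robot_step.induct)
  case (connect x y c)
  then have "{x, y} \<subseteq> {..<n2} \<times> set (locs H)" using wf2 by auto
  then show ?case using connect by (auto simp: valid_def)
next
  case (traverse i a b s' c)
  then have "c ! i \<in> states H" by (auto simp: valid_def)
  then show ?case using traverse H_transition[of "c ! i" a b s']
    by (auto simp: valid_def set_update_subset_insert dest!: set_update_subset_insert[THEN subsetD])
qed

lemma lift_update:
  assumes "i < n2" "length c = n2"
  shows "join ((\<lambda>m. k1 (c ! m))(i := k1 q)) = lift (c[i := q])"
  unfolding lift_def using assms by (intro join_cong) auto

lemma step1_length: "robot_step sys1 (c, x) (c', x') \<Longrightarrow> length c' = length c"
  by (auto elim: robot_step.cases)

lemma step1_less: "robot_step sys1 (c, x) (c', x') \<Longrightarrow> fst x' < n1"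
  using wf1 by (fastforce elim: robot_step.cases)

lemma step1_step3:
  assumes "robot_step sys1 (c, x) (c', x')" "i < n2" "length c = n1"
  shows "robot_step sys3 (join (g(i := c)), block i x) (join (g(i := c')), block i x')"
  using assms(1)
proof cases
  case connect
  then have "block i ` {x, x'} \<in> C3" using assms(2) unfolding C3_def
      by (intro UnI1 UN_I[of i] imageI) simp_all
  then have "{block i x, block i x'} \<in> connections sys3" by simp
  then show ?thesis using connect by (simp only: robot_step.connect)
next
  case (traverse j a b s')
  then have j: "j < n1" "(a, b, s') \<in> transitions G (c ! j)" by auto
  have "robot_step sys3 (join (g(i := c)), (i * n1 + j, a))
      ((join (g(i := c)))[i * n1 + j := s'], (i * n1 + j, b))"
    using j assms(2) by (intro robot_step.traverse) (auto simp: join_nth index_less)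
  then show ?thesis
    using traverse j assms by (simp add: join_update block_def)
qed

text \<open>Traversals and inner connections stay in block \<open>i\<close>. Only a connection of
  the outer system can leave it, and it starts at a designated location of the block.\<close>

lemma step3_cases:
  assumes st: "robot_step sys3 (join (g(i := c)), block i x) (e, y)"
    and i: "i < n2" "length c = n1" "fst x < n1"
  obtains c' x' where "robot_step sys1 (c, x) (c', x')" "e = join (g(i := c'))" "y = block i x'"
  | p p' where "{p, p'} \<in> C2" "block i x = place p" "y = place p'" "e = join (g(i := c))"
  using st
proof cases
  case connect
  then have "{block i x, y} \<in> C3" by simp
  then have "(\<exists>i'<n2. \<exists>f\<in>C1. {block i x, y} = block i' ` f) \<or> (\<exists>f\<in>C2. {block i x, y} = place ` f)"
    unfolding C3_def Un_iff UN_iff image_iff lessThan_iff Bex_def by (simp only: conj_assoc)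
  then consider i' f where "i' < n2" "f \<in> C1" "{block i x, y} = block i' ` f"
    | f where "f \<in> C2" "{block i x, y} = place ` f"
    by (elim disjE exE bexE conjE) simp_all
  then show ?thesis
  proof cases
    case 1
    obtain a a' where f: "f = {a, a'}" using wf1 1 by (auto simp: card_2_iff)
    have less: "fst a < n1" "fst a' < n1" using wf1 1 f by force+
    have "block i x = block i' a \<and> y = block i' a' \<or> block i x = block i' a' \<and> y = block i' a"
      using 1(3) f by (auto simp: doubleton_eq_iff)
    then have "i = i' \<and> (x = a \<and> y = block i' a' \<or> x = a' \<and> y = block i' a)"
      using less i by (auto simp: block_eq_iff)
    moreover have "{a, a'} \<in> C1" "{a', a} \<in> C1" using 1(2) f by (simp_all add: insert_commute)
    ultimately obtain x' where x': "{x, x'} \<in> C1" "y = block i x'" by metis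
    have "robot_step sys1 (c, x) (c, x')" using x' by (intro robot_step.connect) simp
    then show ?thesis using that(1) x' connect by blast
  next
    case 2
    obtain a a' where f: "f = {a, a'}" using wf2 2 by (auto simp: card_2_iff)
    have "block i x = place a \<and> y = place a' \<or> block i x = place a' \<and> y = place a"
      using 2(2) f by (auto simp: doubleton_eq_iff)
    moreover have "{a, a'} \<in> C2" "{a', a} \<in> C2" using 2(1) f by (simp_all add: insert_commute)
    ultimately show ?thesis using that(2)[of a a'] that(2)[of a' a] connect by metis
  qed
next
  case (traverse k a b s')
  obtain j l where x: "x = (j, l)" by (cases x)
  have k: "k = i * n1 + j" "l = a" using traverse x by (auto simp: block_def)
  have "(a, b, s') \<in> transitions G (c ! j)" "j < n1"
    using traverse i x k by (auto simp: join_nth)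
  then have "robot_step sys1 (c, x) (c[j := s'], (j, b))"
    using x k by (auto intro: robot_step.traverse)
  moreover have "e = join (g(i := c[j := s']))"
    using traverse k i x by (simp add: join_update)
  moreover have "y = block i (j, b)" using traverse k by (simp add: block_def)
  ultimately show ?thesis using that(1) by blast
qed

lemma block_notin_D3:
  assumes "fst x < n1" "x \<notin> D1"
  shows "block i x \<notin> D3"
proof
  assume "block i x \<in> D3"
  then obtain p where p: "block i x = place p" "snd p \<in> set (locs H)" using D2_sub by fastforce
  then have "x = e1 (snd p)" using assms(1) by (simp add: place_def block_eq_iff e1_less)
  then show False using assms p by blast
qed

lemma place_in_D3: "snd p \<in> set (locs H) \<Longrightarrow> place p \<in> D3 \<longleftrightarrow> p \<in> D2"
  using D2_sub place_eq_iff[of p] by fastforce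

lemma steps1_steps3:
  assumes "(avoiding_step sys1 D1)\<^sup>*\<^sup>* (c, x) (c', x')" "i < n2" "length c = n1"
  shows "(avoiding_step sys3 D3)\<^sup>*\<^sup>* (join (g(i := c)), block i x) (join (g(i := c')), block i x')
    \<and> length c' = n1"
  using assms(1)
proof (induction rule: rtranclp_induct2)
  case refl
  then show ?case using assms by simp
next
  case (step c' x' c'' x'')
  have st: "robot_step sys1 (c', x') (c'', x'')" "x'' \<notin> D1" and len: "length c' = n1"
    using step by simp_all
  have "robot_step sys3 (join (g(i := c')), block i x') (join (g(i := c'')), block i x'')"
    using step1_step3[OF st(1) assms(2) len] .
  moreover have "block i x'' \<notin> D3"
    using block_notin_D3[OF step1_less[OF st(1)] st(2)] .
  ultimately have "avoiding_step sys3 D3 (join (g(i := c')), block i x') (join (g(i := c'')),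
      block i x'')"
    by simp
  then show ?case
    using step.IH step1_length[OF st(1)] len by (metis (no_types,
        lifting) rtranclp.rtrancl_into_rtrancl)
qed

text \<open>A connection of the outer system is a single step of the flattened one, and a traversal
  of a copy of \<open>H\<close> is a passage through its block. The inner locations of the block are
  never in \<open>D3\<close>.\<close>

lemma step2_passage3:
  assumes "robot_step sys2 (c, p) (c', p')" "valid (c, p)"
  shows "passage sys3 D3 (lift c, place p) (lift c', place p')"
  using assms(1)
proof cases
  case connect
  then have "place ` {p, p'} \<in> C3" unfolding C3_def by (intro UnI2 imageI) simp
  then have "robot_step sys3 (lift c, place p) (lift c', place p')"
    using connect by (auto intro: robot_step.connect)
  then show ?thesis unfolding passage_def by blast
next
  case (traverse i a b s')
  let ?g = "\<lambda>m. k1 (c ! m)"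
  have i: "i < n2" "(a, b, s') \<in> transitions H (c ! i)" using traverse by auto
  have ci: "c ! i \<in> states H" using assms(2) i valid_nth by blast
  note s' = H_transition[OF ci i(2)]
  have len: "length (k1 (c ! i)) = n1" "length c = n2" using k1[OF ci] assms(2)
      by (auto simp: valid_def)
  have g: "?g(i := k1 (c ! i)) = ?g" by auto
  have "passage sys1 D1 (k1 (c ! i), e1 a) (k1 s', e1 b)"
    using passage1[OF ci, of a b] s' i by blast
  then consider "k1 (c ! i) = k1 s'" "e1 a = e1 b"
    | d y where "(avoiding_step sys1 D1)\<^sup>*\<^sup>* (k1 (c ! i), e1 a) (d, y)" "robot_step sys1 (d,
        y) (k1 s', e1 b)"
    unfolding passage_def by auto
  then show ?thesis
  proof cases
    \<comment> \<open>The empty passage: by injectivity of \<open>k1\<close> and \<open>e1\<close>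
      the transition of \<open>H\<close> returns to its entrance without changing the state.\<close>
    case 1
    then have "c ! i = s'" "a = b" using inj_k1 inj_e1 ci s' by (auto dest: inj_onD)
    then have "c' = c" "p' = p" using traverse by auto
    then show ?thesis by (simp add: passage_def)
  next
    case 2
    have *: "(avoiding_step sys3 D3)\<^sup>*\<^sup>* (join (?g(i := k1 (c ! i))), block i (e1 a)) (join (?g(i :=
        d)), block i y)"
      "length d = n1"
      using steps1_steps3[OF 2(1) i(1) len(1)] by auto
    have "robot_step sys3 (join (?g(i := d)), block i y) (join (?g(i := k1 s')), block i (e1 b))"
      using step1_step3[OF 2(2) i(1) *(2)] .
    then have "passage sys3 D3 (join ?g, block i (e1 a)) (join (?g(i := k1 s')), block i (e1 b))"
      using * unfolding passage_def g by blast
    then show ?thesis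
      using traverse i len by (simp only: lift_update place_def) (simp add: lift_def)
  qed
qed

text \<open>An outer step ending outside \<open>D2\<close> becomes a passage ending outside
  \<open>D3\<close>, hence an avoiding path; such paths can be chained.\<close>

lemma passage2_passage3:
  assumes "passage sys2 D2 (c, p) (c', p')" "valid (c, p)" "p' \<in> D2"
  shows "passage sys3 D3 (lift c, place p) (lift c', place p')"
proof -
  have steps: "valid (d, q) \<and> (avoiding_step sys3 D3)\<^sup>*\<^sup>* (lift c, place p) (lift d, place q)"
    if "(avoiding_step sys2 D2)\<^sup>*\<^sup>* (c, p) (d, q)" for d q
    using that
  proof (induction rule: rtranclp_induct2)
    case refl
    then show ?case using assms by simp
  next
    case (step d q d' q')
    then have v: "valid (d', q')" using valid_step by blast
    then have nD: "place q' \<notin> D3" using step place_in_D3[of q'] by (simp add: valid_def)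
    have "passage sys3 D3 (lift d, place q) (lift d', place q')"
      using step by (intro step2_passage3) auto
    then have "(avoiding_step sys3 D3)\<^sup>*\<^sup>* (lift d, place q) (lift d', place q')"
      using nD unfolding passage_def by (auto intro: rtranclp.rtrancl_into_rtrancl)
    then show ?case using v step.IH by auto
  qed
  have p'3: "place p' \<in> D3" using assms(3) by blast
  from assms(1) consider "(c, p) = (c', p')"
    | d q where "(avoiding_step sys2 D2)\<^sup>*\<^sup>* (c, p) (d, q)" "robot_step sys2 (d, q) (c', p')"
    unfolding passage_def by auto
  then show ?thesis
  proof cases
    case 1
    then show ?thesis by (simp add: passage_def)
  next
    case 2
    then show ?thesis
      using steps[OF 2(1)] step2_passage3[OF 2(2)] p'3 by (auto intro: avoiding_steps_passage)
  qed
qed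

text \<open>The robot has entered the block of \<open>p\<close> at the location of \<open>p\<close>
  and has met no designated location of the block since. As far as the outer system is concerned it
  is still at \<open>p\<close> with configuration \<open>c\<close>, although the states in the block
  need not encode a state of \<open>H\<close>.\<close>

definition excursion :: "'t list \<Rightarrow> nat \<times> 'm \<Rightarrow> 's list \<times> (nat \<times> 'l) \<Rightarrow> bool" where
  "excursion c p z \<longleftrightarrow> (\<exists>d y. (avoiding_step sys1 D1)\<^sup>*\<^sup>* (k1 (c ! fst p), e1 (snd p)) (d, y) \<and>
     length d = n1 \<and> fst y < n1 \<and> z = (join ((\<lambda>m. k1 (c ! m))(fst p := d)), block (fst p) y))"

lemma excursion_start:
  assumes "valid (c, p)"
  shows "excursion c p (lift c, place p)"
proof -
  have "(\<lambda>m. k1 (c ! m))(fst p := k1 (c ! fst p)) = (\<lambda>m. k1 (c ! m))" by auto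
  moreover have "length (k1 (c ! fst p)) = n1" using assms k1 valid_nth by (auto simp: valid_def)
  ultimately show ?thesis
    using assms e1_less unfolding excursion_def
    by (intro exI[of _ "k1 (c ! fst p)"] exI[of _ "e1 (snd p)"])
      (auto simp: lift_def place_def valid_def)
qed

text \<open>An excursion ends when it reaches a designated location of its block;
  \<open>passage1\<close> then turns it into one transition of \<open>H\<close> or into no move at
  all. An outer connection also starts at a designated location, where an avoiding path can only be
  empty, so nothing has happened in the block before it is taken.\<close>

lemma excursion_step:
  assumes ex: "excursion c p z" and st: "robot_step sys3 z z'" and val: "valid (c, p)"
  obtains "excursion c p z'" "snd z' \<notin> D3"
  | c' p' where "z' = (lift c', place p')" "robot_step sys2 (c, p) (c', p') \<or> (c, p) = (c', p')"
proof -
  obtain i a where p: "p = (i, a)" by (cases p)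
  let ?g = "\<lambda>m. k1 (c ! m)"
  obtain d y where d: "(avoiding_step sys1 D1)\<^sup>*\<^sup>* (k1 (c ! i), e1 a) (d, y)"
      "length d = n1" "fst y < n1" "z = (join (?g(i := d)), block i y)"
    using ex unfolding excursion_def p by auto
  have i: "i < n2" "a \<in> set (locs H)" "length c = n2" using val by (auto simp: valid_def p)
  have ci: "c ! i \<in> states H" using val i valid_nth by blast
  obtain e w where z': "z' = (e, w)" by (cases z')
  from st[unfolded d z'] i(1) d(2,3) show ?thesis
  proof (cases rule: step3_cases)
    case (1 d' y')
    have len: "length d' = n1" "fst y' < n1" using 1 d step1_length[of d y] step1_less[of d y] by auto
    show ?thesis
    proof (cases "y' \<in> D1")
      case False
      then have "(avoiding_step sys1 D1)\<^sup>*\<^sup>* (k1 (c ! i), e1 a) (d', y')"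
        using d(1) 1(1) by (auto intro: rtranclp.rtrancl_into_rtrancl)
      then have "excursion c p z'"
        using len 1(2,3) z' unfolding excursion_def p
        by (intro exI[of _ d'] exI[of _ y']) (unfold fst_conv snd_conv, intro conjI; simp only:)
      moreover have "snd z' \<notin> D3" using block_notin_D3[OF len(2) False] 1 z' by simp
      ultimately show ?thesis using that(1) by blast
    next
      case True
      then obtain b where b: "b \<in> set (locs H)" "y' = e1 b" by auto
      have "passage sys1 D1 (k1 (c ! i), e1 a) (d', e1 b)"
        using d(1) 1(1) b unfolding passage_def by blast
      then obtain q' where q': "q' \<in> states H" "d' = k1 q'"
          "(a, b, q') \<in> transitions H (c ! i) \<or> a = b \<and> c ! i = q'"
        using passage1[OF ci i(2) b(1)] by auto
      have "z' = (lift (c[i := q']), place (i, b))"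
        using z' 1 b q' i lift_update[of i c q'] by (simp add: place_def)
      moreover have "robot_step sys2 (c, p) (c[i := q'], (i, b)) \<or> (c, p) = (c[i := q'], (i, b))"
        using q'(3) i p by (auto intro: robot_step.traverse)
      ultimately show ?thesis using that(2) by blast
    qed
  next
    case (2 r r')
    have r: "snd r \<in> set (locs H)" using 2(1) wf2 by force
    have y: "y = e1 (snd r)" "i = fst r"
      using 2(2) d(3) r by (auto simp: place_def block_eq_iff e1_less)
    then have "(k1 (c ! i), e1 a) = (d, y)"
      using avoiding_steps_target[OF d(1)] r by auto
    then have d': "d = k1 (c ! i)" and "e1 a = e1 (snd r)" using y by auto
    then have "a = snd r" using inj_e1 i r by (auto dest: inj_onD)
    then have "r = p" using y by (simp add: p)
    moreover have "?g(i := k1 (c ! i)) = ?g" by auto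
    ultimately have "z' = (lift c, place r')" using 2 z' d' by (simp add: lift_def)
    moreover have "robot_step sys2 (c, p) (c, r')"
      using 2(1) \<open>r = p\<close> by (auto intro: robot_step.connect)
    ultimately show ?thesis using that(2) by blast
  qed
qed

lemma passage3_passage2:
  assumes "passage sys3 D3 (lift c, place p) (f, place p')" "valid (c, p)" "p' \<in> D2"
  shows "\<exists>c'. f = lift c' \<and> passage sys2 D2 (c, p) (c', p')"
proof -
  \<comment> \<open>Invariant: every path in the flattened system is shadowed by a path of completed
    moves in the outer system, followed by an unfinished excursion.\<close>
  have reach: "\<exists>d q. (avoiding_step sys2 D2)\<^sup>*\<^sup>* (c, p) (d, q) \<and> valid (d, q) \<and> excursion d q z"
    if "(avoiding_step sys3 D3)\<^sup>*\<^sup>* (lift c, place p) z" for z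
    using that
  proof induction
    case base
    then show ?case using assms(2) excursion_start by blast
  next
    case (step z z')
    then obtain d q where d: "(avoiding_step sys2 D2)\<^sup>*\<^sup>* (c, p) (d, q)" "valid (d, q)"
        "excursion d q z"
      by blast
    have st: "robot_step sys3 z z'" "snd z' \<notin> D3" using step by auto
    from d(3) st(1) d(2) show ?case
    proof (cases rule: excursion_step)
      case 1
      then show ?thesis using d by blast
    next
      case (2 d' q')
      then have v: "valid (d', q')" using d(2) valid_step by blast
      then have "q' \<notin> D2" using 2(1) st(2) by auto
      then have "(avoiding_step sys2 D2)\<^sup>*\<^sup>* (c, p) (d', q')"
        using d(1) 2(2) by (auto intro: rtranclp.rtrancl_into_rtrancl)
      then show ?thesis using v excursion_start[OF v] 2(1) by blast
    qed
  qed
  have p': "snd p' \<in> set (locs H)" using assms(3) D2_sub by force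
  from assms(1) consider "(lift c, place p) = (f, place p')"
    | z where "(avoiding_step sys3 D3)\<^sup>*\<^sup>* (lift c, place p) z" "robot_step sys3 z (f, place p')"
    unfolding passage_def by auto
  then show ?thesis
  proof cases
    case 1
    then have "p = p'" using place_eq_iff[of p p'] assms(2) p' by (simp add: valid_def)
    then show ?thesis using 1 unfolding passage_def by blast
  next
    case 2
    obtain d q where d: "(avoiding_step sys2 D2)\<^sup>*\<^sup>* (c, p) (d, q)" "valid (d, q)" "excursion d q z"
      using reach[OF 2(1)] by blast
    from d(3) 2(2) d(2) show ?thesis
    proof (cases rule: excursion_step)
      case 1
      then show ?thesis using assms(3) by simp
    next
      case (2 d' q')
      then have "valid (d', q')" using d(2) valid_step by blast
      then have "q' = p'" using 2(1) place_eq_iff[of q' p'] p' by (simp add: valid_def)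
      moreover from 2(2) have "passage sys2 D2 (c, p) (d', q')"
      proof
        assume "robot_step sys2 (d, q) (d', q')"
        then show ?thesis using d(1) unfolding passage_def by blast
      next
        \<comment> \<open>The last excursion was no move, so the outer path already ends in
          \<open>D2\<close>; as it avoids \<open>D2\<close>, it must be empty.\<close>
        assume eq: "(d, q) = (d', q')"
        then have "(c, p) = (d, q)"
          using avoiding_steps_target[OF d(1)] \<open>q' = p'\<close> assms(3) by auto
        then show ?thesis using eq by (simp add: passage_def)
      qed
      ultimately show ?thesis using 2(1) by auto
    qed
  qed
qed

lemma lift_inj:
  assumes "length c = n2" "length c' = n2" "set c \<subseteq> states H" "set c' \<subseteq> states H" "lift c = lift c'"
  shows "c = c'"
proof (rule nth_equalityI)
  fix i assume "i < length c"
  then have i: "i < n2" using assms by simp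
  have st: "c ! i \<in> states H" "c' ! i \<in> states H" using i assms by (auto simp: subset_iff)
  have "k1 (c ! i) = k1 (c' ! i)"
  proof (rule nth_equalityI)
    show "length (k1 (c ! i)) = length (k1 (c' ! i))" using st k1 by simp
    fix j assume "j < length (k1 (c ! i))"
    then have "j < n1" using st k1 by simp
    then show "k1 (c ! i) ! j = k1 (c' ! i) ! j"
      using i assms(5) join_nth[of i j "\<lambda>i. k1 (c ! i)"] join_nth[of i j "\<lambda>i. k1 (c' ! i)"]
      by (simp add: lift_def)
  qed
  then show "c ! i = c' ! i" using st inj_k1 by (auto dest: inj_onD)
qed (use assms in simp)

lemma lift_states:
  assumes "length c = n2" "set c \<subseteq> states H"
  shows "set (lift c) \<subseteq> states G"
proof
  fix s assume "s \<in> set (lift c)"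
  then obtain k where k: "k < n2 * n1" "s = k1 (c ! (k div n1)) ! (k mod n1)"
    by (auto simp: lift_def join_def)
  then have "n1 > 0" by (auto intro: gr0I)
  then have "k div n1 < n2" "k mod n1 < n1" using k(1) by (auto simp: div_less_iff_less_mult)
  moreover from this have "c ! (k div n1) \<in> states H" using assms by (auto simp: subset_iff)
  ultimately show "s \<in> states G" using k1 k(2) by (metis nth_mem subsetD)
qed

lemma disc_simulation_substitution:
  "disc_simulation G K (n2 * n1) C3 (place \<circ> e2) (lift \<circ> k2)"
  unfolding disc_simulation_def
proof (intro conjI ballI allI)
  show "planar_disc (locs G) {..<n2 * n1} C3 (map (place \<circ> e2) (locs K))" by (rule disc3)
  show "inj_on (lift \<circ> k2) (states K)"
    using k2 lift_inj inj_k2 by (auto simp: inj_on_def)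
  fix q assume q: "q \<in> states K"
  show "length ((lift \<circ> k2) q) = n2 * n1" by (simp add: lift_def)
  show "set ((lift \<circ> k2) q) \<subseteq> states G" using k2[OF q] lift_states by simp
  fix a b c assume ab: "a \<in> set (locs K)" "b \<in> set (locs K)"
  have v: "valid (k2 q, e2 a)" using k2[OF q] D2_sub ab by (auto simp: valid_def)
  have "passage sys3 D3 (lift (k2 q), place (e2 a)) (c, place (e2 b)) \<longleftrightarrow>
      (\<exists>c'. c = lift c' \<and> passage sys2 D2 (k2 q, e2 a) (c', e2 b))"
    using passage3_passage2[OF _ v] passage2_passage3[OF _ v] ab by blast
  then show "passage sys3 ((place \<circ> e2) ` set (locs K)) ((lift \<circ> k2) q, (place \<circ> e2) a) (c,
      (place \<circ> e2) b) \<longleftrightarrow>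
      (\<exists>q' \<in> states K. c = (lift \<circ> k2) q' \<and> ((a, b, q') \<in> transitions K q \<or> a = b \<and> q = q'))"
    using passage2[OF q ab] by (auto simp: image_comp)
qed

end

theorem disc_simulates_trans:
  assumes "disc_simulates G H" "disc_simulates H K" "is_gadget G" "is_gadget H"
  shows "disc_simulates G K"
  using assms disc_substitution.disc_simulation_substitution[OF disc_substitution.intro]
  unfolding disc_simulates_def by metis

section \<open>Simulations of locking 2-toggles\<close>

lemma robot_step_copies:
  "robot_step (copies G n C) (c, (i, a)) (c', (j, b)) \<longleftrightarrow>
     {(i, a), (j, b)} \<in> C \<and> c' = c \<or>
     i = j \<and> i < n \<and> (\<exists>s'. (a, b, s') \<in> transitions G (c ! i) \<and> c' = c[i := s'])"
  (is "?L \<longleftrightarrow> ?R")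
proof
  show ?R if ?L using that by (cases rule: robot_step.cases) auto
  assume ?R
  then show ?L using robot_step.connect[of "(i, a)" "(j, b)" "copies G n C" c]
      robot_step.traverse[of i "copies G n C" a b _ c] by auto
qed

text \<open>A nonempty passage with all its intermediate points listed, so that a concrete one can
  be checked by rewriting.\<close>

fun walk :: "('l, 's) system \<Rightarrow> (nat \<times> 'l) set \<Rightarrow> 's list \<times> (nat \<times> 'l) \<Rightarrow>
    ('s list \<times> (nat \<times> 'l)) list \<Rightarrow> 's list \<times> (nat \<times> 'l) \<Rightarrow> bool" where
  "walk S D u [] v \<longleftrightarrow> robot_step S u v"
| "walk S D u (w # ws) v \<longleftrightarrow> robot_step S u w \<and> snd w \<notin> D \<and> walk S D w ws v"

lemma walk_passage: "walk S D u ws v \<Longrightarrow> passage S D u v"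
proof (induction ws arbitrary: u)
  case Nil
  then have "robot_step S u v" by simp
  then show ?case unfolding passage_def by blast
next
  case (Cons w ws)
  then have w: "avoiding_step S D u w" by simp
  from Cons have "passage S D w v" by simp
  then consider "w = v" | z where "(avoiding_step S D)\<^sup>*\<^sup>* w z" "robot_step S z v"
    unfolding passage_def by blast
  then show ?case
  proof cases
    case 1
    then show ?thesis using w unfolding passage_def by blast
  next
    case 2
    from converse_rtranclp_into_rtranclp[of "avoiding_step S D", OF w 2(1)] 2(2)
    show ?thesis unfolding passage_def by blast
  qed
qed

lemma robot_step_sym:
  assumes "reversible G" "is_gadget G" "robot_step (copies G n C) (c, x) (c', y)"
    "length c = n" "set c \<subseteq> states G"
  shows "robot_step (copies G n C) (c', y) (c, x)"
  using assms(3)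
proof cases
  case connect
  then show ?thesis by (auto simp: insert_commute intro: robot_step.connect)
next
  case (traverse i a b s')
  then have "c ! i \<in> states G" using assms by auto
  then have "((c ! i, a), (s', b)) \<in> transition_graph G"
    using traverse by (auto simp: transition_graph_def)
  then have "((s', b), (c ! i, a)) \<in> transition_graph G"
    using assms(1) by (auto simp: reversible_def dest: symD)
  then have "(b, a, c ! i) \<in> transitions G s'" by (auto simp: transition_graph_def)
  then have "robot_step (copies G n C) (c', (i, b)) (c'[i := c ! i], (i, a))"
    using traverse assms(4) by (intro robot_step.traverse) auto
  then show ?thesis using traverse by simp
qed

text \<open>Each step can be undone by \<open>robot_step_sym\<close>, and the intermediate points to
  be avoided are the same in both directions.\<close>

lemma passage_sym:
  assumes "reversible G" "is_gadget G" "length c = n" "set c \<subseteq> states G"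
    "passage (copies G n C) D (c, x) (c', y)" "x \<in> D"
  shows "passage (copies G n C) D (c', y) (c, x)"
proof -
  let ?S = "copies G n C"
  have val: "length d = n \<and> set d \<subseteq> states G" if "(robot_step ?S)\<^sup>*\<^sup>* (c, x) (d, z)" for d z
    using that
  proof (induction rule: rtranclp_induct2)
    case refl
    then show ?case using assms by simp
  next
    case (step d z d' z')
    from step(2) show ?case
    proof cases
      case (traverse i a b s')
      then have "d ! i \<in> states G" using step by auto
      then have "s' \<in> states G" using traverse assms(2) by (fastforce simp: is_gadget_def)
      then show ?thesis using traverse step by (auto dest: set_update_subset_insert[THEN subsetD])
    qed (use step in auto)
  qed
  \<comment> \<open>Reversed, the first step of the path becomes the last one. It ends at the start
    \<open>x\<close> and is exempt from avoiding \<open>D\<close>, hence it is split off as the step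
    from \<open>w\<close>.\<close>
  have rev: "(avoiding_step ?S D)\<^sup>*\<^sup>* (c, x) z \<Longrightarrow> z = (c, x) \<or>
      (\<exists>w. snd z \<notin> D \<and> (avoiding_step ?S D)\<^sup>*\<^sup>* z w \<and> robot_step ?S w (c, x))" for z
  proof (induction rule: rtranclp_induct)
    case base
    then show ?case by simp
  next
    case (step z z')
    have "(robot_step ?S)\<^sup>*\<^sup>* (c, x) z" using step(1) by (rule rtranclp_mono[THEN predicate2D,
        rotated]) auto
    then have undo: "robot_step ?S z' z"
      using step(2) val[of "fst z" "snd z"] robot_step_sym[OF assms(1,2), of n C "fst z" "snd z"
          "fst z'" "snd z'"]
      by simp
    from step.IH show ?case
    proof
      assume "z = (c, x)"
      then show ?thesis using undo step(2) by blast
    next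
      assume "\<exists>w. snd z \<notin> D \<and> (avoiding_step ?S D)\<^sup>*\<^sup>* z w \<and> robot_step ?S w (c, x)"
      then obtain w where w: "snd z \<notin> D" "(avoiding_step ?S D)\<^sup>*\<^sup>* z w" "robot_step ?S w (c, x)"
        by (elim exE conjE)
      have "avoiding_step ?S D z' z" using undo w(1) by simp
      from converse_rtranclp_into_rtranclp[of "avoiding_step ?S D", OF this w(2)]
      show ?thesis using w(3) step(2) by (intro disjI2 exI[of _ w] conjI) simp_all
    qed
  qed
  from assms(5) consider "(c, x) = (c', y)"
    | z where "(avoiding_step ?S D)\<^sup>*\<^sup>* (c, x) z" "robot_step ?S z (c', y)"
    unfolding passage_def by blast
  then show ?thesis
  proof cases
    case 1
    then show ?thesis by (simp add: passage_def)
  next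
    case 2
    have "(robot_step ?S)\<^sup>*\<^sup>* (c, x) z" using 2(1) by (rule rtranclp_mono[THEN predicate2D,
        rotated]) auto
    then have undo: "robot_step ?S (c', y) z"
      using 2(2) val[of "fst z" "snd z"] robot_step_sym[OF assms(1,2), of n C "fst z" "snd z" c' y]
      by simp
    from rev[OF 2(1)] show ?thesis
    proof
      assume "z = (c, x)"
      then show ?thesis using undo unfolding passage_def by (intro disjI2 exI[of _ "(c', y)"]) simp
    next
      assume "\<exists>w. snd z \<notin> D \<and> (avoiding_step ?S D)\<^sup>*\<^sup>* z w \<and> robot_step ?S w (c, x)"
      then obtain w where w: "snd z \<notin> D" "(avoiding_step ?S D)\<^sup>*\<^sup>* z w" "robot_step ?S w (c, x)"
        by (elim exE conjE)
      have "avoiding_step ?S D (c', y) z" using undo w(1) by simp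
      from converse_rtranclp_into_rtranclp[of "avoiding_step ?S D", OF this w(2)]
      show ?thesis using w(3) unfolding passage_def by (intro disjI2 exI[of _ w] conjI)
    qed
  qed
qed

lemma toggle_gadget:
  assumes "distinct cyc" "set cyc = UNIV"
  shows "is_gadget (locking_2_toggle cyc)"
  using assms by (auto simp: is_gadget_def locking_2_toggle_def split: toggle_state.splits)

lemma toggle_loc_UNIV: "UNIV = {A1, B1, A2, B2}"
  using toggle_loc.exhaust by blast

lemma locking_2_toggle_simps [simp]:
  "locs (locking_2_toggle cyc) = cyc" "states (locking_2_toggle cyc) = {M, S1, S2}"
  "transitions (locking_2_toggle cyc) M = {(A1, B1, S1), (A2, B2, S2)}"
  "transitions (locking_2_toggle cyc) S1 = {(B1, A1, M)}"
  "transitions (locking_2_toggle cyc) S2 = {(B2, A2, M)}"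
  by (simp_all add: locking_2_toggle_def)

lemma locking_2_toggle_reversible: "reversible (locking_2_toggle cyc)"
  unfolding reversible_def transition_graph_def
  by (rule symI) (auto simp: locking_2_toggle_def split: toggle_state.splits)

text \<open>The way back through either route follows from \<open>passage_sym\<close>, so only the
  two forward passages have to be exhibited. The rest are upper bounds: what the four live entrances
  permit, and that every other entrance leads nowhere.\<close>

lemma toggle_simulationI:
  fixes G :: "('l, 's) gadget" and conf :: "toggle_state \<Rightarrow> 's list"
  defines "D \<equiv> \<lambda>ext. ext ` (UNIV :: toggle_loc set)"
  assumes G: "is_gadget G" "reversible G" and cyc: "distinct cyc" "set cyc = UNIV"
    and pd: "planar_disc (locs G) {..<n} C (map ext cyc)"
    and conf: "inj conf" "\<And>q. length (conf q) = n \<and> set (conf q) \<subseteq> states G"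
    and fwd: "passage (copies G n C) (D ext) (conf M, ext A1) (conf S1, ext B1)"
      "passage (copies G n C) (D ext) (conf M, ext A2) (conf S2, ext B2)"
    and conf1: "\<And>c b. passage (copies G n C) (D ext) (conf M, ext A1) (c, ext b) \<Longrightarrow>
        (c, b) = (conf M, A1) \<or> (c, b) = (conf S1, B1)"
      "\<And>c b. passage (copies G n C) (D ext) (conf M, ext A2) (c, ext b) \<Longrightarrow>
        (c, b) = (conf M, A2) \<or> (c, b) = (conf S2, B2)"
      "\<And>c b. passage (copies G n C) (D ext) (conf S1, ext B1) (c, ext b) \<Longrightarrow>
        (c, b) = (conf S1, B1) \<or> (c, b) = (conf M, A1)"
      "\<And>c b. passage (copies G n C) (D ext) (conf S2, ext B2) (c, ext b) \<Longrightarrow>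
        (c, b) = (conf S2, B2) \<or> (c, b) = (conf M, A2)"
    and stuck: "\<And>q a c b. passage (copies G n C) (D ext) (conf q, ext a) (c, ext b) \<Longrightarrow>
        (q, a) \<notin> {(M, A1), (M, A2), (S1, B1), (S2, B2)} \<Longrightarrow> (c, b) = (conf q, a)"
  shows "disc_simulates G (locking_2_toggle cyc)"
proof -
  have bwd: "passage (copies G n C) (D ext) (conf S1, ext B1) (conf M, ext A1)"
      "passage (copies G n C) (D ext) (conf S2, ext B2) (conf M, ext A2)"
    using passage_sym[OF G(2,1) _ _ fwd(1)] passage_sym[OF G(2,1) _ _ fwd(2)] conf(2)[of M]
    by (auto simp: D_def)
  have refl: "passage (copies G n C) (D ext) (conf q, ext l) (conf q, ext l)" for q l
      by (simp add: passage_def)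
  have inj: "conf q = conf q' \<longleftrightarrow> q = q'" for q q' using conf(1) by (auto dest: injD)
  have "passage (copies G n C) (D ext) (conf q, ext a) (c, ext b) \<longleftrightarrow>
      (\<exists>q'. c = conf q' \<and> ((a, b, q') \<in> transitions (locking_2_toggle cyc) q \<or> a = b \<and> q = q'))"
    for q a b c
  proof
    assume p: "passage (copies G n C) (D ext) (conf q, ext a) (c, ext b)"
    show "\<exists>q'. c = conf q' \<and> ((a, b, q') \<in> transitions (locking_2_toggle cyc) q \<or> a = b \<and> q = q')"
    proof (cases "(q, a) \<in> {(M, A1), (M, A2), (S1, B1), (S2, B2)}")
      case True
      then show ?thesis using p conf1 by fastforce
    next
      case False
      then show ?thesis using stuck[OF p] by blast
    qed
  next
    assume "\<exists>q'. c = conf q' \<and> ((a, b, q') \<in> transitions (locking_2_toggle cyc) q \<or> a = b \<and> q = q')"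
    then show "passage (copies G n C) (D ext) (conf q, ext a) (c, ext b)"
      using fwd bwd refl by (cases q) auto
  qed
  moreover have "{M, S1, S2} = UNIV" using toggle_state.exhaust by blast
  ultimately have "disc_simulation G (locking_2_toggle cyc) n C ext conf"
    using pd conf cyc by (simp add: disc_simulation_def D_def)
  then show ?thesis unfolding disc_simulates_def by blast
qed

lemma toggle_gadgets:
  "is_gadget parallel_locking_2_toggle" "is_gadget antiparallel_locking_2_toggle"
  "is_gadget crossing_locking_2_toggle"
  unfolding parallel_locking_2_toggle_def antiparallel_locking_2_toggle_def crossing_locking_2_toggle_def
  by (auto intro!: toggle_gadget simp: toggle_loc_UNIV)

text \<open>Contracting the connected components of the connection graph to nodes, the robot moves
  between pairs of a configuration and a node; \<open>R\<close> over-approximates the reachable pairs.\<close>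

definition closed_nodes ::
  "('l, 's) gadget \<Rightarrow> nat \<Rightarrow> (nat \<times> 'l \<Rightarrow> nat) \<Rightarrow> ('s list \<times> nat) set \<Rightarrow> bool" where
  "closed_nodes G n nd R \<longleftrightarrow> (\<forall>(c, N) \<in> R. \<forall>i<n. \<forall>(a, b, s') \<in> transitions G (c ! i).
     nd (i, a) = N \<longrightarrow> (c[i := s'], nd (i, b)) \<in> R)"

lemma passage_closed_nodes:
  assumes p: "passage (copies G n C) D (c, x) (c', y)" and R: "closed_nodes G n nd R"
    and nd: "\<forall>e \<in> C. \<forall>x \<in> e. \<forall>y \<in> e. nd x = nd y" and c: "(c, nd x) \<in> R"
  shows "(c', nd y) \<in> R"
proof -
  have step: "(d', nd w) \<in> R" if "robot_step (copies G n C) (d, z) (d', w)" "(d, nd z) \<in> R" for d z d' w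
    using that(1)
  proof cases
    case connect
    then have "nd w = nd z" using nd by auto
    then show ?thesis using connect that(2) by simp
  next
    case traverse
    then show ?thesis using R that(2) unfolding closed_nodes_def by fastforce
  qed
  have steps: "(d, nd z) \<in> R" if "(avoiding_step (copies G n C) D)\<^sup>*\<^sup>* (c, x) (d, z)" for d z
    using that by (induction rule: rtranclp_induct2) (use c step in auto)
  from p consider "(c, x) = (c', y)"
    | u where "(avoiding_step (copies G n C) D)\<^sup>*\<^sup>* (c, x) u" "robot_step (copies G n C) u (c', y)"
    unfolding passage_def by blast
  then show ?thesis
  proof cases
    case 1
    then show ?thesis using c by simp
  next
    case (2 u)
    obtain d z where "u = (d, z)" by (cases u)
    then show ?thesis using 2 steps[of d z] step[of d z c' y] by simp
  qed
qed

text \<open>\<open>R1\<close> bounds what can be reached from \<open>A1\<close> in \<open>M\<close>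
  and likewise from \<open>B1\<close> in \<open>S1\<close>, as it contains both ends of the first
  route and is closed; \<open>R2\<close> does the same for the second. Injectivity of
  \<open>nd\<close> on the terminals makes a node reveal which of them has been reached.\<close>

lemma toggle_simulation_by_nodes:
  fixes G :: "('l, 's) gadget" and conf :: "toggle_state \<Rightarrow> 's list"
  assumes G: "is_gadget G" "reversible G" and cyc: "distinct cyc" "set cyc = UNIV"
    and pd: "planar_disc (locs G) {..<n} C (map ext cyc)"
    and conf: "inj conf" "\<And>q. length (conf q) = n \<and> set (conf q) \<subseteq> states G"
    and fwd: "walk (copies G n C) (ext ` UNIV) (conf M, ext A1) ws1 (conf S1, ext B1)"
      "walk (copies G n C) (ext ` UNIV) (conf M, ext A2) ws2 (conf S2, ext B2)"
    and nd: "\<forall>e \<in> C. \<forall>x \<in> e. \<forall>y \<in> e. nd x = nd y" "inj (nd \<circ> ext)"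
    and closed: "closed_nodes G n nd R1" "closed_nodes G n nd R2"
      "\<And>q a. (q, a) \<notin> {(M, A1), (M, A2), (S1, B1), (S2, B2)} \<Longrightarrow>
        closed_nodes G n nd {(conf q, nd (ext a))}"
    and R1: "(conf M, nd (ext A1)) \<in> R1" "(conf S1, nd (ext B1)) \<in> R1"
      "\<And>c b. (c, nd (ext b)) \<in> R1 \<Longrightarrow> (c, b) = (conf M, A1) \<or> (c, b) = (conf S1, B1)"
    and R2: "(conf M, nd (ext A2)) \<in> R2" "(conf S2, nd (ext B2)) \<in> R2"
      "\<And>c b. (c, nd (ext b)) \<in> R2 \<Longrightarrow> (c, b) = (conf M, A2) \<or> (c, b) = (conf S2, B2)"
  shows "disc_simulates G (locking_2_toggle cyc)"
proof (rule toggle_simulationI[OF G cyc pd conf])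
  note confine = passage_closed_nodes[OF _ _ nd(1)]
  let ?D = "ext ` UNIV"
  show "passage (copies G n C) ?D (conf M, ext A1) (conf S1, ext B1)"
    "passage (copies G n C) ?D (conf M, ext A2) (conf S2, ext B2)"
    using fwd by (auto intro: walk_passage)
  fix c b
  show "(c, b) = (conf M, A1) \<or> (c, b) = (conf S1, B1)"
    if "passage (copies G n C) ?D (conf M, ext A1) (c, ext b)"
    using R1(3)[OF confine[OF that closed(1) R1(1)]] .
  show "(c, b) = (conf M, A2) \<or> (c, b) = (conf S2, B2)"
    if "passage (copies G n C) ?D (conf M, ext A2) (c, ext b)"
    using R2(3)[OF confine[OF that closed(2) R2(1)]] .
  show "(c, b) = (conf S1, B1) \<or> (c, b) = (conf M, A1)"
    if "passage (copies G n C) ?D (conf S1, ext B1) (c, ext b)"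
    using R1(3)[OF confine[OF that closed(1) R1(2)]] by blast
  show "(c, b) = (conf S2, B2) \<or> (c, b) = (conf M, A2)"
    if "passage (copies G n C) ?D (conf S2, ext B2) (c, ext b)"
    using R2(3)[OF confine[OF that closed(2) R2(2)]] by blast
  fix q a
  assume "passage (copies G n C) ?D (conf q, ext a) (c, ext b)"
    and "(q, a) \<notin> {(M, A1), (M, A2), (S1, B1), (S2, B2)}"
  then have "(c, nd (ext b)) \<in> {(conf q, nd (ext a))}" using confine closed(3) by blast
  then show "(c, b) = (conf q, a)" using injD[OF nd(2), of b a] by simp
qed

text \<open>All four inner ends of two antiparallel toggles meet in one node. The first toggle excludes
  entering at \<open>A1\<close> against leaving at \<open>B2\<close>, the second entering at \<open>A2\<close> against leaving at \<open>B1\<close>.\<close>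

lemma antiparallel_simulates_crossing:
  "disc_simulates antiparallel_locking_2_toggle crossing_locking_2_toggle"
proof -
  let ?G = antiparallel_locking_2_toggle
  define C :: "(nat \<times> toggle_loc) set set"
    where "C = {{(0, A2), (1, A2)}, {(0, A2), (1, B1)}, {(0, B1), (0, A2)}}"
  \<comment> \<open>The first route goes from \<open>A1\<close> to \<open>B1\<close> in gadget 0 and
    then from \<open>A2\<close> to \<open>B2\<close> in gadget 1; the second one does the same with
    the two gadgets exchanged.\<close>
  define ext :: "toggle_loc \<Rightarrow> nat \<times> toggle_loc"
    where "ext l = (case l of A1 \<Rightarrow> (0, A1) | B1 \<Rightarrow> (1, B2) | A2 \<Rightarrow> (1, A1) | B2 \<Rightarrow> (0, B2))" for l
  define conf :: "toggle_state \<Rightarrow> toggle_state list"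
    where "conf q = (case q of M \<Rightarrow> [M, M] | S1 \<Rightarrow> [S1, S2] | S2 \<Rightarrow> [S2, S1])" for q
  define nd :: "nat \<times> toggle_loc \<Rightarrow> nat"
    where "nd p = (if p = (0, A1) then 1 else if p = (1, B2) then 2 else if p = (1, A1) then 3
      else if p = (0, B2) then 4 else 0)" for p
  have ext [simp]: "ext A1 = (0, A1)" "ext B1 = (1, B2)" "ext A2 = (1, A1)" "ext B2 = (0, B2)"
    by (simp_all add: ext_def)
  have conf [simp]: "conf M = [M, M]" "conf S1 = [S1, S2]" "conf S2 = [S2, S1]"
    by (simp_all add: conf_def)
  have G: "?G = locking_2_toggle [A1, B1, A2, B2]" by (simp add: antiparallel_locking_2_toggle_def)
  let ?D = "ext ` UNIV"
  have D: "?D = {(0, A1), (1, B2), (1, A1), (0, B2)}" by (simp add: toggle_loc_UNIV)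
  have nd_ext: "nd (ext l) = (case l of A1 \<Rightarrow> 1 | B1 \<Rightarrow> 2 | A2 \<Rightarrow> 3 | B2 \<Rightarrow> 4)" for l
    by (cases l) (simp_all add: nd_def)
  show ?thesis
    unfolding crossing_locking_2_toggle_def
  proof (rule toggle_simulation_by_nodes[where G = ?G and n = 2 and C = C and ext = ext and conf = conf
        and nd = nd])
    show "is_gadget ?G" by (rule toggle_gadgets)
    show "reversible ?G" by (simp add: G locking_2_toggle_reversible)
    show "distinct [A1, A2, B1, B2]" "set [A1, A2, B1, B2] = UNIV" by (auto simp: toggle_loc_UNIV)
    show "inj conf" by (auto simp: inj_def conf_def split: toggle_state.splits)
    show "length (conf q) = 2 \<and> set (conf q) \<subseteq> states ?G" for q by (cases q) (auto simp: G)
    let ?ls = "[A1, B1, A2, B2]"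
    have 0: "planar_disc ?ls {0} {} [(0, B2), (0, A1), (0, B1), (0, A2)]"
      using planar_disc_rotate_nth[OF planar_disc.gadget[of ?ls 0], of 3] by simp
    have 1: "planar_disc ?ls {1} {} [(1, A2), (1, B1), (1, A1), (1, B2)]"
      using planar_disc_rotate_nth[OF planar_disc.reverse[OF planar_disc.gadget[of ?ls 1]], of 1]
          by simp
    have "planar_disc ?ls ({0} \<union> {1}) ({} \<union> {}) ([(0, B2), (0, A1), (0, B1), (0, A2)] @ [(1, A2),
        (1, B1), (1, A1), (1, B2)])"
      by (rule planar_disc.union[OF 0 1]) simp
    \<comment> \<open>Two neighbours are linked and one of them is dropped, while the other stays on
      the boundary for the next link. Three links merge the four inner ends into one node.\<close>
    note d = planar_disc_drop_nth[OF planar_disc_connect_nth[OF this, of 3], of 4, simplified]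
    note d = planar_disc_drop_nth[OF planar_disc_connect_nth[OF d, of 3], of 4, simplified]
    note d = planar_disc_drop_nth[OF planar_disc_connect_nth[OF d, of 2], of 3, simplified]
    note d = planar_disc_drop_nth[OF d, of 2, simplified]
    have "planar_disc ?ls {0, 1} C [(0, A1), (1, A1), (1, B2), (0, B2)]"
      using planar_disc_rotate_nth[OF d, of 1] by (simp add: C_def insert_commute)
    moreover have "{0, 1} = {..<2 :: nat}" by auto
    ultimately show "planar_disc (locs ?G) {..<2} C (map ext [A1, A2, B1, B2])"
      by (simp add: G)
    show "walk (copies ?G 2 C) ?D (conf M, ext A1)
        [([S1, M], (0, B1)), ([S1, M], (0, A2)), ([S1, M], (1, A2))] (conf S1, ext B1)"
      "walk (copies ?G 2 C) ?D (conf M, ext A2)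
        [([M, S1], (1, B1)), ([M, S1], (0, A2))] (conf S2, ext B2)"
      by (simp_all add: robot_step_copies G D C_def doubleton_eq_iff)
    show "\<forall>e \<in> C. \<forall>x \<in> e. \<forall>y \<in> e. nd x = nd y" by (simp add: C_def nd_def)
    show "inj (nd \<circ> ext)" by (auto simp: inj_def nd_ext split: toggle_loc.splits)
    note [simp] = closed_nodes_def G nd_def numeral_2_eq_2 All_less_Suc
    show "closed_nodes ?G 2 nd {([M, M], 1), ([S1, M], 0), ([S1, S2], 2)}" by simp
    show "closed_nodes ?G 2 nd {([M, M], 3), ([M, S1], 0), ([S2, S1], 4)}" by simp
    show "closed_nodes ?G 2 nd {(conf q, nd (ext a))}"
      if "(q, a) \<notin> {(M, A1), (M, A2), (S1, B1), (S2, B2)}" for q a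
      using that by (cases q; cases a) simp_all
  qed (unfold nd_ext, auto split: toggle_loc.splits)
qed

text \<open>One of the two mirror-image halves of the system of seven parallel toggles. It contains
  the crossing of \<open>(i, A2)\<close>, \<open>(j, A1)\<close>, \<open>(k, B1)\<close>,
  \<open>(k, B2)\<close>, three ends \<open>(j, B1)\<close>, \<open>(j, B2)\<close>,
  \<open>(k, A2)\<close> of another crossing, whose fourth end is at the central toggle, and a plain
  wire from \<open>(i, A1)\<close> to \<open>(j, A2)\<close>.\<close>

definition branch_connections :: "nat \<Rightarrow> nat \<Rightarrow> nat \<Rightarrow> (nat \<times> toggle_loc) set set" where
  "branch_connections i j k = {{(i, A1), (j, A2)}, {(i, A2), (j, A1)}, {(j, B1), (j, B2)},
     {(j, A1), (k, B2)}, {(k, B2), (k, B1)}, {(k, A2), (j, B1)}}"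

lemma planar_disc_branch:
  assumes "i \<noteq> j" "i \<noteq> k" "j \<noteq> k"
  shows "planar_disc [A1, B1, B2, A2] {i, j, k} (branch_connections i j k)
    [(j, B1), (i, B1), (i, B2), (k, A1)]"
proof -
  let ?ls = "[A1, B1, B2, A2]"
  have i: "planar_disc ?ls {i} {} [(i, B1), (i, B2), (i, A2), (i, A1)]"
    using planar_disc_rotate_nth[OF planar_disc.gadget[of ?ls i], of 1] by simp
  have j: "planar_disc ?ls {j} {} [(j, A2), (j, A1), (j, B1), (j, B2)]"
    using planar_disc_rotate_nth[OF planar_disc.gadget[of ?ls j], of 3] by simp
  have k: "planar_disc ?ls {k} {} [(k, B2), (k, B1), (k, A1), (k, A2)]"
    using planar_disc_rotate_nth[OF planar_disc.reverse[OF planar_disc.gadget[of ?ls k]], of 1] by simp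
  have "{i} \<inter> {j} = {}" using assms by simp
  note d = planar_disc.union[OF i j this, simplified]
  note d = planar_disc_drop_nth[OF planar_disc_connect_nth[OF d, of 3], of 4, simplified]
  note d = planar_disc_drop_nth[OF d, of 3, simplified]
  note d = planar_disc_drop_nth[OF planar_disc_connect_nth[OF d, of 2], of 2, simplified]
  note d = planar_disc_drop_nth[OF planar_disc_connect_nth[OF d, of 3], of 4, simplified]
  note d = planar_disc_rotate_nth[OF d, of 3, simplified]
  have "{i, j} \<inter> {k} = {}" using assms by simp
  then have "{j, i} \<inter> {k} = {}" by auto
  note d = planar_disc.union[OF d k, simplified]
  have "planar_disc ?ls {i, j, k} {{(i, A1), (j, A2)}, {(i, A2), (j, A1)}, {(j, B1), (j, B2)}}
      [(j, B1), (i, B1), (i, B2), (j, A1), (k, B2), (k, B1), (k, A1), (k, A2)]"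
    using d assms by (simp add: insert_commute)
  note d = planar_disc_drop_nth[OF planar_disc_connect_nth[OF this, of 3], of 3, simplified]
  note d = planar_disc_drop_nth[OF planar_disc_connect_nth[OF d, of 3], of 4, simplified]
  note d = planar_disc_drop_nth[OF d, of 3, simplified]
  note d = planar_disc_drop_nth[OF planar_disc_connect_ends[OF d], of 4, simplified]
  show ?thesis using d by (simp add: branch_connections_def insert_commute)
qed

text \<open>The two routes cross five times, at the nodes 5 to 9. The first route visits these in
  ascending order, passing gadgets 2, 1, 6, 3, 4, 5, 3; the second one in descending order, passing
  5, 4, 6, 0, 1, 2, 0. Gadgets 0 and 3 are initially half way through, so that the last tunnel of a
  route opens only after its fourth one has been traversed; the other gadgets prevent the robot from
  changing to the other route.\<close>

lemma parallel_simulates_crossing: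
  "disc_simulates parallel_locking_2_toggle crossing_locking_2_toggle"
proof -
  let ?G = parallel_locking_2_toggle
  define C where "C = {{(0, B1), (3, B1)}, {(6, B1), (6, B2)}, {(0, B1), (6, B1)}, {(1, B1), (6, A1)},
    {(6, A2), (4, B1)}} \<union> branch_connections 0 1 2 \<union> branch_connections 3 4 5"
  define ext :: "toggle_loc \<Rightarrow> nat \<times> toggle_loc"
    where "ext l = (case l of A1 \<Rightarrow> (2, A1) | B1 \<Rightarrow> (3, B2) | A2 \<Rightarrow> (5, A1) | B2 \<Rightarrow> (0, B2))" for l
  define conf :: "toggle_state \<Rightarrow> toggle_state list" where
    "conf q = (case q of M \<Rightarrow> [S1, M, M, S1, M, M, M] | S1 \<Rightarrow> [S1, S1, S1, S2, S2, S2, S1]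
       | S2 \<Rightarrow> [S2, S2, S2, S1, S1, S1, S2])" for q
  \<comment> \<open>Nodes 1 to 4 are the terminals and 5 to 9 the crossings. Node 10 is the plain
    wire of the left half; the default value 11 is taken in this system only by the ends
    \<open>(3, A1)\<close> and \<open>(4, A2)\<close> of the wire of the right half.\<close>
  define nd :: "nat \<times> toggle_loc \<Rightarrow> nat" where "nd p =
    (if p = (2, A1) then 1 else if p = (3, B2) then 2 else if p = (5, A1) then 3 else if p = (0,
        B2) then 4
     else if p \<in> {(2, B1), (2, B2), (1, A1), (0, A2)} then 5
     else if p \<in> {(1, B1), (1, B2), (2, A2), (6, A1)} then 6
     else if p \<in> {(0, B1), (3, B1), (6, B1), (6, B2)} then 7
     else if p \<in> {(4, B1), (4, B2), (5, A2), (6, A2)} then 8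
     else if p \<in> {(5, B1), (5, B2), (4, A1), (3, A2)} then 9
     else if p \<in> {(0, A1), (1, A2)} then 10 else 11)" for p
  have ext [simp]: "ext A1 = (2, A1)" "ext B1 = (3, B2)" "ext A2 = (5, A1)" "ext B2 = (0, B2)"
    by (simp_all add: ext_def)
  have conf [simp]: "conf M = [S1, M, M, S1, M, M, M]" "conf S1 = [S1, S1, S1, S2, S2, S2, S1]"
    "conf S2 = [S2, S2, S2, S1, S1, S1, S2]"
    by (simp_all add: conf_def)
  have G: "?G = locking_2_toggle [A1, B1, B2, A2]" by (simp add: parallel_locking_2_toggle_def)
  let ?D = "ext ` UNIV"
  have D: "?D = {(2, A1), (3, B2), (5, A1), (0, B2)}" by (simp add: toggle_loc_UNIV)
  have nd_ext: "nd (ext l) = (case l of A1 \<Rightarrow> 1 | B1 \<Rightarrow> 2 | A2 \<Rightarrow> 3 | B2 \<Rightarrow> 4)" for l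
    by (cases l) (simp_all add: nd_def)
  have all: "(\<forall>i<7. Q i) \<longleftrightarrow> Q 0 \<and> Q 1 \<and> Q 2 \<and> Q 3 \<and> Q 4 \<and> Q 5 \<and> Q 6" for Q :: "nat \<Rightarrow> bool"
    by (simp add: numeral_eq_Suc All_less_Suc) blast
  show ?thesis
    unfolding crossing_locking_2_toggle_def
  proof (rule toggle_simulation_by_nodes[where G = ?G and n = 7 and C = C and ext = ext and conf = conf
        and nd = nd])
    show "is_gadget ?G" by (rule toggle_gadgets)
    show "reversible ?G" by (simp add: G locking_2_toggle_reversible)
    show "distinct [A1, A2, B1, B2]" "set [A1, A2, B1, B2] = UNIV" by (auto simp: toggle_loc_UNIV)
    show "inj conf" by (auto simp: inj_def conf_def split: toggle_state.splits)
    show "length (conf q) = 7 \<and> set (conf q) \<subseteq> states ?G" for q by (cases q) (auto simp: G)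
    let ?ls = "[A1, B1, B2, A2]"
    have left: "planar_disc ?ls {0, 1, 2} (branch_connections 0 1 2)
        [(0, B2), (2, A1), (1, B1), (0, B1)]"
      using planar_disc_rotate_nth[OF planar_disc_branch[of 0 1 2], of 2] by simp
    have right: "planar_disc ?ls {3, 4, 5} (branch_connections 3 4 5)
        [(3, B1), (4, B1), (5, A1), (3, B2)]"
      using planar_disc_rotate_nth[OF planar_disc.reverse[OF planar_disc_branch[of 3 4 5]], of 2]
          by simp
    have "planar_disc ?ls {6} {} [(6, B2), (6, B1), (6, A1), (6, A2)]"
      using planar_disc_rotate_nth[OF planar_disc.reverse[OF planar_disc.gadget[of ?ls 6]], of 1]
          by simp
    note centre = planar_disc_drop_nth[OF planar_disc_connect_nth[OF this, of 0], of 0, simplified]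
    note d = planar_disc.union[OF left right, simplified]
    note d = planar_disc_drop_nth[OF planar_disc_connect_nth[OF d, of 3], of 4, simplified]
    note d = planar_disc_rotate_nth[OF d, of 4, simplified]
    note d = planar_disc.union[OF d centre, simplified]
    note d = planar_disc_drop_nth[OF planar_disc_connect_nth[OF d, of 6], of 7, simplified]
    note d = planar_disc_drop_nth[OF d, of 6, simplified]
    note d = planar_disc_drop_nth[OF planar_disc_connect_nth[OF d, of 5], of 6, simplified]
    note d = planar_disc_drop_nth[OF d, of 5, simplified]
    note d = planar_disc_drop_nth[OF planar_disc_connect_ends[OF d], of 5, simplified]
    note d = planar_disc_drop_nth[OF d, of 0, simplified]
    note d = planar_disc_rotate_nth[OF d, of 3, simplified]
    moreover have "{..<7} = {0, 1, 2, 3, 4, 5, 6 :: nat}" by auto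
    moreover have "C = {{(6, A2), (4, B1)}, {(1, B1), (6, A1)}, {(0, B1), (6, B1)}, {(0, B1), (3,
        B1)}, {(6, B1), (6, B2)}} \<union> (branch_connections 0 1 2 \<union> branch_connections 3 4 5)"
        by (auto simp: C_def)
    ultimately show "planar_disc (locs ?G) {..<7} C (map ext [A1, A2, B1, B2])"
      by (simp add: G insert_commute)
    show "walk (copies ?G 7 C) ?D (conf M, ext A1)
        [([S1, M, S1, S1, M, M, M], (2, B1)), ([S1, M, S1, S1, M, M, M], (2, B2)),
         ([S1, M, S1, S1, M, M, M], (1, A1)), ([S1, S1, S1, S1, M, M, M], (1, B1)),
         ([S1, S1, S1, S1, M, M, M], (6, A1)), ([S1, S1, S1, S1, M, M, S1], (6, B1)),
         ([S1, S1, S1, S1, M, M, S1], (0, B1)), ([S1, S1, S1, S1, M, M, S1], (3, B1)),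
         ([S1, S1, S1, M, M, M, S1], (3, A1)), ([S1, S1, S1, M, M, M, S1], (4, A2)),
         ([S1, S1, S1, M, S2, M, S1], (4, B2)), ([S1, S1, S1, M, S2, M, S1], (4, B1)),
         ([S1, S1, S1, M, S2, M, S1], (5, A2)), ([S1, S1, S1, M, S2, S2, S1], (5, B2)),
         ([S1, S1, S1, M, S2, S2, S1], (4, A1)), ([S1, S1, S1, M, S2, S2, S1], (3, A2))]
        (conf S1, ext B1)"
      by (simp add: robot_step_copies G D C_def branch_connections_def doubleton_eq_iff)
    show "walk (copies ?G 7 C) ?D (conf M, ext A2)
        [([S1, M, M, S1, M, S1, M], (5, B1)), ([S1, M, M, S1, M, S1, M], (5, B2)),
         ([S1, M, M, S1, M, S1, M], (4, A1)), ([S1, M, M, S1, S1, S1, M], (4, B1)),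
         ([S1, M, M, S1, S1, S1, M], (6, A2)), ([S1, M, M, S1, S1, S1, S2], (6, B2)),
         ([S1, M, M, S1, S1, S1, S2], (6, B1)), ([S1, M, M, S1, S1, S1, S2], (0, B1)),
         ([M, M, M, S1, S1, S1, S2], (0, A1)), ([M, M, M, S1, S1, S1, S2], (1, A2)),
         ([M, S2, M, S1, S1, S1, S2], (1, B2)), ([M, S2, M, S1, S1, S1, S2], (1, B1)),
         ([M, S2, M, S1, S1, S1, S2], (2, A2)), ([M, S2, S2, S1, S1, S1, S2], (2, B2)),
         ([M, S2, S2, S1, S1, S1, S2], (1, A1)), ([M, S2, S2, S1, S1, S1, S2], (0, A2))]
        (conf S2, ext B2)"
      by (simp add: robot_step_copies G D C_def branch_connections_def doubleton_eq_iff)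
    show "\<forall>e \<in> C. \<forall>x \<in> e. \<forall>y \<in> e. nd x = nd y" by (simp add: C_def branch_connections_def nd_def)
    show "inj (nd \<circ> ext)" by (auto simp: inj_def nd_ext split: toggle_loc.splits)
    note [simp] = closed_nodes_def G nd_def all
    \<comment> \<open>The route admits a single detour: at node 7 gadget 0, half way through, can be
      passed back to node 10, but there gadget 1 is in \<open>S1\<close> and closed at
      \<open>A2\<close>. On the second route gadgets 3 and 4 and node 11 play these parts.\<close>
    show "closed_nodes ?G 7 nd {([S1, M, M, S1, M, M, M], 1), ([S1, M, S1, S1, M, M, M], 5),
        ([S1, S1, S1, S1, M, M, M], 6), ([S1, S1, S1, S1, M, M, S1], 7), ([M, S1, S1, S1, M, M, S1],
            10),
        ([S1, S1, S1, M, M, M, S1], 11),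
        ([S1, S1, S1, M, S2, M, S1], 8), ([S1, S1, S1, M, S2, S2, S1], 9), ([S1, S1, S1, S2, S2, S2,
            S1], 2)}"
      by simp
    show "closed_nodes ?G 7 nd {([S1, M, M, S1, M, M, M], 3), ([S1, M, M, S1, M, S1, M], 9),
        ([S1, M, M, S1, S1, S1, M], 8), ([S1, M, M, S1, S1, S1, S2], 7), ([S1, M, M, M, S1, S1, S2],
            11),
        ([M, M, M, S1, S1, S1, S2], 10),
        ([M, S2, M, S1, S1, S1, S2], 6), ([M, S2, S2, S1, S1, S1, S2], 5), ([S2, S2, S2, S1, S1, S1,
            S2], 4)}"
      by simp
    show "closed_nodes ?G 7 nd {(conf q, nd (ext a))}"
      if "(q, a) \<notin> {(M, A1), (M, A2), (S1, B1), (S2, B2)}" for q a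
      using that by (cases q; cases a) simp_all
  qed (unfold nd_ext, auto split: toggle_loc.splits)
qed

section \<open>Routes through a tunnel gadget\<close>

text \<open>A route is a list of hops \<open>(i, a, b)\<close>, each crossing gadget \<open>i\<close> from \<open>a\<close> to \<open>b\<close>.\<close>

type_synonym 'l hop = "nat \<times> 'l \<times> 'l"

abbreviation entry :: "'l hop \<Rightarrow> nat \<times> 'l" where "entry h \<equiv> (fst h, fst (snd h))"
abbreviation exit :: "'l hop \<Rightarrow> nat \<times> 'l" where "exit h \<equiv> (fst h, snd (snd h))"

fun links :: "'l hop list \<Rightarrow> (nat \<times> 'l) set set" where
  "links (h # h' # hs) = insert {exit h, entry h'} (links (h' # hs))"
| "links hs = {}"

lemma links_append:
  "us \<noteq> [] \<Longrightarrow> vs \<noteq> [] \<Longrightarrow> links (us @ vs) = insert {exit (last us), entry (hd vs)} (links us \<union> links vs)"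
proof (induction us rule: links.induct)
  case ("2_2" h)
  then show ?case by (cases vs) auto
qed auto

lemma links_nth: "e \<in> links hs \<longleftrightarrow> (\<exists>k. Suc k < length hs \<and> e = {exit (hs ! k), entry (hs ! Suc k)})"
proof (induction hs rule: links.induct)
  case (1 h h' hs)
  have "(\<exists>k. Suc k < length (h # h' # hs) \<and> e = {exit ((h # h' # hs) ! k),
      entry ((h # h' # hs) ! Suc k)})
      \<longleftrightarrow> e = {exit h, entry h'} \<or>
        (\<exists>k. Suc k < length (h' # hs) \<and> e = {exit ((h' # hs) ! k), entry ((h' # hs) ! Suc k)})"
    (is "(\<exists>k. ?Q k) \<longleftrightarrow> _ \<or> (\<exists>k. ?R k)")
  proof -
    have "(\<exists>k. ?Q k) \<longleftrightarrow> ?Q 0 \<or> (\<exists>k. ?Q (Suc k))" by (metis not0_implies_Suc)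
    then show ?thesis by simp
  qed
  then show ?case using 1 by simp
qed auto

definition opposite :: "'l hop list \<Rightarrow> 'l hop list" where
  "opposite hs = rev (map (\<lambda>(i, a, b). (i, b, a)) hs)"

lemma opposite_simps [simp]:
  "opposite [] = []" "opposite (us @ vs) = opposite vs @ opposite us"
  "opposite ((i, a, b) # hs) = opposite hs @ [(i, b, a)]"
  "opposite hs = [] \<longleftrightarrow> hs = []" "opposite (opposite hs) = hs"
  by (auto simp: opposite_def rev_map comp_def case_prod_beta)

lemma opposite_ends:
  "hs \<noteq> [] \<Longrightarrow> entry (hd (opposite hs)) = exit (last hs)"
  "hs \<noteq> [] \<Longrightarrow> exit (last (opposite hs)) = entry (hd hs)"
  by (auto simp: opposite_def hd_rev last_rev last_map hd_map case_prod_beta)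

lemma links_opposite: "links (opposite hs) = links hs"
proof (induction hs rule: links.induct)
  case (1 h h' hs)
  obtain i a b where h: "h = (i, a, b)" by (cases h)
  have "links (opposite (h # h' # hs)) = links (opposite (h' # hs) @ [(i, b, a)])" by (simp add: h)
  also have "\<dots> = insert {exit (last (opposite (h' # hs))), (i, b)} (links (opposite (h' # hs)))"
    by (subst links_append) auto
  also have "\<dots> = links (h # h' # hs)"
    using opposite_ends(2)[of "h' # hs"] 1 by (simp add: h insert_commute)
  finally show ?case .
next
  case ("2_2" h)
  then show ?case by (cases h) simp
qed simp

text \<open>Instantiated twice: for the given gadget, and for the crossing toggle, which obtains the
  other two types by the same lemmas.\<close>

locale tunnel_gadget =
  fixes G :: "('l, 's) gadget" and P :: "'l set set"
  assumes gadget: "is_gadget G" and reversible: "reversible G" and deterministic: "deterministic G"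
    and tunnels: "s \<in> states G \<Longrightarrow> (a, b, s') \<in> transitions G s \<Longrightarrow> {a, b} \<in> P"
    and disjoint: "T \<in> P \<Longrightarrow> T' \<in> P \<Longrightarrow> T \<noteq> T' \<Longrightarrow> T \<inter> T' = {}"
    and card_tunnel: "T \<in> P \<Longrightarrow> card T = 2"
begin

lemma transition_closed:
  "s \<in> states G \<Longrightarrow> (a, b, s') \<in> transitions G s \<Longrightarrow> s' \<in> states G \<and> a \<in> set (locs G) \<and> b \<in> set (locs G)"
  using gadget by (auto simp: is_gadget_def)

lemma transition_deterministic:
  "s \<in> states G \<Longrightarrow> (a, b, t) \<in> transitions G s \<Longrightarrow> (a, b', t') \<in> transitions G s \<Longrightarrow> b = b' \<and> t = t'"
  using deterministic unfolding deterministic_def transition_graph_def single_valued_def by blast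

lemma transition_reversible:
  assumes "s \<in> states G" "(a, b, t) \<in> transitions G s"
  shows "(b, a, s) \<in> transitions G t"
proof -
  have "((s, a), (t, b)) \<in> transition_graph G" using assms by (auto simp: transition_graph_def)
  then have "((t, b), (s, a)) \<in> transition_graph G"
    using reversible by (auto simp: reversible_def dest: symD)
  then show ?thesis by (auto simp: transition_graph_def)
qed

lemma tunnel_neq: "{a, b} \<in> P \<Longrightarrow> a \<noteq> b"
  using card_tunnel by force

lemma tunnel_exit:
  assumes "{a, b} \<in> P" "s \<in> states G" "(a, x, s') \<in> transitions G s"
  shows "x = b"
  using tunnels[OF assms(2,3)] assms(1) disjoint[of "{a, x}" "{a, b}"] tunnel_neq
  by (auto simp: doubleton_eq_iff)

primrec run :: "'s list \<Rightarrow> 'l hop list \<Rightarrow> 's list \<Rightarrow> bool" where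
  "run c [] c' \<longleftrightarrow> c' = c"
| "run c (h # hs) c' \<longleftrightarrow> (\<exists>s'. (fst (snd h), snd (snd h), s') \<in> transitions G (c ! fst h) \<and>
     run (c[fst h := s']) hs c')"

lemma run_append: "run c (us @ vs) c' \<longleftrightarrow> (\<exists>d. run c us d \<and> run d vs c')"
  by (induction us arbitrary: c) auto

definition config :: "nat \<Rightarrow> 's list \<Rightarrow> bool" where
  "config n c \<longleftrightarrow> length c = n \<and> set c \<subseteq> states G"

lemma config_nth: "config n c \<Longrightarrow> i < n \<Longrightarrow> c ! i \<in> states G"
  by (auto simp: config_def)

lemma config_update: "config n c \<Longrightarrow> s \<in> states G \<Longrightarrow> config n (c[i := s])"
  by (auto simp: config_def dest: set_update_subset_insert[THEN subsetD])

text \<open>Distinctness forbids branching: every location occurs in at most one hop and on one side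
  of it, so the position of the robot tells how many hops lie behind it. Several hops through the
  same copy are allowed if they use different tunnels.\<close>

definition route :: "nat \<Rightarrow> 'l hop list \<Rightarrow> bool" where
  "route n hs \<longleftrightarrow> hs \<noteq> [] \<and> (\<forall>(i, a, b) \<in> set hs. i < n \<and> {a, b} \<in> P) \<and>
     distinct (map entry hs @ map exit hs)"

lemma run_config: "run c hs c' \<Longrightarrow> config n c \<Longrightarrow> \<forall>h \<in> set hs. fst h < n \<Longrightarrow> config n c'"
  by (induction hs arbitrary: c) (auto dest: config_nth transition_closed intro: config_update)

lemma route_run_steps:
  assumes r: "route n hs" and c: "config n c" and C: "links hs \<subseteq> C"
    and run: "run c (take (Suc m) hs) d" and m: "m < length hs"
    and D: "\<And>k. Suc k < length hs \<Longrightarrow> exit (hs ! k) \<notin> D \<and> entry (hs ! Suc k) \<notin> D"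
  shows "\<exists>u. (avoiding_step (copies G n C) D)\<^sup>*\<^sup>* (c, entry (hs ! 0)) u \<and>
    robot_step (copies G n C) u (d, exit (hs ! m))"
  using run m
proof (induction m arbitrary: d)
  case 0
  obtain h hs' where hs: "hs = h # hs'" using r by (cases hs) (auto simp: route_def)
  obtain s' where s': "(fst (snd h), snd (snd h), s') \<in> transitions G (c ! fst h)" "d = c[fst h := s']"
    using 0 by (auto simp: hs)
  have "fst h < n" using r by (auto simp: route_def hs)
  then have "robot_step (copies G n C) (c, entry h) (d, exit h)"
    using s' robot_step.traverse[of "fst h" "copies G n C" "fst (snd h)" "snd (snd h)" s' c] by simp
  then show ?case by (auto simp: hs)
next
  case (Suc m)
  let ?S = "copies G n C" and ?h = "hs ! Suc m"
  have "take (Suc (Suc m)) hs = take (Suc m) hs @ [?h]" using Suc.prems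
      by (simp add: take_Suc_conv_app_nth)
  then obtain e where e: "run c (take (Suc m) hs) e" "run e [?h] d"
    using Suc.prems by (auto simp: run_append)
  obtain u where u: "(avoiding_step ?S D)\<^sup>*\<^sup>* (c, entry (hs ! 0)) u" "robot_step ?S u (e,
      exit (hs ! m))"
    using Suc.IH[OF e(1)] Suc.prems by auto
  have avoid: "exit (hs ! m) \<notin> D" "entry ?h \<notin> D" using D Suc.prems by auto
  have "avoiding_step ?S D u (e, exit (hs ! m))" using u(2) avoid(1) by simp
  note 1 = rtranclp.rtrancl_into_rtrancl[of "avoiding_step ?S D", OF u(1) this]
  have "{exit (hs ! m), entry ?h} \<in> C" using C Suc.prems links_nth[of _ hs] by blast
  then have "robot_step ?S (e, exit (hs ! m)) (e, entry ?h)" by (intro robot_step.connect) simp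
  then have "avoiding_step ?S D (e, exit (hs ! m)) (e, entry ?h)" using avoid(2) by simp
  note 2 = rtranclp.rtrancl_into_rtrancl[of "avoiding_step ?S D", OF 1 this]
  obtain s' where s': "(fst (snd ?h), snd (snd ?h), s') \<in> transitions G (e ! fst ?h)" "d =
      e[fst ?h := s']"
    using e(2) by auto
  have "?h \<in> set hs" using Suc.prems by auto
  then have "fst ?h < n" using r by (auto simp: route_def)
  then have "robot_step ?S (e, entry ?h) (d, exit ?h)"
    using s' robot_step.traverse[of "fst ?h" ?S "fst (snd ?h)" "snd (snd ?h)" s' e] by simp
  then show ?case using 2 by blast
qed

lemma route_passage:
  assumes "route n hs" "config n c" "links hs \<subseteq> C" "run c hs d"
    "\<And>k. Suc k < length hs \<Longrightarrow> exit (hs ! k) \<notin> D \<and> entry (hs ! Suc k) \<notin> D"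
  shows "passage (copies G n C) D (c, entry (hd hs)) (d, exit (last hs))"
proof -
  have "hs \<noteq> []" using assms(1) by (simp add: route_def)
  then show ?thesis
    using route_run_steps[of n hs c C "length hs - 1" d D] assms unfolding passage_def
    by (auto simp: hd_conv_nth last_conv_nth)
qed

lemma route_neq:
  assumes "route n hs" "k < length hs" "m < length hs"
  shows "entry (hs ! k) = entry (hs ! m) \<longleftrightarrow> k = m" "exit (hs ! k) = exit (hs ! m) \<longleftrightarrow> k = m"
    "entry (hs ! k) \<noteq> exit (hs ! m)"
proof -
  have d: "distinct (map entry hs)" "distinct (map exit hs)"
      "set (map entry hs) \<inter> set (map exit hs) = {}"
    using assms(1) unfolding route_def distinct_append by auto
  show "entry (hs ! k) = entry (hs ! m) \<longleftrightarrow> k = m" "exit (hs ! k) = exit (hs ! m) \<longleftrightarrow> k = m"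
    using nth_eq_iff_index_eq[OF d(1), of k m] nth_eq_iff_index_eq[OF d(2), of k m] assms by simp_all
  have mem: "entry (hs ! k) \<in> set (map entry hs)" "exit (hs ! m) \<in> set (map exit hs)"
    using assms by simp_all
  show "entry (hs ! k) \<noteq> exit (hs ! m)"
  proof
    assume "entry (hs ! k) = exit (hs ! m)"
    then have "entry (hs ! k) \<in> set (map entry hs) \<inter> set (map exit hs)"
      using mem by (simp only: Int_iff simp_thms)
    then show False unfolding d(3) by simp
  qed
qed

definition on_route :: "'s list \<Rightarrow> 'l hop list \<Rightarrow> 's list \<times> (nat \<times> 'l) \<Rightarrow> bool" where
  "on_route c hs u \<longleftrightarrow> (\<exists>m \<le> length hs. run c (take m hs) (fst u) \<and>
     (m < length hs \<and> snd u = entry (hs ! m) \<or> m > 0 \<and> snd u = exit (hs ! (m - 1))))"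

text \<open>The robot can only shuttle along the route: a tunnel leads to its other end alone, and
  going back through it restores the state before the hop, by reversibility and determinism. Hence
  the configuration depends only on the number \<open>m\<close> of hops behind the robot.\<close>

lemma on_route_step:
  assumes r: "route n hs" and c: "config n c" and u: "on_route c hs u"
    and st: "robot_step (copies G n C) u v"
    and C: "\<And>x y. {x, y} \<in> C \<Longrightarrow> x \<in> entry ` set hs \<union> exit ` set hs \<Longrightarrow> {x, y} \<in> links hs"
  shows "on_route c hs v"
proof -
  obtain d x e y where uv: "u = (d, x)" "v = (e, y)" by (cases u; cases v)
  obtain m where m: "m \<le> length hs" "run c (take m hs) d"
    "m < length hs \<and> x = entry (hs ! m) \<or> m > 0 \<and> x = exit (hs ! (m - 1))"
    using u by (auto simp: on_route_def uv)
  have hop: "fst (hs ! k) < n" "{fst (snd (hs ! k)), snd (snd (hs ! k))} \<in> P" if "k < length hs" for k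
  proof -
    have "hs ! k \<in> set hs" using that by simp
    then show "fst (hs ! k) < n" "{fst (snd (hs ! k)), snd (snd (hs ! k))} \<in> P"
      using r unfolding route_def by (auto simp: case_prod_beta)
  qed
  have cd: "config n e'" if "run c (take k hs) e'" for k e'
  proof (rule run_config[OF that c], rule ballI)
    fix h assume "h \<in> set (take k hs)"
    then have "h \<in> set hs" by (rule in_set_takeD)
    then show "fst h < n" using r unfolding route_def by auto
  qed
  have sub: "entry (hs ! k) \<in> entry ` set hs" "exit (hs ! k) \<in> exit ` set hs" if "k < length hs" for k
    using that by simp_all
  from st[unfolded uv] show ?thesis
  proof cases
    case connect
    have "x \<in> entry ` set hs \<union> exit ` set hs" using m(1,3) sub by auto
    then have "{x, y} \<in> links hs" using C connect by simp
    then obtain k where k: "Suc k < length hs" "{x, y} = {exit (hs ! k), entry (hs ! Suc k)}"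
      by (auto simp: links_nth)
    from m(3) show ?thesis
    proof
      assume *: "m < length hs \<and> x = entry (hs ! m)"
      then have "x = entry (hs ! Suc k) \<and> y = exit (hs ! k)"
        using k route_neq(3)[OF r, of m k] by (auto simp: doubleton_eq_iff)
      then have "m = Suc k" "y = exit (hs ! k)" using * k route_neq(1)[OF r, of m "Suc k"] by auto
      then show ?thesis using m connect unfolding on_route_def uv by (intro exI[of _ m]) auto
    next
      assume *: "m > 0 \<and> x = exit (hs ! (m - 1))"
      then have ml: "m - 1 < length hs" using m(1) by linarith
      have "x \<noteq> entry (hs ! Suc k)" using route_neq(3)[OF r k(1) ml] * by metis
      then have y: "x = exit (hs ! k)" "y = entry (hs ! Suc k)"
        using k(2) by (auto simp: doubleton_eq_iff)
      then have "m - 1 = k" using * k(1) route_neq(2)[OF r ml, of k] by simp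
      then have "m = Suc k" using * by linarith
      then show ?thesis using m k y connect unfolding on_route_def uv by (intro exI[of _ m]) auto
    qed
  next
    case (traverse i a b s')
    then have i: "i < n" "(a, b, s') \<in> transitions G (d ! i)" by auto
    have di: "d ! i \<in> states G" using cd[OF m(2)] i(1) config_nth by blast
    from m(3) show ?thesis
    proof
      assume *: "m < length hs \<and> x = entry (hs ! m)"
      then have h: "hs ! m = (i, a, snd (snd (hs ! m)))" using traverse by (auto simp: prod_eq_iff)
      then have "{a, snd (snd (hs ! m))} \<in> P" using hop(2)[of m] * by (metis fst_conv snd_conv)
      then have b: "b = snd (snd (hs ! m))" using tunnel_exit di i(2) by blast
      have "run c (take (Suc m) hs) e"
        using m(2) * i(2) h b traverse
            by (simp add: take_Suc_conv_app_nth run_append) (metis fst_conv snd_conv)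
      moreover have "y = exit (hs ! m)" using h b traverse by (metis fst_conv)
      ultimately show ?thesis
        using * unfolding on_route_def uv by (intro exI[of _ "Suc m"]) auto
    next
      assume *: "m > 0 \<and> x = exit (hs ! (m - 1))"
      define k where "k = m - 1"
      have k: "m = Suc k" "k < length hs" using * m(1) by (auto simp: k_def)
      have h: "hs ! k = (i, fst (snd (hs ! k)), a)" using traverse * by (auto simp: prod_eq_iff k_def)
      define a' where "a' = fst (snd (hs ! k))"
      have h': "hs ! k = (i, a', a)" using h a'_def by simp
      have "{a, a'} \<in> P" using hop(2)[OF k(2)] h' by (simp add: insert_commute)
      then have b: "b = a'" using tunnel_exit di i(2) by blast
      obtain d0 s0 where d0: "run c (take k hs) d0" "(a', a, s0) \<in> transitions G (d0 ! i)" "d =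
          d0[i := s0]"
        using m(2) k h' by (auto simp: take_Suc_conv_app_nth run_append)
      have c0: "d0 ! i \<in> states G" "length d0 = n" using cd[OF d0(1)] i(1) config_nth
          by (auto simp: config_def)
      have "(a, a', d0 ! i) \<in> transitions G s0" using transition_reversible c0(1) d0(2) by blast
      moreover have "d ! i = s0" using d0(3) c0 i(1) by simp
      ultimately have "s' = d0 ! i" using transition_deterministic[OF di] i(2) b by blast
      then have "e = d0" using traverse d0(3) by simp
      moreover have "y = entry (hs ! k)" using traverse b h' by simp
      ultimately show ?thesis
        using d0(1) k unfolding on_route_def uv by (intro exI[of _ k]) auto
    qed
  qed
qed

text \<open>All reachable points are on the route, by \<open>on_route_step\<close>. As
  \<open>y\<close> is no inner location, only the two ends remain, and at the first of them nothing
  has changed.\<close>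

lemma route_confined:
  assumes r: "route n hs" and c: "config n c"
    and C: "\<And>x y. {x, y} \<in> C \<Longrightarrow> x \<in> entry ` set hs \<union> exit ` set hs \<Longrightarrow> {x, y} \<in> links hs"
    and p: "passage (copies G n C) D (c, entry (hd hs)) (d, y)"
    and y: "y \<notin> exit ` set (butlast hs) \<union> entry ` set (tl hs)"
  shows "(d, y) = (c, entry (hd hs)) \<or> y = exit (last hs) \<and> run c hs d"
proof -
  have ne: "hs \<noteq> []" using r by (simp add: route_def)
  have start: "on_route c hs (c, entry (hd hs))"
    using ne unfolding on_route_def by (intro exI[of _ 0]) (simp add: hd_conv_nth)
  have steps: "on_route c hs u" if "(avoiding_step (copies G n C) D)\<^sup>*\<^sup>* (c, entry (hd hs)) u" for u
    using that by (induction rule: rtranclp_induct) (use start on_route_step[OF r c _ _ C] in blast)+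
  from p consider "(c, entry (hd hs)) = (d, y)"
    | u where "(avoiding_step (copies G n C) D)\<^sup>*\<^sup>* (c, entry (hd hs)) u"
      "robot_step (copies G n C) u (d, y)"
    unfolding passage_def by blast
  then have "on_route c hs (d, y)"
  proof cases
    case 1
    then show ?thesis using start by simp
  next
    case (2 u)
    from on_route_step[OF r c steps[OF 2(1)] 2(2) C] show ?thesis .
  qed
  then obtain m where m: "m \<le> length hs" "run c (take m hs) d"
    "m < length hs \<and> y = entry (hs ! m) \<or> m > 0 \<and> y = exit (hs ! (m - 1))"
    by (auto simp: on_route_def)
  from m(3) show ?thesis
  proof
    assume *: "m < length hs \<and> y = entry (hs ! m)"
    have "m = 0"
    proof (rule ccontr)
      assume "m \<noteq> 0"
      then have "hs ! m = tl hs ! (m - 1)" "m - 1 < length (tl hs)" using * by (auto simp: nth_tl)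
      then have "hs ! m \<in> set (tl hs)" by simp
      then show False using y * by blast
    qed
    then show ?thesis using m(2) * ne by (simp add: hd_conv_nth)
  next
    assume *: "m > 0 \<and> y = exit (hs ! (m - 1))"
    have "m = length hs"
    proof (rule ccontr)
      assume "m \<noteq> length hs"
      then have "hs ! (m - 1) = butlast hs ! (m - 1)" "m - 1 < length (butlast hs)"
        using m(1) * by (auto simp: nth_butlast)
      then have "hs ! (m - 1) \<in> set (butlast hs)" by simp
      then show False using y * by blast
    qed
    then show ?thesis using m(2) * ne by (simp add: last_conv_nth)
  qed
qed

lemma route_opposite: "route n hs \<Longrightarrow> route n (opposite hs)"
  unfolding route_def opposite_def
  by (auto simp: case_prod_beta insert_commute comp_def rev_map[symmetric] image_image)

lemma opposite_locs:
  "entry ` set (opposite hs) = exit ` set hs" "exit ` set (opposite hs) = entry ` set hs"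
  by (auto simp: opposite_def image_image case_prod_beta)

text \<open>The routes may share gadgets but no locations, so one influences the other only through
  the states. The lemma is applied four times, with either route or its opposite in the role of
  \<open>A\<close>.\<close>

lemma two_routes:
  assumes A: "route n A" and B: "route n B"
    and disj: "(entry ` set A \<union> exit ` set A) \<inter> (entry ` set B \<union> exit ` set B) = {}"
    and C: "C = links A \<union> links B"
    and D: "D = {entry (hd A), exit (last A), entry (hd B), exit (last B)}"
    and c: "config n c"
  shows "run c A d \<Longrightarrow> passage (copies G n C) D (c, entry (hd A)) (d, exit (last A))"
    and "passage (copies G n C) D (c, entry (hd A)) (d, y) \<Longrightarrow> y \<in> D \<Longrightarrow>
      (d, y) = (c, entry (hd A)) \<or> y = exit (last A) \<and> run c A d"
proof -
  have ne: "A \<noteq> []" "B \<noteq> []" using A B by (auto simp: route_def)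
  have hd_last: "hd A = A ! 0" "last A = A ! (length A - 1)" using ne
      by (simp_all add: hd_conv_nth last_conv_nth)
  have B_ends: "entry (hd B) \<in> entry ` set B" "exit (last B) \<in> exit ` set B" using ne by simp_all
  have sep: "p \<noteq> q" if "p \<in> entry ` set A \<union> exit ` set A" "q \<in> entry ` set B \<union> exit ` set B" for p q
  proof
    assume "p = q"
    then have "p \<in> (entry ` set A \<union> exit ` set A) \<inter> (entry ` set B \<union> exit ` set B)"
      using that by (simp only: Int_iff simp_thms)
    then show False unfolding disj by simp
  qed
  have notB: "entry h \<noteq> entry (hd B)" "entry h \<noteq> exit (last B)" "exit h \<noteq> entry (hd B)"
      "exit h \<noteq> exit (last B)"
    if "h \<in> set A" for h
    using that B_ends by (intro sep; simp)+
  have inner: "exit (A ! k) \<notin> D \<and> entry (A ! Suc k) \<notin> D" if k: "Suc k < length A" for k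
  proof -
    have in_A: "A ! k \<in> set A" "A ! Suc k \<in> set A" using k by simp_all
    have l: "0 < length A" "k < length A" "length A - 1 < length A" "(k = length A - 1) = False"
      using k by auto
    have "exit (A ! k) \<noteq> entry (hd A)"
      using route_neq(3)[OF A l(1) l(2)] unfolding hd_last(1) by (rule not_sym)
    moreover have "entry (A ! Suc k) \<noteq> exit (last A)"
      unfolding hd_last(2) by (rule route_neq(3)[OF A k l(3)])
    moreover have "exit (A ! k) \<noteq> exit (last A)"
      unfolding hd_last(2) route_neq(2)[OF A l(2) l(3)] l(4) by simp
    moreover have "entry (A ! Suc k) \<noteq> entry (hd A)"
      unfolding hd_last(1) route_neq(1)[OF A k l(1)] by simp
    ultimately show ?thesis
      unfolding D using notB[OF in_A(1)] notB[OF in_A(2)] by (simp only: insert_iff empty_iff simp_thms)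
  qed
  show "passage (copies G n C) D (c, entry (hd A)) (d, exit (last A))" if "run c A d"
    using A c that inner by (intro route_passage) (auto simp: C)
  have link: "{x, y} \<in> links A" if "{x, y} \<in> C" "x \<in> entry ` set A \<union> exit ` set A" for x y
  proof (rule ccontr)
    assume "{x, y} \<notin> links A"
    then have "{x, y} \<in> links B" using that(1) C by simp
    then obtain k where k: "Suc k < length B" "{x, y} = {exit (B ! k), entry (B ! Suc k)}"
      by (auto simp: links_nth)
    have "exit (B ! k) \<in> exit ` set B" "entry (B ! Suc k) \<in> entry ` set B" using k(1) by simp_all
    moreover have "x \<in> {exit (B ! k), entry (B ! Suc k)}" unfolding k(2)[symmetric] by simp
    ultimately have "x \<in> entry ` set B \<union> exit ` set B" by auto
    then show False using that(2) disj by blast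
  qed
  show "(d, y) = (c, entry (hd A)) \<or> y = exit (last A) \<and> run c A d"
    if "passage (copies G n C) D (c, entry (hd A)) (d, y)" "y \<in> D"
  proof (rule route_confined[OF A c link that(1)])
    show "y \<notin> exit ` set (butlast A) \<union> entry ` set (tl A)"
    proof
      assume "y \<in> exit ` set (butlast A) \<union> entry ` set (tl A)"
      then consider h where "h \<in> set (butlast A)" "y = exit h" | h where "h \<in> set (tl A)" "y = entry h"
        by blast
      then show False
      proof cases
        case 1
        then obtain k where k: "k < length (butlast A)" "butlast A ! k = h" by (meson in_set_conv_nth)
        then have "Suc k < length A" "A ! k = h" using nth_butlast[OF k(1)] by auto
        then show False using inner[of k] 1(2) that(2) by simp
      next
        case 2
        then obtain k where k: "k < length (tl A)" "tl A ! k = h" by (meson in_set_conv_nth)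
        then have "Suc k < length A" "A ! Suc k = h" using nth_tl[OF k(1)] by auto
        then show False using inner[of k] 2(2) that(2) by simp
      qed
    qed
  qed
qed

section \<open>Words, that is, sequences of crossings within one copy\<close>

definition word_at :: "nat \<Rightarrow> ('l \<times> 'l) list \<Rightarrow> 'l hop list" where
  "word_at i w = map (\<lambda>(a, b). (i, a, b)) w"

definition reverse_word :: "('l \<times> 'l) list \<Rightarrow> ('l \<times> 'l) list" where
  "reverse_word w = rev (map prod.swap w)"

lemma opposite_at: "opposite (word_at i w) = word_at i (reverse_word w)"
  by (auto simp: opposite_def word_at_def reverse_word_def rev_map)

lemma reverse_word_twice [simp]: "reverse_word (reverse_word w) = w"
  by (simp add: reverse_word_def rev_map)

lemma reverse_word_Nil [simp]: "reverse_word w = [] \<longleftrightarrow> w = []"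
  by (simp add: reverse_word_def)

lemma at_ends:
  assumes "w \<noteq> []"
  shows "word_at i w \<noteq> []" "entry (hd (word_at i w)) = (i, fst (hd w))" "exit (last (word_at i w)) =
      (i, snd (last w))"
    "fst (hd (reverse_word w)) = snd (last w)" "snd (last (reverse_word w)) = fst (hd w)"
  using assms by (auto simp: word_at_def reverse_word_def hd_map last_map hd_rev last_rev case_prod_beta)

primrec word_run :: "'s \<Rightarrow> ('l \<times> 'l) list \<Rightarrow> 's \<Rightarrow> bool" where
  "word_run s [] t \<longleftrightarrow> t = s"
| "word_run s (h # w) t \<longleftrightarrow> (\<exists>s'. (fst h, snd h, s') \<in> transitions G s \<and> word_run s' w t)"

lemma word_run_append: "word_run s (v @ w) t \<longleftrightarrow> (\<exists>u. word_run s v u \<and> word_run u w t)"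
  by (induction v arbitrary: s) auto

lemma word_run_closed: "word_run s w t \<Longrightarrow> s \<in> states G \<Longrightarrow> t \<in> states G"
  by (induction w arbitrary: s) (auto dest: transition_closed)

lemma word_run_deterministic: "word_run s w t \<Longrightarrow> word_run s w t' \<Longrightarrow> s \<in> states G \<Longrightarrow> t = t'"
proof (induction w arbitrary: s)
  case (Cons h w)
  then obtain u u' where u: "(fst h, snd h, u) \<in> transitions G s" "word_run u w t"
    "(fst h, snd h, u') \<in> transitions G s" "word_run u' w t'" by auto
  then have "u = u'" "u \<in> states G" using transition_deterministic transition_closed Cons.prems
      by blast+
  then show ?case using Cons.IH u by blast
qed simp

lemma word_run_reverse: "word_run s w t \<Longrightarrow> s \<in> states G \<Longrightarrow> word_run t (reverse_word w) s"
proof (induction w arbitrary: s)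
  case Nil
  then show ?case by (simp add: reverse_word_def)
next
  case (Cons h w)
  then obtain u where u: "(fst h, snd h, u) \<in> transitions G s" "word_run u w t" by auto
  then have "word_run t (reverse_word w) u" using Cons transition_closed by blast
  moreover have "(snd h, fst h, s) \<in> transitions G u" using u Cons.prems transition_reversible by blast
  moreover have "reverse_word (h # w) = reverse_word w @ [(snd h, fst h)]"
    by (simp add: reverse_word_def prod.swap_def)
  ultimately show ?case by (auto simp: word_run_append)
qed

lemma run_at: "i < length c \<Longrightarrow> run c (word_at i w) c' \<longleftrightarrow> (\<exists>t. word_run (c ! i) w t \<and> c' = c[i := t])"
proof (induction w arbitrary: c)
  case Nil
  then show ?case by (auto simp: word_at_def)
next
  case (Cons h w)
  have "run c (word_at i (h # w)) c' \<longleftrightarrow>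
      (\<exists>s'. (fst h, snd h, s') \<in> transitions G (c ! i) \<and> run (c[i := s']) (word_at i w) c')"
    by (simp add: word_at_def case_prod_beta)
  also have "\<dots> \<longleftrightarrow> (\<exists>t. word_run (c ! i) (h # w) t \<and> c' = c[i := t])"
    using Cons by auto
  finally show ?case .
qed

lemma run_word_append:
  "i < length c \<Longrightarrow> run c (word_at i w @ hs) c' \<longleftrightarrow> (\<exists>t. word_run (c ! i) w t \<and> run (c[i := t]) hs c')"
  by (auto simp: run_append run_at)

lemma route_word:
  assumes "w \<noteq> []" "\<And>p q. (p, q) \<in> set w \<Longrightarrow> {p, q} \<in> P" "distinct (map fst w @ map snd w)" "i < n"
  shows "route n (word_at i w)"
proof -
  have "map entry (word_at i w) = map (Pair i) (map fst w)" "map exit (word_at i w) =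
      map (Pair i) (map snd w)"
    by (simp_all add: word_at_def case_prod_beta)
  then have "map entry (word_at i w) @ map exit (word_at i w) = map (Pair i) (map fst w @ map snd w)"
    by simp
  moreover have "distinct (map (Pair i) (map fst w @ map snd w))"
    unfolding distinct_map using assms(3) by (simp add: inj_on_def)
  ultimately have d: "distinct (map entry (word_at i w) @ map exit (word_at i w))" by (simp only:)
  show ?thesis
    unfolding route_def using assms(1,2,4) by (intro conjI d) (auto simp: word_at_def)
qed

lemma route_append:
  assumes "route n us" "route n vs"
    "(entry ` set us \<union> exit ` set us) \<inter> (entry ` set vs \<union> exit ` set vs) = {}"
  shows "route n (us @ vs)"
proof -
  let ?us = "map entry us @ map exit us" and ?vs = "map entry vs @ map exit vs"
  have d: "distinct ?us" "distinct ?vs" using assms(1,2) by (simp_all only: route_def)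
  have "set ?us \<inter> set ?vs = {}" using assms(3) by (simp only: set_append set_map)
  with d have d: "distinct (?us @ ?vs)" unfolding distinct_append[of ?us ?vs] by (intro conjI)
  have "mset (map entry (us @ vs) @ map exit (us @ vs)) = mset (?us @ ?vs)" by simp
  from mset_eq_imp_distinct_iff[OF this] d
  have "distinct (map entry (us @ vs) @ map exit (us @ vs))" by (rule iffD2)
  moreover have "us @ vs \<noteq> []" using assms(1) by (simp add: route_def)
  moreover have "\<forall>(i, a, b) \<in> set (us @ vs). i < n \<and> {a, b} \<in> P"
    using assms(1,2) unfolding route_def set_append by blast
  ultimately show ?thesis unfolding route_def by (intro conjI)
qed

lemma word_at_locs: "entry ` set (word_at i w) \<subseteq> {i} \<times> UNIV" "exit ` set (word_at i w) \<subseteq> {i} \<times> UNIV"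
  by (auto simp: word_at_def)

text \<open>A word that can be run once but not twice makes a tunnel one-way: put in series with its
  reverse on another copy, it also blocks the way back until it has been run.\<close>

lemma planar_disc_one_way:
  assumes w: "w \<noteq> []" "\<And>i. planar_disc ls {i} (links (word_at i w)) [(i, fst (hd w)), (i,
      snd (last w))]"
    and "i \<noteq> j"
  shows "planar_disc ls {i, j} (links (word_at i w @ word_at j (reverse_word w))) [(i, fst (hd w)),
      (j, fst (hd w))]"
proof -
  have "links (word_at j (reverse_word w)) = links (word_at j w)"
    using links_opposite[of "word_at j w"] by (simp add: opposite_at)
  then have eq: "links (word_at i w @ word_at j (reverse_word w)) =
      insert {(i, snd (last w)), (j, snd (last w))} (links (word_at i w) \<union> links (word_at j w))"
    using w(1) at_ends(1-3)[of "reverse_word w"] at_ends[OF w(1)] by (simp add: links_append)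
  \<comment> \<open>The second copy is reflected, which brings its location
    \<open>snd (last w)\<close> next to that of the first.\<close>
  have "planar_disc ls ({i} \<union> {j}) (links (word_at i w) \<union> links (word_at j w))
      ([(i, fst (hd w)), (i, snd (last w))] @ rev [(j, fst (hd w)), (j, snd (last w))])"
    using w(2) planar_disc.reverse[OF w(2)[of j]] assms(3) by (intro planar_disc.union) auto
  from planar_disc_connect_nth[OF this, of 1]
  have "planar_disc ls {i, j} (links (word_at i w @ word_at j (reverse_word w)))
      [(i, fst (hd w)), (i, snd (last w)), (j, snd (last w)), (j, fst (hd w))]"
    by (simp add: eq insert_commute)
  from planar_disc_drop_nth[OF planar_disc_drop_nth[OF this, of 1], of 1] show ?thesis by simp
qed

text \<open>Copies 0 and 1 make the routes exclude each other, copies 2 and 3 make \<open>A\<close>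
  one-way, and copies 4 and 5 do so for \<open>B\<close>. The order in which \<open>B0\<close> meets
  copies 0 and 1 does not affect the blocking; it is left open because the arrangement of the
  tunnels decides which order can be drawn.\<close>

lemma six_copies_simulate_toggle:
  assumes T: "{a, b} \<in> P" "{c, d} \<in> P" "{a, b} \<noteq> {c, d}"
    and s: "s0 \<in> states G" "(a, b, s1) \<in> transitions G s0" "(c, d, s2) \<in> transitions G s0"
      "\<And>t. (c, d, t) \<notin> transitions G s1"
    and w: "w \<noteq> []" "\<And>p q. (p, q) \<in> set w \<Longrightarrow> {p, q} \<in> P" "distinct (map fst w @ map snd w)"
    and x: "x \<in> states G" "word_run x w x'" "\<And>t. \<not> word_run x' w t"
    and w_disc: "\<And>i. planar_disc (locs G) {i} (links (word_at i w)) [(i, fst (hd w)), (i,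
        snd (last w))]"
    and B0: "B0 = [(0, c, d), (1, a, b)] \<or> B0 = [(1, a, b), (0, c, d)]"
    and cyc: "distinct cyc" "set cyc = UNIV"
    and core: "planar_disc (locs G) {0, 1} (links [(0, a, b), (1, c, d)] \<union> links B0)
        (map (case_toggle_loc (0, a) (1, d) (entry (hd B0)) (exit (last B0))) cyc)"
  shows "disc_simulates G (locking_2_toggle cyc)"
proof -
  define A where "A = word_at 2 w @ word_at 3 (reverse_word w) @ [(0, a, b), (1, c, d)]"
  define B where "B = word_at 4 w @ word_at 5 (reverse_word w) @ B0"
  define C where "C = links A \<union> links B"
  define ext where "ext = (case_toggle_loc (0, a) (1, d) (entry (hd B0)) (exit (last B0)))
      (A1 := (2, fst (hd w)), A2 := (4, fst (hd w)))"
  \<comment> \<open>In \<open>M\<close> the ways back are barred by copies 3 and 5, where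
    \<open>w\<close> cannot be run from \<open>x'\<close>. After route \<open>A\<close>, copy 0 in
    \<open>s1\<close> bars \<open>B\<close>, copy 2 in \<open>x'\<close> bars a second run of
    \<open>A\<close>, and copy 5 still bars the way back of \<open>B\<close>. After route
    \<open>B\<close>, copies 1, 4 and 3 have these tasks.\<close>
  define conf where "conf q = (case q of M \<Rightarrow> [s0, s0, x, x', x, x'] | S1 \<Rightarrow> [s1, s2, x', x, x, x']
      | S2 \<Rightarrow> [s2, s1, x, x', x', x])" for q
  note ends = at_ends[OF w(1)] at_ends(1-3)[of "reverse_word w", simplified, OF w(1)]
  have B0_ne: "B0 \<noteq> []" using B0 by auto
  have abcd: "distinct [a, b, c, d]"
    using T tunnel_neq[OF T(1)] tunnel_neq[OF T(2)] disjoint[OF T] by auto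
  have ends_A: "entry (hd A) = ext A1" "exit (last A) = ext B1"
    and ends_B: "entry (hd B) = ext A2" "exit (last B) = ext B2"
    using ends B0_ne by (simp_all add: A_def B_def ext_def)
  have D: "ext ` UNIV = {entry (hd A), exit (last A), entry (hd B), exit (last B)}"
    unfolding ends_A ends_B by (auto simp: toggle_loc_UNIV)
  have disc: "planar_disc (locs G) {..<6} C (map ext cyc)"
  proof -
    have "planar_disc (locs G) ({2, 3} \<union> {0, 1})
        (insert {(3, fst (hd w)), (0, a)} (links (word_at 2 w @ word_at 3 (reverse_word w)) \<union>
          (links [(0, a, b), (1, c, d)] \<union> links B0)))
        (map ((case_toggle_loc (0, a) (1, d) (entry (hd B0)) (exit (last B0)))(A1 := (2,
            fst (hd w)))) cyc)"
      using planar_disc_attach[OF core planar_disc_one_way[OF w(1) w_disc, of 2 3], of A1] cyc by simp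
    from planar_disc_attach[OF this planar_disc_one_way[OF w(1) w_disc, of 4 5], of A2]
    have "planar_disc (locs G) ({4, 5} \<union> ({2, 3} \<union> {0, 1}))
        (insert {(5, fst (hd w)), entry (hd B0)} (links (word_at 4 w @ word_at 5 (reverse_word w)) \<union>
          (insert {(3, fst (hd w)), (0, a)} (links (word_at 2 w @ word_at 3 (reverse_word w)) \<union>
          (links [(0, a, b), (1, c, d)] \<union> links B0))))) (map ext cyc)"
      using cyc by (simp add: ext_def)
    moreover have "{4, 5} \<union> ({2, 3} \<union> {0, 1}) = {..<6 :: nat}" by auto
    moreover have "links A = insert {(3, fst (hd w)), (0, a)}
        (links (word_at 2 w @ word_at 3 (reverse_word w)) \<union> links [(0, a, b), (1, c, d)])"
      using ends unfolding A_def append_assoc[symmetric] by (subst links_append) auto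
    moreover have "links B = insert {(5, fst (hd w)), entry (hd B0)}
        (links (word_at 4 w @ word_at 5 (reverse_word w)) \<union> links B0)"
      using ends B0_ne unfolding B_def append_assoc[symmetric] by (subst links_append) auto
    ultimately show ?thesis by (simp add: C_def Un_ac)
  qed
  have rw: "route 6 (word_at i w)" "route 6 (word_at i (reverse_word w))" if "i < 6" for i
    using route_word[OF w that] route_opposite[of 6 "word_at i w"] by (simp_all add: opposite_at)
  have r0: "route 6 [(0, a, b), (1, c, d)]" "route 6 B0"
    using T B0 abcd by (auto simp: route_def)
  have B0_locs: "entry ` set B0 = {(0, c), (1, a)}" "exit ` set B0 = {(0, d), (1, b)}"
    using B0 by auto
  let ?L = "\<lambda>hs. entry ` set hs \<union> exit ` set hs"
  let ?A0 = "[(0, a, b), (1, c, d)]"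
  have sep: "X \<inter> Y = {}" if "X \<subseteq> I \<times> UNIV" "Y \<subseteq> J \<times> UNIV" "I \<inter> J = {}"
    for X Y :: "(nat \<times> 'l) set" and I J using that by blast
  have L_word: "?L (word_at i v) \<subseteq> {i} \<times> UNIV" for i v using word_at_locs by simp
  have L_0: "?L ?A0 \<subseteq> {0, 1} \<times> UNIV" "?L B0 \<subseteq> {0, 1} \<times> UNIV" unfolding B0_locs by auto
  have L_append: "?L (us @ vs) = ?L us \<union> ?L vs" for us vs :: "'l hop list"
    unfolding set_append image_Un by blast
  have L_word_0: "?L (word_at i v @ hs) \<subseteq> {i, 0, 1} \<times> UNIV" if "?L hs \<subseteq> {0, 1} \<times> UNIV" for i v hs
    unfolding L_append using L_word[of i v] that by blast
  have rA: "route 6 A"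
    unfolding A_def
    by (intro route_append rw r0 sep[OF L_word L_0(1)] sep[OF L_word L_word_0[OF L_0(1)]]) simp_all
  have rB: "route 6 B"
    unfolding B_def
    by (intro route_append rw r0 sep[OF L_word L_0(2)] sep[OF L_word L_word_0[OF L_0(2)]]) simp_all
  have disj: "?L A \<inter> ?L B = {}"
  proof -
    have "?L (word_at i v) \<inter> ?L (word_at j v') = {}" if "i \<noteq> j" for i j v v'
      using that by (intro sep[OF L_word L_word]) simp
    moreover have "?L (word_at i v) \<inter> ?L B0 = {}" "?L ?A0 \<inter> ?L (word_at i v) = {}" if "i > 1" for i v
      using that by (intro sep[OF L_word L_0(2)] sep[OF L_0(1) L_word]; simp)+
    moreover have "?L ?A0 \<inter> ?L B0 = {}" unfolding B0_locs using abcd by auto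
    ultimately show ?thesis
      unfolding A_def B_def L_append Int_Un_distrib Int_Un_distrib2 by simp
  qed
  have st: "s1 \<in> states G" "s2 \<in> states G" "x' \<in> states G"
    using transition_closed[OF s(1,2)] transition_closed[OF s(1,3)] word_run_closed x by auto
  have config: "config 6 (conf q)" for q using s(1) x(1) st
      by (cases q) (auto simp: config_def conf_def)
  have run_A: "run [u0, u1, u2, u3, u4, u5] A c' \<longleftrightarrow> (\<exists>t0 t1 t2 t3. word_run u2 w t2 \<and>
      word_run u3 (reverse_word w) t3 \<and> (a, b, t0) \<in> transitions G u0 \<and> (c, d, t1) \<in> transitions G u1 \<and>
      c' = [t0, t1, t2, t3, u4, u5])" for u0 u1 u2 u3 u4 u5 c'
    by (auto simp: A_def run_word_append run_at eval_nat_numeral)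
  have run_B: "run [u0, u1, u2, u3, u4, u5] B c' \<longleftrightarrow> (\<exists>t0 t1 t4 t5. word_run u4 w t4 \<and>
      word_run u5 (reverse_word w) t5 \<and> (c, d, t0) \<in> transitions G u0 \<and> (a, b, t1) \<in> transitions G u1 \<and>
      c' = [t0, t1, u2, u3, t4, t5])" for u0 u1 u2 u3 u4 u5 c'
    using B0 by (auto simp: B_def run_word_append run_at eval_nat_numeral)
  have run_oA: "run [u0, u1, u2, u3, u4, u5] (opposite A) c' \<longleftrightarrow> (\<exists>t0 t1 t2 t3.
      word_run u2 (reverse_word w) t2 \<and> word_run u3 w t3 \<and> (b, a, t0) \<in> transitions G u0 \<and>
      (d, c, t1) \<in> transitions G u1 \<and> c' = [t0, t1, t2, t3, u4, u5])" for u0 u1 u2 u3 u4 u5 c'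
    by (auto simp: A_def opposite_at run_word_append run_at eval_nat_numeral)
  have run_oB: "run [u0, u1, u2, u3, u4, u5] (opposite B) c' \<longleftrightarrow> (\<exists>t0 t1 t4 t5.
      word_run u4 (reverse_word w) t4 \<and> word_run u5 w t5 \<and> (d, c, t0) \<in> transitions G u0 \<and>
      (b, a, t1) \<in> transitions G u1 \<and> c' = [t0, t1, u2, u3, t4, t5])" for u0 u1 u2 u3 u4 u5 c'
    using B0 by (auto simp: B_def opposite_at run_word_append run_at eval_nat_numeral)
  have x_iff: "word_run x w t \<longleftrightarrow> t = x'" "word_run x' (reverse_word w) t \<longleftrightarrow> t = x" for t
    using x word_run_deterministic word_run_reverse st(3) by blast+
  have det: "(p, q, t) \<in> transitions G u \<longleftrightarrow> t = v" if "u \<in> states G" "(p, q, v) \<in> transitions G u"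
    for p q t u v
  proof
    assume "(p, q, t) \<in> transitions G u"
    from transition_deterministic[OF that(1) this that(2)] show "t = v" ..
  qed (simp add: that(2))
  note s_iff = det[OF s(1,2)] det[OF s(1,3)]
    det[OF st(1) transition_reversible[OF s(1,2)]] det[OF st(2) transition_reversible[OF s(1,3)]]
  note facts = run_A run_B run_oA run_oB x_iff s_iff x(3) s(4) conf_def
  have runs: "run (conf M) A c' \<longleftrightarrow> c' = conf S1" "run (conf M) B c' \<longleftrightarrow> c' = conf S2"
    "run (conf S1) (opposite A) c' \<longleftrightarrow> c' = conf M" "run (conf S2) (opposite B) c' \<longleftrightarrow> c' = conf M"
    "\<not> run (conf M) (opposite A) c'" "\<not> run (conf M) (opposite B) c'"
    "\<not> run (conf S1) A c'" "\<not> run (conf S1) B c'" "\<not> run (conf S1) (opposite B) c'"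
    "\<not> run (conf S2) A c'" "\<not> run (conf S2) B c'" "\<not> run (conf S2) (opposite A) c'" for c'
    by (auto simp: facts)
  have C': "C = links B \<union> links A" "C = links (opposite A) \<union> links B" "C = links (opposite B) \<union> links A"
    by (auto simp: C_def links_opposite)
  have ne: "A \<noteq> []" "B \<noteq> []" using rA rB by (auto simp: route_def)
  note op = opposite_ends[OF ne(1)] opposite_ends[OF ne(2)]
  have D': "ext ` UNIV = {entry (hd B), exit (last B), entry (hd A), exit (last A)}"
    "ext ` UNIV = {entry (hd (opposite A)), exit (last (opposite A)), entry (hd B), exit (last B)}"
    "ext ` UNIV = {entry (hd (opposite B)), exit (last (opposite B)), entry (hd A), exit (last A)}"
    unfolding op D by auto
  have disj': "(entry ` set B \<union> exit ` set B) \<inter> (entry ` set A \<union> exit ` set A) = {}"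
    "(entry ` set (opposite A) \<union> exit ` set (opposite A)) \<inter> (entry ` set B \<union> exit ` set B) = {}"
    "(entry ` set (opposite B) \<union> exit ` set (opposite B)) \<inter> (entry ` set A \<union> exit ` set A) = {}"
    using disj unfolding opposite_locs by (simp_all add: Un_commute Int_commute)
  note routes_A = two_routes[OF rA rB disj C_def D config]
  note routes_B = two_routes[OF rB rA disj'(1) C'(1) D'(1) config]
  note routes_oA = two_routes[OF route_opposite[OF rA] rB disj'(2) C'(2) D'(2) config]
  note routes_oB = two_routes[OF route_opposite[OF rB] rA disj'(3) C'(3) D'(3) config]
  have "distinct (map ext cyc)"
    using planar_disc_wf[OF disc] gadget by (simp add: is_gadget_def)
  then have inj_ext: "ext l = ext l' \<longleftrightarrow> l = l'" for l l'
    using cyc by (auto simp: distinct_map inj_on_def)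
  have confine: "(c', l) = (conf q, A1) \<or> l = B1 \<and> run (conf q) A c'"
    if "passage (copies G 6 C) (ext ` UNIV) (conf q, ext A1) (c', ext l)" for q c' l
    using routes_A(2)[of q c' "ext l"] that by (simp add: ends_A inj_ext)
  moreover have "(c', l) = (conf q, A2) \<or> l = B2 \<and> run (conf q) B c'"
    if "passage (copies G 6 C) (ext ` UNIV) (conf q, ext A2) (c', ext l)" for q c' l
    using routes_B(2)[of q c' "ext l"] that by (simp add: ends_B inj_ext)
  moreover have "(c', l) = (conf q, B1) \<or> l = A1 \<and> run (conf q) (opposite A) c'"
    if "passage (copies G 6 C) (ext ` UNIV) (conf q, ext B1) (c', ext l)" for q c' l
    using routes_oA(2)[of q c' "ext l"] that by (simp add: op ends_A inj_ext)
  moreover have "(c', l) = (conf q, B2) \<or> l = A2 \<and> run (conf q) (opposite B) c'"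
    if "passage (copies G 6 C) (ext ` UNIV) (conf q, ext B2) (c', ext l)" for q c' l
    using routes_oB(2)[of q c' "ext l"] that by (simp add: op ends_B inj_ext)
  ultimately have confine: "(c', l) = (conf q, l') \<or>
      (l', l) = (A1, B1) \<and> run (conf q) A c' \<or> (l', l) = (A2, B2) \<and> run (conf q) B c' \<or>
      (l', l) = (B1, A1) \<and> run (conf q) (opposite A) c' \<or> (l', l) = (B2, A2) \<and>
          run (conf q) (opposite B) c'"
    if "passage (copies G 6 C) (ext ` UNIV) (conf q, ext l') (c', ext l)" for q c' l l'
    using that by (cases l') blast+
  show ?thesis
  proof (rule toggle_simulationI[OF gadget reversible cyc disc])
    have "s0 \<noteq> s1" "x \<noteq> x'" using s(3,4) x(2,3) by auto
    then show "inj conf" by (auto simp: inj_def conf_def split: toggle_state.splits)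
    show "length (conf q) = 6 \<and> set (conf q) \<subseteq> states G" for q
      using config by (simp add: config_def)
    show "passage (copies G 6 C) (ext ` UNIV) (conf M, ext A1) (conf S1, ext B1)"
      using routes_A(1)[of M "conf S1"] runs(1) by (simp add: ends_A)
    show "passage (copies G 6 C) (ext ` UNIV) (conf M, ext A2) (conf S2, ext B2)"
      using routes_B(1)[of M "conf S2"] runs(2) by (simp add: ends_B)
    fix c' l
    show "(c', l) = (conf M, A1) \<or> (c', l) = (conf S1, B1)"
      if "passage (copies G 6 C) (ext ` UNIV) (conf M, ext A1) (c', ext l)"
      using confine[OF that] runs(1) by auto
    show "(c', l) = (conf M, A2) \<or> (c', l) = (conf S2, B2)"
      if "passage (copies G 6 C) (ext ` UNIV) (conf M, ext A2) (c', ext l)"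
      using confine[OF that] runs(2) by auto
    show "(c', l) = (conf S1, B1) \<or> (c', l) = (conf M, A1)"
      if "passage (copies G 6 C) (ext ` UNIV) (conf S1, ext B1) (c', ext l)"
      using confine[OF that] runs(3) by auto
    show "(c', l) = (conf S2, B2) \<or> (c', l) = (conf M, A2)"
      if "passage (copies G 6 C) (ext ` UNIV) (conf S2, ext B2) (c', ext l)"
      using confine[OF that] runs(4) by auto
    show "(c', l) = (conf q, l')"
      if "passage (copies G 6 C) (ext ` UNIV) (conf q, ext l') (c', ext l)"
        "(q, l') \<notin> {(M, A1), (M, A2), (S1, B1), (S2, B2)}" for q l'
      using confine[OF that(1)] that(2) runs(5-12) by (cases q) auto
  qed
qed

end

section \<open>All types of locking 2-toggles\<close>

context tunnel_gadget
begin

text \<open>Suppose no word in question blocks. Then every tunnel is traversable in both directions or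
  not at all, so that the traversals of \<open>{a, b}\<close> permute the states \<open>D1\<close> in which it is open, and
  running \<open>[(a, b), (e, f)]\<close> permutes the states \<open>U\<close> in which this is possible. Counting shows that
  traversing \<open>{a, b}\<close> preserves openness of \<open>{c, d}\<close>, contrary to \<open>s0\<close> and \<open>s1\<close>.\<close>

lemma blocking_word_exists:
  assumes s: "s0 \<in> states G" "(a, b, s1) \<in> transitions G s0" "(c, d, s2) \<in> transitions G s0"
    "\<And>t. (c, d, t) \<notin> transitions G s1"
    and ef: "(e, f) = (c, d) \<or> (e, f) = (d, c)"
  shows "\<exists>w x x'. w \<in> {[(a, b)], [(c, d)], [(d, c)], [(a, b), (e, f)]} \<and> x \<in> states G \<and>
    word_run x w x' \<and> (\<forall>t. \<not> word_run x' w t)"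
proof (rule ccontr)
  assume contra: "\<not> ?thesis"
  let ?blocks = ?thesis
  have rerun: "\<exists>t'. word_run t w t'"
    if "w \<in> {[(a, b)], [(c, d)], [(d, c)], [(a, b), (e, f)]}" "x \<in> states G" "word_run x w t" for w x t
  proof (rule ccontr)
    assume "\<nexists>t'. word_run t w t'"
    then have ?blocks using that by (intro exI[of _ w] exI[of _ x] exI[of _ t] conjI allI) simp_all
    with contra show False by contradiction
  qed
  define traversable where "traversable p q s \<longleftrightarrow> (\<exists>t. (p, q, t) \<in> transitions G s)" for p q s
  have single: "traversable p q t"
    if "x \<in> states G" "(p, q, t) \<in> transitions G x" "(p, q) \<in> {(a, b), (c, d), (d, c)}" for p q x t
  proof -
    have w: "[(p, q)] \<in> {[(a, b)], [(c, d)], [(d, c)], [(a, b), (e, f)]}" and r: "word_run x [(p, q)] t"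
      using that by auto
    from rerun[OF w that(1) r] show ?thesis by (auto simp: traversable_def)
  qed
  have double: "\<exists>t'. word_run t [(a, b), (e, f)] t'" if "x \<in> states G" "word_run x [(a, b), (e,
      f)] t" for x t
    using rerun[OF _ that] by simp
  define D1 where "D1 = {s \<in> states G. traversable a b s}"
  define D2 where "D2 = {s \<in> states G. traversable e f s}"
  define next1 where "next1 s = (THE t. (a, b, t) \<in> transitions G s)" for s
  define next2 where "next2 s = (THE t. (e, f, t) \<in> transitions G s)" for s
  have the_next: "(THE t. (p, q, t) \<in> transitions G s) = t"
    if "s \<in> states G" "(p, q, t) \<in> transitions G s" for p q s t
    using that transition_deterministic[OF that(1)] by (intro the_equality) blast+
  have next1: "(a, b, next1 s) \<in> transitions G s \<and> next1 s \<in> D1" if s: "s \<in> D1" for s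
  proof -
    obtain t where t: "s \<in> states G" "(a, b, t) \<in> transitions G s"
      using s by (auto simp: D1_def traversable_def)
    then show ?thesis
      using the_next[OF t] single[OF t] transition_closed[OF t] by (simp add: next1_def D1_def)
  qed
  have next2: "(e, f, next2 s) \<in> transitions G s \<and> next2 s \<in> D2" if s: "s \<in> D2" for s
  proof -
    obtain t where t: "s \<in> states G" "(e, f, t) \<in> transitions G s"
      using s by (auto simp: D2_def traversable_def)
    then show ?thesis
      using ef the_next[OF t] single[OF t] transition_closed[OF t] by (auto simp: next2_def D2_def)
  qed
  have inj: "s = s'" if "s \<in> states G" "s' \<in> states G" "(p, q, t) \<in> transitions G s"
    "(p, q, t) \<in> transitions G s'" for p q s s' t
    using transition_deterministic[of t q p s p s'] transition_reversible[OF that(1,3)]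
      transition_reversible[OF that(2,4)] transition_closed[OF that(1,3)] by blast
  have fin: "finite D1" "finite D2" using gadget by (auto simp: D1_def D2_def is_gadget_def)
  have inj1: "inj_on next1 D1"
    using next1 inj by (intro inj_onI) (metis (no_types, lifting) D1_def mem_Collect_eq)
  have "next1 ` D1 \<subseteq> D1" using next1 by blast
  then have surj1: "next1 ` D1 = D1" using endo_inj_surj[OF fin(1) _ inj1] by blast
  define U where "U = {s \<in> D1. next1 s \<in> D2}"
  have inj_U: "inj_on (next2 \<circ> next1) U"
  proof (rule inj_onI)
    fix s s' assume *: "s \<in> U" "s' \<in> U" "(next2 \<circ> next1) s = (next2 \<circ> next1) s'"
    then have "next1 s \<in> D2" "next1 s' \<in> D2" by (auto simp: U_def)
    then have "next1 s = next1 s'"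
      using * next2[of "next1 s"] next2[of "next1 s'"] inj by (auto simp: D2_def)
    then show "s = s'" using inj1 * by (auto simp: U_def dest: inj_onD)
  qed
  \<comment> \<open>After any run of the word it can be run again, by \<open>double\<close>, so the
    state reached is again in \<open>U\<close>.\<close>
  have "(next2 \<circ> next1) ` U \<subseteq> U"
  proof
    fix t assume "t \<in> (next2 \<circ> next1) ` U"
    then obtain s where s: "s \<in> D1" "next1 s \<in> D2" "t = next2 (next1 s)" by (auto simp: U_def)
    have "word_run s [(a, b), (e, f)] t" using next1[OF s(1)] next2[OF s(2)] s(3) by auto
    moreover have s_state: "s \<in> states G" using s(1) by (simp add: D1_def)
    ultimately obtain t' where "word_run t [(a, b), (e, f)] t'" using double by blast
    then obtain u where u: "(a, b, u) \<in> transitions G t" "(e, f, t') \<in> transitions G u" by auto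
    have t: "t \<in> states G" using next2[OF s(2)] s(3) by (simp add: D2_def)
    then have "t \<in> D1" using u(1) by (auto simp: D1_def traversable_def)
    moreover have "next1 t = u" unfolding next1_def by (rule the_next[OF t u(1)])
    moreover have "u \<in> D2" using u(2) transition_closed[OF t u(1)]
        by (auto simp: D2_def traversable_def)
    ultimately show "t \<in> U" by (simp add: U_def)
  qed
  moreover have "finite U" using fin(1) by (simp add: U_def)
  ultimately have "(next2 \<circ> next1) ` U = U" using endo_inj_surj inj_U by blast
  moreover have "(next2 \<circ> next1) ` U \<subseteq> D2" using next2 by (auto simp: U_def)
  \<comment> \<open>\<open>U\<close> is the image of itself under \<open>next1\<close> followed by
    \<open>next2\<close>, whose values lie in \<open>D2\<close>. On the other hand
    \<open>next1\<close> maps \<open>U\<close> bijectively onto the intersection of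
    \<open>D1\<close> and \<open>D2\<close>, so these finite sets are equally large and
    coincide.\<close>
  ultimately have "U \<subseteq> D1 \<inter> D2" by (auto simp: U_def)
  moreover have "next1 ` U = D1 \<inter> D2"
    using surj1 next1 by (auto simp: U_def)
  then have "card U = card (D1 \<inter> D2)"
    using card_image[OF inj_on_subset[OF inj1, of U]] by (auto simp: U_def)
  ultimately have "U = D1 \<inter> D2" using fin by (intro card_subset_eq) auto
  moreover have "traversable c d s0 \<and> traversable d c s0"
  proof -
    have "(d, c, s0) \<in> transitions G s2" "s2 \<in> states G"
      using transition_reversible[OF s(1,3)] transition_closed[OF s(1,3)] by auto
    then show ?thesis using single[of s2 d c s0] s(3) by (auto simp: traversable_def)
  qed
  then have "s0 \<in> D1 \<inter> D2" using s ef by (auto simp: D1_def D2_def traversable_def)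
  ultimately have "next1 s0 \<in> D2" by (auto simp: U_def)
  moreover have "next1 s0 = s1" unfolding next1_def by (rule the_next[OF s(1,2)])
  ultimately obtain t where t: "s1 \<in> states G" "(e, f, t) \<in> transitions G s1"
    by (auto simp: D2_def traversable_def)
  \<comment> \<open>For \<open>(e, f) = (c, d)\<close> this contradicts the blocking in
    \<open>s1\<close> at once. Otherwise reversing the crossing shows that \<open>s1\<close> is
    reached from \<open>t\<close> by going from \<open>c\<close> to \<open>d\<close>, which by
    \<open>single\<close> can be done once more.\<close>
  then have dc: "(d, c, t) \<in> transitions G s1" using ef s(4) by auto
  have "traversable c d s1"
    using single[of t c d s1] transition_reversible[OF t(1) dc] transition_closed[OF t(1) dc] by simp
  then show False using s(4) by (simp add: traversable_def)
qed

text \<open>A transition may open a direction of the other tunnel instead of closing it; its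
  reverse, available by reversibility, then closes that direction.\<close>

lemma interacting_tunnels_orientation:
  assumes "interacting_tunnels G P"
  obtains a b c d s0 s1 s2 where "{a, b} \<in> P" "{c, d} \<in> P" "{a, b} \<noteq> {c, d}" "s0 \<in> states G"
    "(a, b, s1) \<in> transitions G s0" "(c, d, s2) \<in> transitions G s0" "\<And>t. (c, d, t) \<notin> transitions G s1"
proof -
  obtain s a b s' T where s: "s \<in> states G" "(a, b, s') \<in> transitions G s" "T \<in> P" "T \<noteq> {a, b}"
    "allowed_directions G s T \<noteq> allowed_directions G s' T"
    using assms unfolding interacting_tunnels_def by blast
  have ab: "{a, b} \<in> P" "s' \<in> states G"
    using tunnels[OF s(1,2)] transition_closed[OF s(1,2)] by auto
  have rev: "(b, a, s) \<in> transitions G s'" by (rule transition_reversible[OF s(1,2)])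
  obtain c d where "((c, d) \<in> allowed_directions G s T) \<noteq> ((c, d) \<in> allowed_directions G s' T)"
    using s(5) by (metis set_eqI surj_pair)
  then have cd: "{c, d} = T"
    "(\<exists>t. (c, d, t) \<in> transitions G s) \<noteq> (\<exists>t. (c, d, t) \<in> transitions G s')"
    by (auto simp: allowed_directions_def)
  show ?thesis
  proof (cases "\<exists>t. (c, d, t) \<in> transitions G s")
    case True
    then show ?thesis using that[of a b c d s s'] ab s cd by auto
  next
    case False
    then show ?thesis using that[of b a c d s' s] ab s cd rev by (auto simp: insert_commute)
  qed
qed

text \<open>The choice between the two directions of the second tunnel in the word
  \<open>[(a, b), (e, f)]\<close> is a matter of planarity: \<open>e\<close> has to be an end next
  to \<open>b\<close>, so that the link inside the copy can be drawn.\<close>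

lemma toggle_from_arrangement:
  assumes T: "{a, b} \<in> P" "{c, d} \<in> P" "{a, b} \<noteq> {c, d}"
    and s: "s0 \<in> states G" "(a, b, s1) \<in> transitions G s0" "(c, d, s2) \<in> transitions G s0"
      "\<And>t. (c, d, t) \<notin> transitions G s1"
    and ef: "(e, f) = (c, d) \<or> (e, f) = (d, c)"
    and word_disc: "\<And>i. planar_disc (locs G) {i} {{(i, b), (i, e)}} [(i, a), (i, f)]"
    and B0: "B0 = [(0, c, d), (1, a, b)] \<or> B0 = [(1, a, b), (0, c, d)]"
    and cyc: "distinct cyc" "set cyc = UNIV"
    and core: "planar_disc (locs G) {0, 1} (links [(0, a, b), (1, c, d)] \<union> links B0)
        (map (case_toggle_loc (0, a) (1, d) (entry (hd B0)) (exit (last B0))) cyc)"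
  shows "disc_simulates G (locking_2_toggle cyc)"
proof -
  have abcd: "distinct [a, b, c, d]"
    using T tunnel_neq[OF T(1)] tunnel_neq[OF T(2)] disjoint[OF T] by auto
  obtain w x x' where w: "w \<in> {[(a, b)], [(c, d)], [(d, c)], [(a, b), (e, f)]}"
    and x: "x \<in> states G" "word_run x w x'" "\<And>t. \<not> word_run x' w t"
    using blocking_word_exists[OF s ef] by blast
  have locs: "a \<in> set (locs G)" "b \<in> set (locs G)" "c \<in> set (locs G)" "d \<in> set (locs G)"
    using transition_closed[OF s(1,2)] transition_closed[OF s(1,3)] by auto
  have pair: "planar_disc (locs G) {i} {} [(i, p), (i, q)]"
    if "p \<in> set (locs G)" "q \<in> set (locs G)" "p \<noteq> q" for i p q
    using that gadget by (intro planar_disc_pair) (auto simp: is_gadget_def)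
  show ?thesis
  proof (rule six_copies_simulate_toggle[OF T s _ _ _ x _ B0 cyc core])
    show "w \<noteq> []" using w by auto
    show "{p, q} \<in> P" if "(p, q) \<in> set w" for p q
      using that w T ef by (auto simp: insert_commute)
    show "distinct (map fst w @ map snd w)" using w abcd ef by auto
    show "planar_disc (locs G) {i} (links (word_at i w)) [(i, fst (hd w)), (i, snd (last w))]" for i
      using w pair[of _ _ i] locs abcd word_disc by (auto simp: word_at_def)
  qed
qed

text \<open>Both routes pass copy 0 first and leave it at \<open>b\<close> and \<open>d\<close>,
  which are neighbours. With copy 1 reflected, its entrances \<open>c\<close> and \<open>a\<close>
  face them, and the two links are nested.\<close>

lemma parallel_arrangement:
  assumes T: "{a, b} \<in> P" "{c, d} \<in> P" "{a, b} \<noteq> {c, d}"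
    and s: "s0 \<in> states G" "(a, b, s1) \<in> transitions G s0" "(c, d, s2) \<in> transitions G s0"
      "\<And>t. (c, d, t) \<notin> transitions G s1"
    and disc: "\<And>i. planar_disc (locs G) {i} {} (map (Pair i) [a, b, d, c])"
  shows "disc_simulates G parallel_locking_2_toggle"
  unfolding parallel_locking_2_toggle_def
proof (rule toggle_from_arrangement[OF T s, of d c "[(0, c, d), (1, a, b)]"])
  show "planar_disc (locs G) {i} {{(i, b), (i, d)}} [(i, a), (i, c)]" for i
    using planar_disc_drop_nth[OF planar_disc_drop_nth[OF planar_disc_connect_nth[OF disc[of i],
        of 1], of 1], of 1]
    by simp
  have X: "planar_disc (locs G) {0} {} [(0, c), (0, a), (0, b), (0, d)]"
    using planar_disc_rotate_nth[OF disc[of 0], of 3] by simp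
  have Y: "planar_disc (locs G) {1} {} [(1, a), (1, c), (1, d), (1, b)]"
    using planar_disc_rotate_nth[OF planar_disc.reverse[OF disc[of 1]], of 3] by simp
  note e = planar_disc.union[OF X Y, simplified]
  note e = planar_disc_drop_nth[OF planar_disc_connect_nth[OF e, of 3], of 4, simplified]
  note e = planar_disc_connect_nth[OF planar_disc_drop_nth[OF e, of 3], of 2, simplified]
  note e = planar_disc_drop_nth[OF planar_disc_drop_nth[OF e, of 3], of 2, simplified]
  show "planar_disc (locs G) {0, 1} (links [(0, a, b), (1, c, d)] \<union> links [(0, c, d), (1, a, b)])
    (map (case_toggle_loc (0, a) (1, d) (entry (hd [(0, c, d), (1, a, b)])) (exit (last [(0, c, d),
        (1, a, b)])))
      [A1, B1, B2, A2])"
    using planar_disc_rotate_nth[OF e, of 1] by (simp add: insert_commute)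
qed (auto simp: toggle_loc_UNIV)

text \<open>The routes pass the two copies in opposite orders, so both links join an end
  \<open>b\<close> with an end \<open>c\<close> of the other copy. These are neighbours in either
  cyclic order, and the links are nested.\<close>

lemma antiparallel_arrangement:
  assumes T: "{a, b} \<in> P" "{c, d} \<in> P" "{a, b} \<noteq> {c, d}"
    and s: "s0 \<in> states G" "(a, b, s1) \<in> transitions G s0" "(c, d, s2) \<in> transitions G s0"
      "\<And>t. (c, d, t) \<notin> transitions G s1"
    and disc: "(\<forall>i. planar_disc (locs G) {i} {} (map (Pair i) [a, b, c, d])) \<or>
      (\<forall>i. planar_disc (locs G) {i} {} (map (Pair i) [a, c, b, d]))"
  shows "disc_simulates G antiparallel_locking_2_toggle"
  unfolding antiparallel_locking_2_toggle_def
proof (rule toggle_from_arrangement[OF T s, of c d "[(1, a, b), (0, c, d)]"])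
  show "planar_disc (locs G) {i} {{(i, b), (i, c)}} [(i, a), (i, d)]" for i
    using disc planar_disc_drop_nth[OF planar_disc_drop_nth[OF planar_disc_connect_nth[of "locs G"
        "{i}" "{}" "map (Pair i) [a, b, c, d]" 1], of 1], of 1]
      planar_disc_drop_nth[OF planar_disc_drop_nth[OF planar_disc_connect_nth[of "locs G" "{i}" "{}"
          "map (Pair i) [a, c, b, d]" 1], of 1], of 1]
    by (auto simp: insert_commute)
  from disc have "planar_disc (locs G) {0, 1} {{(0, b), (1, c)}, {(1, b), (0, c)}} [(0, d), (0, a),
      (1, d), (1, a)]"
  proof
    assume d: "\<forall>i. planar_disc (locs G) {i} {} (map (Pair i) [a, b, c, d])"
    have X: "planar_disc (locs G) {0} {} [(0, d), (0, a), (0, b), (0, c)]"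
      using planar_disc_rotate_nth[OF d[rule_format, of 0], of 3] by simp
    have Y: "planar_disc (locs G) {1} {} [(1, b), (1, c), (1, d), (1, a)]"
      using planar_disc_rotate_nth[OF d[rule_format, of 1], of 1] by simp
    note e = planar_disc.union[OF X Y, simplified]
    note e = planar_disc_drop_nth[OF planar_disc_connect_nth[OF e, of 3], of 4, simplified]
    note e = planar_disc_connect_nth[OF planar_disc_drop_nth[OF e, of 3], of 2, simplified]
    note e = planar_disc_drop_nth[OF planar_disc_drop_nth[OF e, of 3], of 2, simplified]
    then show ?thesis by (simp add: insert_commute)
  next
    assume d: "\<forall>i. planar_disc (locs G) {i} {} (map (Pair i) [a, c, b, d])"
    have X: "planar_disc (locs G) {0} {} [(0, d), (0, a), (0, c), (0, b)]"
      using planar_disc_rotate_nth[OF d[rule_format, of 0], of 3] by simp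
    have Y: "planar_disc (locs G) {1} {} [(1, c), (1, b), (1, d), (1, a)]"
      using planar_disc_rotate_nth[OF d[rule_format, of 1], of 1] by simp
    note e = planar_disc.union[OF X Y, simplified]
    note e = planar_disc_drop_nth[OF planar_disc_connect_nth[OF e, of 3], of 4, simplified]
    note e = planar_disc_connect_nth[OF planar_disc_drop_nth[OF e, of 3], of 2, simplified]
    note e = planar_disc_drop_nth[OF planar_disc_drop_nth[OF e, of 3], of 2, simplified]
    then show ?thesis by (simp add: insert_commute)
  qed
  from planar_disc_rotate_nth[OF this, of 1]
  show "planar_disc (locs G) {0, 1} (links [(0, a, b), (1, c, d)] \<union> links [(1, a, b), (0, c, d)])
    (map (case_toggle_loc (0, a) (1, d) (entry (hd [(1, a, b), (0, c, d)])) (exit (last [(1, a, b),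
        (0, c, d)])))
      [A1, B1, A2, B2])"
    by (simp add: insert_commute)
qed (auto simp: toggle_loc_UNIV)

text \<open>In the crossing order \<open>b\<close> and \<open>d\<close> are neighbours and so are
  \<open>a\<close> and \<open>c\<close>, hence both routes can also pass copy 0 first, as with
  parallel tunnels.\<close>

lemma crossing_arrangement:
  assumes T: "{a, b} \<in> P" "{c, d} \<in> P" "{a, b} \<noteq> {c, d}"
    and s: "s0 \<in> states G" "(a, b, s1) \<in> transitions G s0" "(c, d, s2) \<in> transitions G s0"
      "\<And>t. (c, d, t) \<notin> transitions G s1"
    and disc: "\<And>i. planar_disc (locs G) {i} {} (map (Pair i) [a, c, b, d])"
  shows "disc_simulates G parallel_locking_2_toggle"
  unfolding parallel_locking_2_toggle_def
proof (rule toggle_from_arrangement[OF T s, of c d "[(0, c, d), (1, a, b)]"])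
  show "planar_disc (locs G) {i} {{(i, b), (i, c)}} [(i, a), (i, d)]" for i
    using planar_disc_drop_nth[OF planar_disc_drop_nth[OF planar_disc_connect_nth[OF disc[of i],
        of 1], of 1], of 1]
    by (simp add: insert_commute)
  note e = planar_disc.union[OF disc[of 0] disc[of 1], simplified]
  note e = planar_disc_drop_nth[OF planar_disc_connect_nth[OF e, of 3], of 4, simplified]
  note e = planar_disc_connect_nth[OF planar_disc_drop_nth[OF e, of 3], of 2, simplified]
  note e = planar_disc_drop_nth[OF planar_disc_drop_nth[OF e, of 3], of 2, simplified]
  show "planar_disc (locs G) {0, 1} (links [(0, a, b), (1, c, d)] \<union> links [(0, c, d), (1, a, b)])
    (map (case_toggle_loc (0, a) (1, d) (entry (hd [(0, c, d), (1, a, b)])) (exit (last [(0, c, d),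
        (1, a, b)])))
      [A1, B1, B2, A2])"
    using planar_disc_rotate_nth[OF planar_disc.reverse[OF e], of 3] by (simp add: insert_commute)
qed (auto simp: toggle_loc_UNIV)

end

text \<open>The toggle itself has interacting tunnels: from \<open>M\<close>, going from
  \<open>A1\<close> to \<open>B1\<close> leads to \<open>S1\<close>, where \<open>A2\<close> to
  \<open>B2\<close> is blocked.\<close>

lemma crossing_simulates_others:
  "disc_simulates crossing_locking_2_toggle parallel_locking_2_toggle"
  "disc_simulates crossing_locking_2_toggle antiparallel_locking_2_toggle"
proof -
  have G: "crossing_locking_2_toggle = locking_2_toggle [A1, A2, B1, B2]"
    by (simp add: crossing_locking_2_toggle_def)
  interpret tunnel_gadget crossing_locking_2_toggle "{{A1, B1}, {A2, B2}}"
  proof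
    show "is_gadget crossing_locking_2_toggle" by (rule toggle_gadgets)
    show "reversible crossing_locking_2_toggle" by (simp add: G locking_2_toggle_reversible)
    show "deterministic crossing_locking_2_toggle"
      by (auto simp: G deterministic_def single_valued_def transition_graph_def)
  qed (auto simp: G insert_commute)
  have disc: "planar_disc (locs crossing_locking_2_toggle) {i} {} (map (Pair i) [A1, A2, B1, B2])" for i
    using planar_disc.gadget[of "[A1, A2, B1, B2]" i] by (simp add: G)
  show "disc_simulates crossing_locking_2_toggle parallel_locking_2_toggle"
    "disc_simulates crossing_locking_2_toggle antiparallel_locking_2_toggle"
    using crossing_arrangement[of A1 B1 A2 B2 M S1 S2, OF _ _ _ _ _ _ _ disc]
      antiparallel_arrangement[of A1 B1 A2 B2 M S1 S2] disc
    by (simp_all add: G doubleton_eq_iff)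
qed

theorem theorem2p9:
  fixes G :: "('l, 's) gadget" and k :: nat and P :: "'l set set"
  assumes "k_tunnel_gadget k G P"
    and "reversible G"
    and "deterministic G"
    and "interacting_tunnels G P"
  shows "simulates_planar G parallel_locking_2_toggle
    \<and> simulates_planar G antiparallel_locking_2_toggle
    \<and> simulates_planar G crossing_locking_2_toggle"
proof -
  have gadget: "is_gadget G" using assms(1) by (simp add: k_tunnel_gadget_def)
  interpret tunnel_gadget G P
  proof
    show "is_gadget G" "reversible G" "deterministic G" using gadget assms by auto
    show "{a, b} \<in> P" if "s \<in> states G" "(a, b, s') \<in> transitions G s" for s a b s'
      using assms(1) that by (auto simp: k_tunnel_gadget_def)
    show "T \<inter> T' = {}" if "T \<in> P" "T' \<in> P" "T \<noteq> T'" for T T'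
      using assms(1) that by (auto simp: k_tunnel_gadget_def partition_on_def disjoint_def)
    show "card T = 2" if "T \<in> P" for T
      using assms(1) that by (auto simp: k_tunnel_gadget_def)
  qed
  obtain a b c d s0 s1 s2 where T: "{a, b} \<in> P" "{c, d} \<in> P" "{a, b} \<noteq> {c, d}"
    and s: "s0 \<in> states G" "(a, b, s1) \<in> transitions G s0" "(c, d, s2) \<in> transitions G s0"
      "\<And>t. (c, d, t) \<notin> transitions G s1"
    using interacting_tunnels_orientation[OF assms(4)] by metis
  have "{a, b, c, d} \<subseteq> set (locs G)" "distinct [a, b, c, d]"
    using transition_closed[OF s(1,2)] transition_closed[OF s(1,3)]
      tunnel_neq[OF T(1)] tunnel_neq[OF T(2)] disjoint[OF T] by auto
  \<comment> \<open>The crossing order is grouped with the antiparallel one, as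
    \<open>antiparallel_arrangement\<close> covers both.\<close>
  then consider "\<And>i. planar_disc (locs G) {i} {} (map (Pair i) [a, b, d, c])"
    | "(\<forall>i. planar_disc (locs G) {i} {} (map (Pair i) [a, b, c, d])) \<or>
       (\<forall>i. planar_disc (locs G) {i} {} (map (Pair i) [a, c, b, d]))"
    using planar_disc_two_tunnels[of "locs G" a b c d] gadget unfolding is_gadget_def by blast
  \<comment> \<open>The crossing toggle is obtained in every case; the other two types are then
    derived from it uniformly, including the one that the arrangement already provides.\<close>
  then have crossing: "disc_simulates G crossing_locking_2_toggle"
  proof cases
    case 1
    from parallel_arrangement[OF T s 1] show ?thesis
      by (rule disc_simulates_trans[OF _ parallel_simulates_crossing gadget toggle_gadgets(1)])
  next
    case 2
    from antiparallel_arrangement[OF T s 2] show ?thesis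
      by (rule disc_simulates_trans[OF _ antiparallel_simulates_crossing gadget toggle_gadgets(2)])
  qed
  note trans = disc_simulates_trans[OF crossing _ gadget toggle_gadgets(3)]
  show ?thesis
    using crossing trans[OF crossing_simulates_others(1)] trans[OF crossing_simulates_others(2)]
    by (intro conjI simulates_planar_if_disc_simulates[OF _ gadget] toggle_gadgets)
qed

end
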